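(* Let $\mathcal C=V(f)\subset\mathbb{C}^2$ be a generic curve through the origin defined by a polynomial $f$ with real coefficients. For every squarefree positive integer $d$, there exists at least one real $(d,d)$-interpolant of $\mathcal C$.
   Context: A $(d,d)$-interpolant of $V(f)$ is a curve which is the image of a generically one-to-one polynomial map $t\mapsto(x_1(t),x_2(t))$ with $\deg x_1=\deg x_2=d$, $x_1(0)=x_2(0)=0$, and $f(x_1(t),x_2(t))\equiv0\pmod{t^{2d}}$. It is real if it is the image of such a map with $x_1,x_2\in\mathbb{R}[t]$. "Generic" means the real coefficient vector of $f$ (on monomials of total degree at most $2d$) lies outside a proper Zariski closed subset. *)

theory Defs
  imports Complex_Main "HOL-Computational_Algebra.Polynomial" "HOL-Computational_Algebra.Squarefree"
begin

text \<open>A bivariate real polynomial f is represented by its coefficient function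
  c :: nat \<times> nat \<Rightarrow> real (c (i,j) is the coefficient of x1^i x2^j), with finite support.\<close>

definition biv_support :: "(nat \<times> nat \<Rightarrow> real) \<Rightarrow> (nat \<times> nat) set" where
  "biv_support c = {ij. c ij \<noteq> 0}"

definition biv_subst :: "(nat \<times> nat \<Rightarrow> real) \<Rightarrow> real poly \<Rightarrow> real poly \<Rightarrow> real poly" where
  "biv_subst c p q = (\<Sum>(i,j)\<in>biv_support c. smult (c (i,j)) (p ^ i * q ^ j))"

definition generically_injective :: "complex poly \<Rightarrow> complex poly \<Rightarrow> bool" where
  "generically_injective p q \<longleftrightarrow>
     finite {t::complex. \<exists>s. s \<noteq> t \<and> poly p s = poly p t \<and> poly q s = poly q t}"

definition real_dd_interpolant ::
    "(nat \<times> nat \<Rightarrow> real) \<Rightarrow> nat \<Rightarrow> real poly \<Rightarrow> real poly \<Rightarrow> bool" where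
  "real_dd_interpolant c d x1 x2 \<longleftrightarrow>
     degree x1 = d \<and> degree x2 = d \<and> poly x1 0 = 0 \<and> poly x2 0 = 0 \<and>
     generically_injective (map_poly of_real x1) (map_poly of_real x2) \<and>
     [:0, 1:] ^ (2 * d) dvd biv_subst c x1 x2"

definition coord_space :: "'i set \<Rightarrow> ('i \<Rightarrow> real) set" where
  "coord_space I = {x. \<forall>i. i \<notin> I \<longrightarrow> x i = 0}"

definition poly_fun :: "'i set \<Rightarrow> (('i \<Rightarrow> real) \<Rightarrow> real) \<Rightarrow> bool" where
  "poly_fun I p \<longleftrightarrow> (\<exists>S a. finite S \<and> (\<forall>\<alpha>\<in>S. \<forall>i. i \<notin> I \<longrightarrow> \<alpha> i = (0::nat)) \<and>
      p = (\<lambda>x. \<Sum>\<alpha>\<in>S. a \<alpha> * (\<Prod>i\<in>I. x i ^ \<alpha> i)))"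

definition zariski_closed_in :: "'i set \<Rightarrow> ('i \<Rightarrow> real) set \<Rightarrow> bool" where
  "zariski_closed_in I Z \<longleftrightarrow>
     (\<exists>P. (\<forall>p\<in>P. poly_fun I p) \<and> Z = {x \<in> coord_space I. \<forall>p\<in>P. p x = 0})"

text \<open>Monomials of total degree between 1 and 2d (f passes through the origin,
  so the constant coefficient is fixed to 0).\<close>
definition mon_set :: "nat \<Rightarrow> (nat \<times> nat) set" where
  "mon_set d = {(i,j). 0 < i + j \<and> i + j \<le> 2 * d}"

definition restrict_coeffs :: "(nat \<times> nat) set \<Rightarrow> (nat \<times> nat \<Rightarrow> real) \<Rightarrow> (nat \<times> nat \<Rightarrow> real)" where
  "restrict_coeffs M c = (\<lambda>ij. if ij \<in> M then c ij else 0)"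

end

theory Submission
  imports Defs "HOL-Analysis.Analysis" "HOL-Computational_Algebra.Fundamental_Theorem_Algebra"
begin

text \<open>
  Normalise an interpolant \<open>(p, q)\<close> by \<open>p\<^sub>d q\<^sub>d = -1\<close>; the \<open>2d\<close>-th roots of unity \<open>\<zeta>\<close> then act on the
  solutions by \<open>t \<mapsto> \<zeta> t\<close>, freely on the generically injective ones. For the conic \<open>x + y + x y\<close> the solutions
  are the factorisations \<open>(1 + p) (1 + q) = 1 - t\<^sup>2\<^sup>d\<close>, that is, the \<open>d\<close>-subsets of the \<open>2d\<close>-th roots of unity,
  all of them nondegenerate, and none escapes to infinity when the conic is perturbed. So the number of injective
  solutions is the same for all curves near the conic, and by elimination of quantifiers it is the same for
  a generic curve. For squarefree \<open>d\<close> the number of orbits, which is a number of aperiodic necklaces, is odd.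
  Complex conjugation therefore fixes an orbit of a generic real curve, and a fixed orbit contains a real arc.
\<close>

subsection \<open>Constructible sets\<close>

text \<open>A generic real curve may be far from the conic, and along a real path towards it the
  number of real solutions may change. So the count is taken over the complex numbers, where a
  constructible set contains or misses a nonempty principal open set, and a ball around the conic
  decides which. This is why every condition on an arc has to be expressible by polynomial equations
  and quantifiers over coordinates. Oddness of the number of orbits is used in this form: if no arc
  were conjugate to a rotation of itself, rotations and conjugation would act with orbits of size
  4d, so it suffices that 4d does not divide the number of arcs. At the conic, exchanging
  \<open>p\<close> and \<open>q\<close> commutes with rotations and leaves, modulo 4d, only the arcs
  with q(t) = p(-t). These are the antisymmetric necklaces, whose number is 2 modulo 4 for odd d and
  4 modulo 8 for even d. Squarefreeness enters through the parity of the number of divisors k with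
  d/k odd. The normalisation is -1 because that is the top coefficient of
  \<open>1 - t\<^sup>2\<^sup>d\<close>. A conjugation with factor z becomes trivial after
  substituting eta t with eta squared equal to z.\<close>

text \<open>The constants are real so that the exceptional set is defined over the reals.\<close>

inductive_set pfun :: "(('i \<Rightarrow> complex) \<Rightarrow> complex) set" where
  const: "(\<lambda>_. of_real r) \<in> pfun"
| var: "(\<lambda>v. v i) \<in> pfun"
| add: "f \<in> pfun \<Longrightarrow> g \<in> pfun \<Longrightarrow> (\<lambda>v. f v + g v) \<in> pfun"
| mult: "f \<in> pfun \<Longrightarrow> g \<in> pfun \<Longrightarrow> (\<lambda>v. f v * g v) \<in> pfun"

lemma pfun_0: "(\<lambda>_. 0) \<in> pfun" and pfun_1: "(\<lambda>_. 1) \<in> pfun"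
  using pfun.const[of 0] pfun.const[of 1] by simp_all

lemma pfun_uminus: "f \<in> pfun \<Longrightarrow> (\<lambda>v. - f v) \<in> pfun"
  using pfun.mult[OF pfun.const[of "-1"], of f] by simp

lemma pfun_diff: "f \<in> pfun \<Longrightarrow> g \<in> pfun \<Longrightarrow> (\<lambda>v. f v - g v) \<in> pfun"
  using pfun.add[OF _ pfun_uminus, of f g] by simp

lemma pfun_power: "f \<in> pfun \<Longrightarrow> (\<lambda>v. f v ^ n) \<in> pfun"
  by (induction n) (auto intro: pfun_1 pfun.mult)

lemma pfun_sum: "(\<And>x. x \<in> A \<Longrightarrow> f x \<in> pfun) \<Longrightarrow> (\<lambda>v. \<Sum>x\<in>A. f x v) \<in> pfun"
  by (induction A rule: infinite_finite_induct) (auto intro: pfun_0 pfun.add)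

inductive_set constructible :: "('i \<Rightarrow> complex) set set" where
  zero: "f \<in> pfun \<Longrightarrow> {v. f v = 0} \<in> constructible"
| compl: "S \<in> constructible \<Longrightarrow> - S \<in> constructible"
| inter: "S \<in> constructible \<Longrightarrow> T \<in> constructible \<Longrightarrow> S \<inter> T \<in> constructible"

lemma constructible_UNIV: "UNIV \<in> constructible"
  using constructible.zero[OF pfun_0] by simp

lemma constructible_empty: "{} \<in> constructible"
  using constructible.compl[OF constructible_UNIV] by simp

lemma constructible_union:
  "S \<in> constructible \<Longrightarrow> T \<in> constructible \<Longrightarrow> S \<union> T \<in> constructible"
  using constructible.compl[OF constructible.inter[OF constructible.compl constructible.compl], of S T]
  by simp

lemma constructible_eq:
  "f \<in> pfun \<Longrightarrow> g \<in> pfun \<Longrightarrow> {v. f v = g v} \<in> constructible"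
  using constructible.zero[OF pfun_diff, of f g] by simp

lemma constructible_not:
  "{v. P v} \<in> constructible \<Longrightarrow> {v. \<not> P v} \<in> constructible"
  using constructible.compl[of "{v. P v}"] by (simp add: Collect_neg_eq)

lemma constructible_neq:
  "f \<in> pfun \<Longrightarrow> g \<in> pfun \<Longrightarrow> {v. f v \<noteq> g v} \<in> constructible"
  by (intro constructible_not constructible_eq)

lemma constructible_conj:
  "{v. P v} \<in> constructible \<Longrightarrow> {v. Q v} \<in> constructible \<Longrightarrow> {v. P v \<and> Q v} \<in> constructible"
  using constructible.inter[of "{v. P v}" "{v. Q v}"] by (simp add: Collect_conj_eq)

lemma constructible_disj:
  "{v. P v} \<in> constructible \<Longrightarrow> {v. Q v} \<in> constructible \<Longrightarrow> {v. P v \<or> Q v} \<in> constructible"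
  using constructible_union[of "{v. P v}" "{v. Q v}"] by (simp add: Collect_disj_eq)

lemma constructible_ball:
  "finite A \<Longrightarrow> (\<And>x. x \<in> A \<Longrightarrow> {v. P x v} \<in> constructible) \<Longrightarrow> {v. \<forall>x\<in>A. P x v} \<in> constructible"
  by (induction A rule: finite_induct) (auto intro: constructible_UNIV constructible_conj)

lemma constructible_bex:
  "finite A \<Longrightarrow> (\<And>x. x \<in> A \<Longrightarrow> {v. P x v} \<in> constructible) \<Longrightarrow> {v. \<exists>x\<in>A. P x v} \<in> constructible"
  by (induction A rule: finite_induct) (auto intro: constructible_empty constructible_disj)

section \<open>One-variable polynomials with parameters in their coefficients\<close>

text \<open>The index counts coefficient slots: a strict degree bound, uniform in \<open>v\<close>,
  with index 0 for the zero family. The top slot may vanish at particular \<open>v\<close>, which is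
  why the elimination below branches on it.\<close>

definition pfun_polys :: "nat \<Rightarrow> (('i \<Rightarrow> complex) \<Rightarrow> complex poly) set" where
  "pfun_polys n = {F. (\<forall>v. \<forall>j\<ge>n. coeff (F v) j = 0) \<and> (\<forall>j. (\<lambda>v. coeff (F v) j) \<in> pfun)}"

lemma pfun_polys_mono: "F \<in> pfun_polys m \<Longrightarrow> m \<le> n \<Longrightarrow> F \<in> pfun_polys n"
  by (auto simp: pfun_polys_def)

lemma pfun_polys_add:
  "F \<in> pfun_polys n \<Longrightarrow> G \<in> pfun_polys n \<Longrightarrow> (\<lambda>v. F v + G v) \<in> pfun_polys n"
  by (auto simp: pfun_polys_def intro: pfun.add)

lemma pfun_polys_diff:
  "F \<in> pfun_polys n \<Longrightarrow> G \<in> pfun_polys n \<Longrightarrow> (\<lambda>v. F v - G v) \<in> pfun_polys n"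
  by (auto simp: pfun_polys_def intro: pfun_diff)

lemma pfun_polys_mult:
  assumes "F \<in> pfun_polys m" "G \<in> pfun_polys n"
  shows "(\<lambda>v. F v * G v) \<in> pfun_polys (m + n)"
proof -
  have "coeff (F v) i * coeff (G v) (j - i) = 0" if "j \<ge> m + n" for v i j
    using assms that by (cases "i \<ge> m") (auto simp: pfun_polys_def)
  then have "coeff (F v * G v) j = 0" if "j \<ge> m + n" for v j
    unfolding coeff_mult using that by (intro sum.neutral ballI) blast
  moreover have "(\<lambda>v. coeff (F v * G v) j) \<in> pfun" for j
    using assms by (auto simp: pfun_polys_def coeff_mult intro!: pfun_sum pfun.mult)
  ultimately show ?thesis by (simp add: pfun_polys_def)
qed

lemma pfun_polys_monom:
  assumes "f \<in> pfun"
  shows "(\<lambda>v. monom (f v) k) \<in> pfun_polys (Suc k)"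
proof -
  have "(\<lambda>v. coeff (monom (f v) k) j) \<in> pfun" for j
    using assms by (cases "k = j") (simp_all add: pfun_0)
  then show ?thesis by (simp add: pfun_polys_def)
qed

lemma pfun_polys_smult:
  assumes "f \<in> pfun" "F \<in> pfun_polys n"
  shows "(\<lambda>v. smult (f v) (F v)) \<in> pfun_polys n"
  using assms by (auto simp: pfun_polys_def intro: pfun.mult)

lemma pfun_polys_power:
  assumes "F \<in> pfun_polys n"
  shows "(\<lambda>v. F v ^ k) \<in> pfun_polys (Suc (k * n))"
proof (induction k)
  case 0
  show ?case using pfun_polys_monom[OF pfun_1, of 0] by (simp add: monom_0 one_pCons)
next
  case (Suc k)
  from pfun_polys_mult[OF assms Suc.IH] show ?case by (simp add: add.commute)
qed

lemma pfun_polys_coeff: "F \<in> pfun_polys n \<Longrightarrow> (\<lambda>v. coeff (F v) j) \<in> pfun"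
  by (simp add: pfun_polys_def)

lemma pfun_polys_degree: "F \<in> pfun_polys (Suc n) \<Longrightarrow> degree (F v) \<le> n"
  by (auto simp: pfun_polys_def Suc_le_eq intro!: degree_le)

lemma poly_eq_sum:
  fixes p :: "'a :: comm_ring_1 poly"
  assumes "degree p \<le> n"
  shows "poly p x = (\<Sum>j\<le>n. coeff p j * x ^ j)"
  by (subst poly_as_sum_of_monoms'[OF assms, symmetric]) (simp add: poly_sum poly_monom)

lemma pfun_polys_poly:
  assumes "F \<in> pfun_polys n" "f \<in> pfun"
  shows "(\<lambda>v. poly (F v) (f v)) \<in> pfun"
proof -
  have "poly (F v) (f v) = (\<Sum>j\<le>n. coeff (F v) j * f v ^ j)" for v
    using assms by (intro poly_eq_sum degree_le) (auto simp: pfun_polys_def)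
  then show ?thesis
    using assms by (auto simp: pfun_polys_def intro!: pfun_sum pfun.mult pfun_power)
qed

text \<open>Division without inverting the formal leading coefficient of \<open>F\<close>: each step
  multiplies by that coefficient and cancels the top slot, and \<open>k\<close> counts the steps.
  The identity holds at every \<open>v\<close>, also where the coefficient vanishes.\<close>

lemma pseudo_remainder:
  assumes "F \<in> pfun_polys (Suc b)" "H \<in> pfun_polys h"
  shows "\<exists>R\<in>pfun_polys b. \<exists>k. \<forall>v. \<exists>Q. smult (coeff (F v) b ^ k) (H v) = Q * F v + R v"
  using assms(2)
proof (induction h arbitrary: H)
  case 0
  then show ?case by (intro bexI[of _ H] exI[of _ 0] allI exI[of _ 0]) (auto intro: pfun_polys_mono)
next
  case (Suc h)
  show ?case
  proof (cases "h < b")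
    case True
    with Suc.prems show ?thesis
      by (intro bexI[of _ H] exI[of _ 0] allI exI[of _ 0]) (auto intro: pfun_polys_mono)
  next
    case False
    define H' where "H' v = smult (coeff (F v) b) (H v) - monom (coeff (H v) h) (h - b) * F v" for v
    have "H' \<in> pfun_polys h"
    proof -
      have 1: "coeff (H' v) j = 0" if "j \<ge> h" for v j
        using that False assms(1) Suc.prems
        by (cases "j = h") (auto simp: H'_def coeff_monom_mult pfun_polys_def)
      \<comment> \<open>This crude index records that the coefficients of \<open>H'\<close> lie in
        \<open>pfun\<close>; the sharp index \<open>h\<close> comes from the cancellation just
        shown.\<close>
      have "H' \<in> pfun_polys (Suc h + (Suc (h - b) + Suc b))"
        unfolding H'_def using assms(1) Suc.prems
        by (intro pfun_polys_diff pfun_polys_mono[OF pfun_polys_smult[of "\<lambda>v. coeff (F v) b" H "Suc h"]]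
              pfun_polys_mono[OF pfun_polys_mult[OF pfun_polys_monom assms(1)]] pfun_polys_coeff) auto
      with 1 show ?thesis by (auto simp: pfun_polys_def)
    qed
    from Suc.IH[OF this] obtain R k where R: "R \<in> pfun_polys b"
      and k: "\<And>v. \<exists>Q. smult (coeff (F v) b ^ k) (H' v) = Q * F v + R v" by blast
    show ?thesis
    proof (intro bexI[OF _ R] exI[of _ "Suc k"] allI)
      fix v
      from k[of v] obtain Q where Q: "smult (coeff (F v) b ^ k) (H' v) = Q * F v + R v" by blast
      have "smult (coeff (F v) b ^ Suc k) (H v)
          = smult (coeff (F v) b ^ k) (H' v + monom (coeff (H v) h) (h - b) * F v)"
        by (simp add: H'_def mult.commute)
      also have "\<dots> = (Q + smult (coeff (F v) b ^ k) (monom (coeff (H v) h) (h - b))) * F v + R v"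
        by (simp add: smult_add_right Q algebra_simps)
      finally show "\<exists>Q. smult (coeff (F v) b ^ Suc k) (H v) = Q * F v + R v" by blast
    qed
  qed
qed

lemma constructible_poly_eq_0:
  assumes "F \<in> pfun_polys n"
  shows "{v. F v = 0} \<in> constructible"
proof -
  have "{v. F v = 0} = {v. \<forall>j\<in>{..<n}. coeff (F v) j = 0}"
    using assms by (auto simp: pfun_polys_def poly_eq_iff) (metis lessThan_iff not_less)
  also have "\<dots> \<in> constructible"
    using assms by (intro constructible_ball) (auto simp: pfun_polys_def intro: constructible.zero)
  finally show ?thesis .
qed

text \<open>Euclid's algorithm with parameters. Two equations are reduced to smaller ones after a
  case split on a leading coefficient; a single equation \<open>F = 0\<close> with
  \<open>G \<noteq> 0\<close> is decided by whether \<open>F\<close> divides a power of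
  \<open>G\<close>. The \<open>Suc\<close> in the measure makes the removal of a zero polynomial a
  descent.\<close>

lemma constructible_common_root:
  assumes "\<forall>(n, F)\<in>set L. F \<in> pfun_polys n" "G \<in> pfun_polys m"
  shows "{v. \<exists>x. (\<forall>(n, F)\<in>set L. poly (F v) x = 0) \<and> poly (G v) x \<noteq> 0} \<in> constructible"
  using assms(1)
proof (induction "sum_list (map (Suc \<circ> fst) L)" arbitrary: L rule: less_induct)
  case less
  let ?S = "\<lambda>L. {v. \<exists>x. (\<forall>(n, F)\<in>set L. poly (F v) x = 0) \<and> poly (G v) x \<noteq> 0}"
  let ?\<mu> = "\<lambda>L :: (nat \<times> (('a \<Rightarrow> complex) \<Rightarrow> complex poly)) list. sum_list (map (Suc \<circ> fst) L)"
  have zero_head: "?S ((0, F) # L') \<in> constructible"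
    if "?\<mu> ((0, F) # L') = ?\<mu> L" "F \<in> pfun_polys 0" "\<forall>(n, F)\<in>set L'. F \<in> pfun_polys n" for F L'
  proof -
    have "F v = 0" for v using that(2) by (auto simp: pfun_polys_def poly_eq_iff)
    then have "?S ((0, F) # L') = ?S L'" by simp
    also have "\<dots> \<in> constructible" using that by (intro less.hyps) auto
    finally show ?thesis .
  qed
  have drop_lead: "{v. coeff (F v) b = 0} \<inter> ?S ((Suc b, F) # L') \<in> constructible"
    if "?\<mu> ((Suc b, F) # L') = ?\<mu> L" "F \<in> pfun_polys (Suc b)"
       "\<forall>(n, F)\<in>set L'. F \<in> pfun_polys n" for F L' b
  proof -
    define F' where "F' v = F v - monom (coeff (F v) b) b" for v
    have "F' \<in> pfun_polys (Suc b)" unfolding F'_def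
      using that by (intro pfun_polys_diff pfun_polys_monom pfun_polys_coeff) auto
    moreover have "coeff (F' v) b = 0" for v by (simp add: F'_def)
    ultimately have F': "F' \<in> pfun_polys b"
      by (auto simp: pfun_polys_def le_eq_less_or_eq[of b] Suc_le_eq)
    have "{v. coeff (F v) b = 0} \<inter> ?S ((Suc b, F) # L') = {v. coeff (F v) b = 0} \<inter> ?S ((b, F') # L')"
    proof -
      have "F' v = F v" if "coeff (F v) b = 0" for v using that by (simp add: F'_def)
      then show ?thesis by (intro set_eqI) (simp cong: conj_cong)
    qed
    also have "?S ((b, F') # L') \<in> constructible"
      using that F' by (intro less.hyps) auto
    then have "{v. coeff (F v) b = 0} \<inter> ?S ((b, F') # L') \<in> constructible"
      using that by (intro constructible.inter constructible.zero pfun_polys_coeff) auto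
    finally show ?thesis .
  qed
  \<comment> \<open>Where the leading coefficient of the formally smaller \<open>F\<close> is
    nonzero, it cancels the top slot of \<open>H\<close> without changing the common roots; where it
    vanishes, \<open>drop_lead\<close> shortens \<open>F\<close>.\<close>
  have two: "?S ((a, F) # (b, H) # L') \<in> constructible"
    if le: "a \<le> b" and "?\<mu> ((a, F) # (b, H) # L') = ?\<mu> L" "F \<in> pfun_polys a" "H \<in> pfun_polys b"
       "\<forall>(n, F)\<in>set L'. F \<in> pfun_polys n" for a b F H L'
  proof (cases a)
    case 0
    then show ?thesis using that zero_head[of F "(b, H) # L'"] by auto
  next
    case (Suc a')
    then obtain b' where b': "b = Suc b'" "a' \<le> b'" using le by (cases b) auto
    define H' where "H' v = smult (coeff (F v) a') (H v) - monom (coeff (H v) b') (b' - a') * F v" for v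
    have F: "F \<in> pfun_polys (Suc a')" and H: "H \<in> pfun_polys (Suc b')" using that Suc b' by auto
    have "coeff (H' v) j = 0" if "j \<ge> b'" for v j
      using that b' F H by (cases "j = b'") (auto simp: H'_def coeff_monom_mult pfun_polys_def)
    moreover have "H' \<in> pfun_polys (Suc b' + (Suc (b' - a') + Suc a'))"
      unfolding H'_def using F H
      by (intro pfun_polys_diff pfun_polys_mono[OF pfun_polys_smult[of "\<lambda>v. coeff (F v) a'" H "Suc b'"]]
            pfun_polys_mono[OF pfun_polys_mult[OF pfun_polys_monom F]] pfun_polys_coeff) auto
    ultimately have H': "H' \<in> pfun_polys b'" by (auto simp: pfun_polys_def)
    have "?S ((a, F) # (b', H') # L') \<in> constructible"
      using that H' b' by (intro less.hyps) auto
    then have "{v. coeff (F v) a' \<noteq> 0} \<inter> ?S ((a, F) # (b', H') # L') \<in> constructible"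
      using F by (intro constructible.inter constructible_not constructible.zero pfun_polys_coeff)
    also have "{v. coeff (F v) a' \<noteq> 0} \<inter> ?S ((a, F) # (b', H') # L')
             = {v. coeff (F v) a' \<noteq> 0} \<inter> ?S ((a, F) # (b, H) # L')"
    proof -
      have "(poly (F v) x = 0 \<and> poly (H' v) x = 0 \<and> P) \<longleftrightarrow> (poly (F v) x = 0 \<and> poly (H v) x = 0 \<and> P)"
        if "coeff (F v) a' \<noteq> 0" for v x P
        using that by (auto simp: H'_def)
      then show ?thesis by (intro set_eqI) (simp cong: conj_cong)
    qed
    finally have "{v. coeff (F v) a' \<noteq> 0} \<inter> ?S ((a, F) # (b, H) # L') \<in> constructible" .
    moreover have "{v. coeff (F v) a' = 0} \<inter> ?S ((a, F) # (b, H) # L') \<in> constructible"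
      using drop_lead[of a' F "(b, H) # L'"] that F Suc by auto
    ultimately have "({v. coeff (F v) a' \<noteq> 0} \<inter> ?S ((a, F) # (b, H) # L')) \<union>
        ({v. coeff (F v) a' = 0} \<inter> ?S ((a, F) # (b, H) # L')) \<in> constructible"
      by (rule constructible_union)
    also have "({v. coeff (F v) a' \<noteq> 0} \<inter> ?S ((a, F) # (b, H) # L')) \<union>
        ({v. coeff (F v) a' = 0} \<inter> ?S ((a, F) # (b, H) # L')) = ?S ((a, F) # (b, H) # L')" by blast
    finally show ?thesis .
  qed
  consider "L = []" | n F where "L = [(n, F)]" | a F b H L' where "L = (a, F) # (b, H) # L'"
    by (metis list.exhaust surj_pair)
  then show ?case
  proof cases
    case 1
    have "?S L = - {v. G v = 0}"
      using 1 by (simp add: basic_cqe_conv_2b Collect_neg_eq)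
    then show ?thesis using constructible.compl[OF constructible_poly_eq_0[OF assms(2)]] by simp
  next
    case (2 n F)
    show ?thesis
    proof (cases n)
      case 0
      then show ?thesis using 2 less.prems zero_head[of F "[]"] by auto
    next
      case (Suc b)
      have F: "F \<in> pfun_polys (Suc b)" using 2 Suc less.prems by auto
      \<comment> \<open>When its top coefficient is nonzero, \<open>F v\<close> has degree
        \<open>b\<close>, which bounds every root multiplicity. Hence all roots of
        \<open>F v\<close> are roots of \<open>G v\<close> exactly if \<open>F v\<close> divides
        \<open>G v ^ b\<close>, that is, if this remainder vanishes.\<close>
      from pseudo_remainder[OF F pfun_polys_power[OF assms(2), of b]] obtain R k where R: "R \<in> pfun_polys b"
        and k: "\<And>v. \<exists>Q. smult (coeff (F v) b ^ k) (G v ^ b) = Q * F v + R v" by blast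
      have eq: "v \<in> ?S L \<longleftrightarrow> R v \<noteq> 0" if lc: "coeff (F v) b \<noteq> 0" for v
      proof -
        have deg: "degree (F v) = b" using lc pfun_polys_degree[OF F, of v]
          by (simp add: le_antisym le_degree)
        have nz: "F v \<noteq> 0" using lc by auto
        have "v \<in> ?S L \<longleftrightarrow> \<not> F v dvd G v ^ b"
          using nullstellensatz_univariate[of "F v" "G v"] nz 2 deg by auto
        also have "F v dvd G v ^ b \<longleftrightarrow> F v dvd smult (coeff (F v) b ^ k) (G v ^ b)"
          using lc by (simp add: dvd_smult_iff)
        also obtain Q where "smult (coeff (F v) b ^ k) (G v ^ b) = Q * F v + R v" using k by blast
        then have "F v dvd smult (coeff (F v) b ^ k) (G v ^ b) \<longleftrightarrow> F v dvd R v"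
          by (simp add: dvd_add_right_iff)
        also have "\<dots> \<longleftrightarrow> R v = 0"
        proof
          assume "F v dvd R v"
          show "R v = 0"
          proof (rule ccontr)
            assume "R v \<noteq> 0"
            with \<open>F v dvd R v\<close> have "b \<le> degree (R v)" using dvd_imp_degree_le deg by blast
            then have "coeff (R v) (degree (R v)) = 0" using R by (auto simp: pfun_polys_def)
            with \<open>R v \<noteq> 0\<close> show False by simp
          qed
        qed auto
        finally show ?thesis .
      qed
      have "{v. coeff (F v) b = 0} \<inter> ?S L \<in> constructible"
        using drop_lead[of b F "[]"] F 2 Suc by auto
      moreover have "{v. coeff (F v) b \<noteq> 0} \<inter> {v. R v \<noteq> 0} \<in> constructible"
        using F R by (intro constructible.inter constructible_not constructible.zero
            pfun_polys_coeff constructible_poly_eq_0)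
      ultimately have "({v. coeff (F v) b = 0} \<inter> ?S L) \<union> ({v. coeff (F v) b \<noteq> 0} \<inter> {v. R v \<noteq> 0})
          \<in> constructible" by (rule constructible_union)
      also have "({v. coeff (F v) b = 0} \<inter> ?S L) \<union> ({v. coeff (F v) b \<noteq> 0} \<inter> {v. R v \<noteq> 0}) = ?S L"
        using eq by blast
      finally show ?thesis .
    qed
  next
    case (3 a F b H L')
    show ?thesis
    proof (cases "a \<le> b")
      case True
      then show ?thesis using two[of a b F H L'] 3 less.prems by auto
    next
      case False
      have "?S ((b, H) # (a, F) # L') \<in> constructible"
        using False 3 less.prems by (intro two) auto
      also have "?S ((b, H) # (a, F) # L') = ?S L" unfolding 3 by auto
      finally show ?thesis .
    qed
  qed
qed

lemma pfun_upd:
  assumes "f \<in> pfun"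
  shows "\<exists>n. \<exists>F\<in>pfun_polys n. \<forall>v x. f (v(i := x)) = poly (F v) x"
  using assms
proof induction
  case (const r)
  show ?case
    by (intro exI[of _ "Suc 0"] bexI[OF _ pfun_polys_monom[OF pfun.const[of r]]]) (auto simp: monom_0)
next
  case (var j)
  show ?case
  proof (cases "j = i")
    case True
    then show ?thesis
      by (intro exI[of _ "Suc 1"] bexI[OF _ pfun_polys_monom[OF pfun_1]]) (auto simp: poly_monom)
  next
    case False
    then show ?thesis
      by (intro exI[of _ "Suc 0"] bexI[OF _ pfun_polys_monom[OF pfun.var[of j]]]) (auto simp: monom_0)
  qed
next
  case (add f g)
  then obtain m F n G where "F \<in> pfun_polys m" "G \<in> pfun_polys n"
    and *: "\<And>v x. f (v(i := x)) = poly (F v) x" "\<And>v x. g (v(i := x)) = poly (G v) x" by blast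
  then have "(\<lambda>v. F v + G v) \<in> pfun_polys (m + n)"
    by (intro pfun_polys_add) (auto intro: pfun_polys_mono)
  moreover have "f (v(i := x)) + g (v(i := x)) = poly (F v + G v) x" for v x
    by (simp only: * poly_add)
  ultimately show ?case by (intro exI[of _ "m + n"] bexI[of _ "\<lambda>v. F v + G v"] allI)
next
  case (mult f g)
  then obtain m F n G where "F \<in> pfun_polys m" "G \<in> pfun_polys n"
    and *: "\<And>v x. f (v(i := x)) = poly (F v) x" "\<And>v x. g (v(i := x)) = poly (G v) x" by blast
  then have "(\<lambda>v. F v * G v) \<in> pfun_polys (m + n)"
    by (intro pfun_polys_mult)
  moreover have "f (v(i := x)) * g (v(i := x)) = poly (F v * G v) x" for v x
    by (simp only: * poly_mult)
  ultimately show ?case by (intro exI[of _ "m + n"] bexI[of _ "\<lambda>v. F v * G v"] allI)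
qed

section \<open>Disjunctive normal form and elimination of quantifiers\<close>

text \<open>One inequation suffices because several can be multiplied together. This is the shape
  that \<open>constructible_common_root\<close> can handle.\<close>

definition basic_set :: "(('i \<Rightarrow> complex) \<Rightarrow> complex) list \<Rightarrow> (('i \<Rightarrow> complex) \<Rightarrow> complex) \<Rightarrow> ('i \<Rightarrow> complex) set" where
  "basic_set fs g = {v. (\<forall>f\<in>set fs. f v = 0) \<and> g v \<noteq> 0}"

definition union_of_basic :: "('i \<Rightarrow> complex) set \<Rightarrow> bool" where
  "union_of_basic S \<longleftrightarrow> (\<exists>B. finite B \<and> (\<forall>b\<in>B. set (fst b) \<subseteq> pfun \<and> snd b \<in> pfun) \<and>
     S = (\<Union>b\<in>B. basic_set (fst b) (snd b)))"

lemma union_of_basicI: "set fs \<subseteq> pfun \<Longrightarrow> g \<in> pfun \<Longrightarrow> S = basic_set fs g \<Longrightarrow> union_of_basic S"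
  unfolding union_of_basic_def by (intro exI[of _ "{(fs, g)}"]) auto

lemma union_of_basicE:
  assumes "union_of_basic S"
  obtains B where "finite B" "\<And>b. b \<in> B \<Longrightarrow> set (fst b) \<subseteq> pfun" "\<And>b. b \<in> B \<Longrightarrow> snd b \<in> pfun"
    "S = (\<Union>b\<in>B. basic_set (fst b) (snd b))"
proof -
  from assms obtain B where "finite B \<and> (\<forall>b\<in>B. set (fst b) \<subseteq> pfun \<and> snd b \<in> pfun) \<and>
     S = (\<Union>b\<in>B. basic_set (fst b) (snd b))" unfolding union_of_basic_def ..
  then show ?thesis by (intro that[of B]) simp_all
qed

lemma union_of_basic_Un:
  assumes "union_of_basic S" "union_of_basic T"
  shows "union_of_basic (S \<union> T)"
proof (rule union_of_basicE[OF assms(1)], rule union_of_basicE[OF assms(2)])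
  fix A B :: "((('a \<Rightarrow> complex) \<Rightarrow> complex) list \<times> (('a \<Rightarrow> complex) \<Rightarrow> complex)) set"
  assume A: "finite A" "\<And>b. b \<in> A \<Longrightarrow> set (fst b) \<subseteq> pfun" "\<And>b. b \<in> A \<Longrightarrow> snd b \<in> pfun"
      "S = (\<Union>b\<in>A. basic_set (fst b) (snd b))"
    and B: "finite B" "\<And>b. b \<in> B \<Longrightarrow> set (fst b) \<subseteq> pfun" "\<And>b. b \<in> B \<Longrightarrow> snd b \<in> pfun"
      "T = (\<Union>b\<in>B. basic_set (fst b) (snd b))"
  show ?thesis
    unfolding union_of_basic_def A(4) B(4)
    by (intro exI[of _ "A \<union> B"] conjI ballI)
      ((use A(1) B(1) in simp), (use A(2,3) B(2,3) in blast)+)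
qed

lemma union_of_basic_UN:
  "finite A \<Longrightarrow> (\<And>x. x \<in> A \<Longrightarrow> union_of_basic (S x)) \<Longrightarrow> union_of_basic (\<Union>x\<in>A. S x)"
proof (induction A rule: finite_induct)
  case empty
  then show ?case unfolding union_of_basic_def by (intro exI[of _ "{}"]) auto
next
  case (insert a A)
  then show ?case by (simp add: union_of_basic_Un)
qed

lemma union_of_basic_Int:
  assumes "union_of_basic S" "union_of_basic T"
  shows "union_of_basic (S \<inter> T)"
proof (rule union_of_basicE[OF assms(1)], rule union_of_basicE[OF assms(2)])
  fix A B :: "((('a \<Rightarrow> complex) \<Rightarrow> complex) list \<times> (('a \<Rightarrow> complex) \<Rightarrow> complex)) set"
  assume A: "finite A" "\<And>b. b \<in> A \<Longrightarrow> set (fst b) \<subseteq> pfun" "\<And>b. b \<in> A \<Longrightarrow> snd b \<in> pfun"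
      "S = (\<Union>b\<in>A. basic_set (fst b) (snd b))"
    and B: "finite B" "\<And>b. b \<in> B \<Longrightarrow> set (fst b) \<subseteq> pfun" "\<And>b. b \<in> B \<Longrightarrow> snd b \<in> pfun"
      "T = (\<Union>b\<in>B. basic_set (fst b) (snd b))"
  have *: "basic_set fs g \<inter> basic_set fs' g' = basic_set (fs @ fs') (\<lambda>v. g v * g' v)"
    for fs fs' :: "(('a \<Rightarrow> complex) \<Rightarrow> complex) list" and g g'
    by (auto simp: basic_set_def)
  have "S \<inter> T = (\<Union>a\<in>A. \<Union>b\<in>B. basic_set (fst a) (snd a) \<inter> basic_set (fst b) (snd b))"
    unfolding A(4) B(4) by blast
  moreover have "union_of_basic (\<Union>a\<in>A. \<Union>b\<in>B. basic_set (fst a) (snd a) \<inter> basic_set (fst b) (snd b))"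
  proof (intro union_of_basic_UN A(1) B(1))
    fix a b assume "a \<in> A" "b \<in> B"
    with A(2,3) B(2,3) show "union_of_basic (basic_set (fst a) (snd a) \<inter> basic_set (fst b) (snd b))"
      by (intro union_of_basicI[OF _ _ *] pfun.mult) (simp_all only: set_append Un_subset_iff simp_thms)
  qed
  ultimately show ?thesis by simp
qed

lemma union_of_basic_Compl:
  assumes "union_of_basic S"
  shows "union_of_basic (- S)"
proof (rule union_of_basicE[OF assms])
  fix A :: "((('a \<Rightarrow> complex) \<Rightarrow> complex) list \<times> (('a \<Rightarrow> complex) \<Rightarrow> complex)) set"
  assume A: "finite A" "\<And>b. b \<in> A \<Longrightarrow> set (fst b) \<subseteq> pfun" "\<And>b. b \<in> A \<Longrightarrow> snd b \<in> pfun"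
      "S = (\<Union>b\<in>A. basic_set (fst b) (snd b))"
  have basic: "union_of_basic (- basic_set fs g)" if "set fs \<subseteq> pfun" "g \<in> pfun"
    for fs and g :: "('a \<Rightarrow> complex) \<Rightarrow> complex"
  proof -
    have "- basic_set fs g = basic_set [g] (\<lambda>_. 1) \<union> (\<Union>f\<in>set fs. basic_set [] f)"
      by (auto simp: basic_set_def)
    moreover have "union_of_basic (basic_set [g] (\<lambda>_. 1) \<union> (\<Union>f\<in>set fs. basic_set [] f))"
      using that pfun_1 by (intro union_of_basic_Un union_of_basic_UN)
        (auto intro: union_of_basicI[of "[g]" "\<lambda>_. 1"] union_of_basicI[of "[]"])
    ultimately show ?thesis by simp
  qed
  from A(1-3) have "union_of_basic (- (\<Union>b\<in>A. basic_set (fst b) (snd b)))"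
  proof (induction A rule: finite_induct)
    case empty
    then show ?case using pfun_1 by (intro union_of_basicI[of "[]" "\<lambda>_. 1"]) (auto simp: basic_set_def)
  next
    case (insert a A)
    then have "union_of_basic (- basic_set (fst a) (snd a) \<inter> - (\<Union>b\<in>A. basic_set (fst b) (snd b)))"
      by (intro union_of_basic_Int basic) auto
    then show ?case by simp
  qed
  with A(4) show ?thesis by simp
qed

lemma constructible_imp_union_of_basic: "S \<in> constructible \<Longrightarrow> union_of_basic S"
proof (induction rule: constructible.induct)
  case (zero f)
  then show ?case using pfun_1 by (intro union_of_basicI[of "[f]" "\<lambda>_. 1"]) (auto simp: basic_set_def)
next
  case (compl S)
  show ?case by (rule union_of_basic_Compl[OF compl.IH])
next
  case (inter S T)
  show ?case by (rule union_of_basic_Int[OF inter.IH])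
qed

text \<open>Chevalley's theorem for a coordinate projection: in disjunctive normal form the
  quantifier distributes over the union, and each basic set becomes a common-root problem in the
  coordinate \<open>i\<close>.\<close>

theorem constructible_ex:
  assumes "S \<in> constructible"
  shows "{v. \<exists>x. v(i := x) \<in> S} \<in> constructible"
proof (rule union_of_basicE[OF constructible_imp_union_of_basic[OF assms]])
  fix A :: "((('a \<Rightarrow> complex) \<Rightarrow> complex) list \<times> (('a \<Rightarrow> complex) \<Rightarrow> complex)) set"
  assume A: "finite A" "\<And>b. b \<in> A \<Longrightarrow> set (fst b) \<subseteq> pfun" "\<And>b. b \<in> A \<Longrightarrow> snd b \<in> pfun"
      "S = (\<Union>b\<in>A. basic_set (fst b) (snd b))"
  have basic: "{v. \<exists>x. v(i := x) \<in> basic_set fs g} \<in> constructible" if fs: "set fs \<subseteq> pfun" and g: "g \<in> pfun"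
    for fs and g :: "('a \<Rightarrow> complex) \<Rightarrow> complex"
  proof -
    have "\<exists>L. (\<forall>(n, F)\<in>set L. F \<in> pfun_polys n) \<and>
        (\<forall>v x. (\<forall>f\<in>set fs. f (v(i := x)) = 0) \<longleftrightarrow> (\<forall>(n, F)\<in>set L. poly (F v) x = 0))"
      using fs
    proof (induction fs)
      case Nil
      show ?case by (intro exI[of _ "[]"]) auto
    next
      case (Cons f fs)
      then have "set fs \<subseteq> pfun" by simp
      from Cons.IH[OF this] obtain L where L: "\<forall>(n, F)\<in>set L. F \<in> pfun_polys n"
        "\<And>v x. (\<forall>f\<in>set fs. f (v(i := x)) = 0) \<longleftrightarrow> (\<forall>(n, F)\<in>set L. poly (F v) x = 0)" by blast
      obtain n F where "F \<in> pfun_polys n" "\<And>v x. f (v(i := x)) = poly (F v) x"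
        using pfun_upd[of f i] Cons.prems by auto
      with L show ?case
        by (intro exI[of _ "(n, F) # L"]) (simp only: list.set ball_simps case_prod_conv simp_thms)
    qed
    then obtain L where L: "\<forall>(n, F)\<in>set L. F \<in> pfun_polys n"
        "\<And>v x. (\<forall>f\<in>set fs. f (v(i := x)) = 0) \<longleftrightarrow> (\<forall>(n, F)\<in>set L. poly (F v) x = 0)" by blast
    obtain m G where G: "G \<in> pfun_polys m" "\<And>v x. g (v(i := x)) = poly (G v) x"
      using pfun_upd[OF g, of i] by blast
    show ?thesis
      using constructible_common_root[OF L(1) G(1)] by (simp add: basic_set_def L(2) G(2))
  qed
  have "{v. \<exists>x. v(i := x) \<in> S} = {v. \<exists>a\<in>A. \<exists>x. v(i := x) \<in> basic_set (fst a) (snd a)}"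
    unfolding A(4) by auto
  also have "\<dots> \<in> constructible"
    using A(1-3) by (intro constructible_bex basic) auto
  finally show ?thesis .
qed

lemma pfun_subst:
  assumes "f \<in> pfun" "\<And>i. \<theta> i \<in> pfun"
  shows "(\<lambda>w. f (\<lambda>i. \<theta> i w)) \<in> pfun"
  using assms(1)
proof induction
  case (const r)
  show ?case by (rule pfun.const)
next
  case (var i)
  show ?case by (rule assms(2))
next
  case (add f g)
  from pfun.add[OF add.IH] show ?case .
next
  case (mult f g)
  from pfun.mult[OF mult.IH] show ?case .
qed

lemma constructible_subst:
  assumes "S \<in> constructible" "\<And>i. \<theta> i \<in> pfun"
  shows "{w. (\<lambda>i. \<theta> i w) \<in> S} \<in> constructible"
  using assms(1)
proof induction
  case (zero f)
  from constructible.zero[OF pfun_subst[of f \<theta>, OF zero assms(2)]] show ?case by simp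
next
  case (compl S)
  from constructible.compl[OF compl.IH] show ?case by (simp add: Collect_neg_eq)
next
  case (inter S T)
  from constructible.inter[OF inter.IH] show ?case by (simp add: Collect_conj_eq)
qed

lemma constructible_ex_finite:
  assumes "finite I" "S \<in> constructible"
  shows "{v. \<exists>w. (\<forall>i. i \<notin> I \<longrightarrow> w i = v i) \<and> w \<in> S} \<in> constructible"
  using assms
proof (induction I arbitrary: S rule: finite_induct)
  case empty
  have "{v. \<exists>w. (\<forall>i. i \<notin> {} \<longrightarrow> w i = v i) \<and> w \<in> S} = S" by (auto simp: fun_eq_iff[symmetric])
  with empty show ?case by simp
next
  case (insert j I)
  have "(\<exists>w. (\<forall>i. i \<notin> insert j I \<longrightarrow> w i = v i) \<and> w \<in> S) \<longleftrightarrow>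
      (\<exists>u. (\<forall>i. i \<notin> I \<longrightarrow> u i = v i) \<and> u \<in> {u. \<exists>x. u(j := x) \<in> S})" (is "?L \<longleftrightarrow> ?R") for v
  proof
    assume ?L
    then obtain w where w: "\<forall>i. i \<notin> insert j I \<longrightarrow> w i = v i" "w \<in> S" by blast
    have "(w(j := v j))(j := w j) \<in> S" using w by simp
    then have "w(j := v j) \<in> {u. \<exists>x. u(j := x) \<in> S}" by blast
    moreover have "\<forall>i. i \<notin> I \<longrightarrow> (w(j := v j)) i = v i" using w by simp
    ultimately show ?R by blast
  next
    assume ?R
    then obtain u x where "\<forall>i. i \<notin> I \<longrightarrow> u i = v i" "u(j := x) \<in> S" by blast
    then have "(\<forall>i. i \<notin> insert j I \<longrightarrow> (u(j := x)) i = v i) \<and> u(j := x) \<in> S" by simp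
    then show ?L by blast
  qed
  then show ?case using insert.IH[OF constructible_ex[OF insert.prems, of j]] by simp
qed

section \<open>Restriction to lines and generic points\<close>

text \<open>On a coordinate line an equation has finitely many solutions or holds everywhere, and
  the dichotomy survives Boolean operations. It later shows that the parameters at which an arc
  fails to be injective form a finite or a cofinite set.\<close>

lemma constructible_slice:
  assumes "S \<in> constructible"
  shows "finite {x. v(i := x) \<in> S} \<or> finite {x. v(i := x) \<notin> S}"
  using assms
proof induction
  case (zero f)
  from pfun_upd[OF zero, of i] obtain F where "\<forall>v x. f (v(i := x)) = poly (F v) x" by blast
  then have eq: "f (v(i := x)) = poly (F v) x" for x by blast
  show ?case
  proof (cases "F v = 0")
    case True
    then show ?thesis by (simp only: mem_Collect_eq eq poly_0 simp_thms Collect_const) simp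
  next
    case False
    then show ?thesis using poly_roots_finite[of "F v"] by (simp only: mem_Collect_eq eq simp_thms)
  qed
next
  case (compl S)
  then show ?case by (simp only: Compl_iff not_not disj_commute)
next
  case (inter S T)
  have "{x. v(i := x) \<in> S \<inter> T} = {x. v(i := x) \<in> S} \<inter> {x. v(i := x) \<in> T}"
    "{x. v(i := x) \<notin> S \<inter> T} = {x. v(i := x) \<notin> S} \<union> {x. v(i := x) \<notin> T}" by blast+
  then show ?case using inter.IH by (simp only:) (simp only: finite_Int finite_Un, blast)
qed

text \<open>Along a line, nonvanishing in arbitrarily many coordinates becomes nonvanishing of one
  polynomial, which has finitely many roots or is zero.\<close>

lemma pfun_line:
  assumes "f \<in> pfun"
  shows "\<exists>p. \<forall>s. f (\<lambda>i. x i + s * y i) = poly p s"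
  using assms
proof induction
  case (const r)
  show ?case by (intro exI[of _ "[:of_real r:]"]) simp
next
  case (var i)
  show ?case by (intro exI[of _ "[:x i, y i:]"]) simp
next
  case (add f g)
  then obtain p q where "\<And>s. f (\<lambda>i. x i + s * y i) = poly p s" "\<And>s. g (\<lambda>i. x i + s * y i) = poly q s"
    by blast
  then show ?case by (intro exI[of _ "p + q"]) simp
next
  case (mult f g)
  then obtain p q where "\<And>s. f (\<lambda>i. x i + s * y i) = poly p s" "\<And>s. g (\<lambda>i. x i + s * y i) = poly q s"
    by blast
  then show ?case by (intro exI[of _ "p * q"]) simp
qed

text \<open>Irreducibility of affine space: two nonempty principal open sets already meet on the
  line joining the given points.\<close>

lemma pfun_mult_nonzero:
  assumes "f \<in> pfun" "g \<in> pfun" "f v \<noteq> 0" "g w \<noteq> 0"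
  shows "\<exists>u. f u * g u \<noteq> 0"
proof -
  let ?l = "\<lambda>s i. v i + s * (w i - v i)"
  obtain p where p: "\<And>s. f (?l s) = poly p s"
    using pfun_line[OF assms(1), of v "\<lambda>i. w i - v i"] by blast
  obtain q where q: "\<And>s. g (?l s) = poly q s"
    using pfun_line[OF assms(2), of v "\<lambda>i. w i - v i"] by blast
  have "poly p 0 \<noteq> 0" "poly q 1 \<noteq> 0" using p[of 0] q[of 1] assms by auto
  then have "p * q \<noteq> 0" by auto
  then obtain s where "poly (p * q) s \<noteq> 0" using poly_all_0_iff_0 by blast
  then show ?thesis using p[of s] q[of s] by (intro exI[of _ "?l s"]) auto
qed

text \<open>By induction on the construction of \<open>S\<close>. For an intersection the product of
  the two witnesses works, and irreducibility makes it nonzero somewhere.\<close>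

lemma constructible_generic:
  assumes "S \<in> constructible"
  obtains g v where "g \<in> pfun" "g v \<noteq> 0" "(\<forall>v. g v \<noteq> 0 \<longrightarrow> v \<in> S) \<or> (\<forall>v. g v \<noteq> 0 \<longrightarrow> v \<notin> S)"
proof -
  define P where "P S g \<longleftrightarrow> g \<in> pfun \<and> (\<exists>v. g v \<noteq> 0) \<and>
      ((\<forall>v. g v \<noteq> 0 \<longrightarrow> v \<in> S) \<or> (\<forall>v. g v \<noteq> 0 \<longrightarrow> v \<notin> S))" for S and g :: "('a \<Rightarrow> complex) \<Rightarrow> complex"
  have "\<exists>g. P S g"
    using assms
  proof induction
    case (zero f)
    show ?case
    proof (cases "\<exists>v. f v \<noteq> 0")
      case True
      with zero have "P {v. f v = 0} f" by (simp add: P_def)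
      then show ?thesis by (rule exI[of _ f])
    next
      case False
      then have "P {v. f v = 0} (\<lambda>_. 1)" using pfun_1 by (simp add: P_def)
      then show ?thesis by (rule exI[of _ "\<lambda>_. 1"])
    qed
  next
    case (compl S)
    from compl.IH obtain g where "P S g" by (elim exE)
    then have "P (- S) g" unfolding P_def by auto
    then show ?case by (rule exI[of _ g])
  next
    case (inter S T)
    from inter.IH obtain f g where fg: "P S f" "P T g" by (elim exE)
    then obtain v w where "f v \<noteq> 0" "g w \<noteq> 0" unfolding P_def by blast
    with fg have "\<exists>u. f u * g u \<noteq> 0" unfolding P_def by (intro pfun_mult_nonzero) simp_all
    with fg have "P (S \<inter> T) (\<lambda>v. f v * g v)"
      unfolding P_def by (auto intro: pfun.mult)
    then show ?case by (rule exI[of _ "\<lambda>v. f v * g v"])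
  qed
  then show ?thesis using that unfolding P_def by blast
qed

text \<open>On the line Re v + s Im v the value at \<open>s = \<i>\<close> is \<open>g v\<close>.
  The restriction is therefore a nonzero polynomial, whose roots cannot exhaust the real values of
  s.\<close>

lemma pfun_real_point:
  assumes "g \<in> pfun" "g v \<noteq> 0"
  shows "\<exists>w. g (\<lambda>i. of_real (w i)) \<noteq> 0"
proof -
  obtain p where p: "\<And>s. g (\<lambda>i. of_real (Re (v i)) + s * of_real (Im (v i))) = poly p s"
    using pfun_line[OF assms(1), of "\<lambda>i. of_real (Re (v i))" "\<lambda>i. of_real (Im (v i))"] by blast
  have "poly p \<i> \<noteq> 0" using p[of \<i>] assms(2) by (simp flip: complex_eq)
  then have "finite {s. poly p s = 0}" by (intro poly_roots_finite) auto
  moreover have "infinite (range complex_of_real)"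
    using finite_imageD[of complex_of_real UNIV] infinite_UNIV_char_0 by (auto simp: inj_on_def)
  ultimately obtain s where "poly p (complex_of_real s) \<noteq> 0"
    by (metis (mono_tags, lifting) finite_subset image_subsetI mem_Collect_eq)
  then show ?thesis using p[of "of_real s"] by (intro exI[of _ "\<lambda>i. Re (v i) + s * Im (v i)"]) simp
qed

text \<open>Density of \<open>g \<noteq> 0\<close> in the Euclidean sense, which lets a ball around
  the conic decide between the two alternatives of \<open>constructible_generic\<close>.\<close>

lemma pfun_nonzero_nearby:
  assumes "g \<in> pfun" "g w \<noteq> 0" "finite A" "\<delta> > 0"
  shows "\<exists>v. g v \<noteq> 0 \<and> (\<forall>i\<in>A. cmod (v i - u i) < \<delta>)"
proof -
  obtain p where p: "\<And>s. g (\<lambda>i. u i + s * (w i - u i)) = poly p s"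
    using pfun_line[OF assms(1), of u "\<lambda>i. w i - u i"] by blast
  have "poly p 1 \<noteq> 0" using p[of 1] assms(2) by simp
  then have fin: "finite {s. poly p s = 0}" by (intro poly_roots_finite) auto
  \<comment> \<open>The extra 1 keeps \<open>M\<close> positive; a parameter below
    \<open>\<delta> / M\<close> then moves each coordinate in \<open>A\<close> by less than
    \<open>\<delta>\<close>.\<close>
  define M where "M = 1 + (\<Sum>i\<in>A. cmod (w i - u i))"
  have "M > 0" unfolding M_def by (smt (verit) sum_nonneg norm_ge_zero)
  then have "0 < \<delta> / M" using assms(4) by simp
  then have "infinite (complex_of_real ` {0<..<\<delta> / M})"
    using finite_imageD[of complex_of_real "{0<..<\<delta> / M}"] infinite_Ioo[of 0 "\<delta> / M"] by (auto simp: inj_on_def)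
  then obtain s where s: "0 < s" "s < \<delta> / M" "poly p (complex_of_real s) \<noteq> 0"
    using fin by (metis (mono_tags, lifting) finite_subset greaterThanLessThan_iff image_subsetI mem_Collect_eq)
  have "cmod (of_real s * (w i - u i)) < \<delta>" if "i \<in> A" for i
  proof -
    have "cmod (w i - u i) \<le> M" using that assms(3) unfolding M_def
      by (smt (verit) member_le_sum norm_ge_zero)
    then have "cmod (of_real s * (w i - u i)) \<le> s * M" using s by (simp add: norm_mult mult_left_mono)
    also have "\<dots> < \<delta>" using s \<open>M > 0\<close> by (simp add: field_simps)
    finally show ?thesis .
  qed
  then show ?thesis using s p[of "of_real s"] by (intro exI[of _ "\<lambda>i. u i + of_real s * (w i - u i)"]) simp
qed

section \<open>Real polynomial functions\<close>

text \<open>\<open>poly_fun\<close> sums over a set of exponent vectors, whereas sums and products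
  of polynomials produce repeated exponents. Terms with equal exponent vectors are collected here
  once and for all.\<close>

lemma poly_fun_indexed_sum:
  fixes \<alpha> :: "'k \<Rightarrow> 'i \<Rightarrow> nat"
  assumes "finite K" "\<And>k i. k \<in> K \<Longrightarrow> i \<notin> I \<Longrightarrow> \<alpha> k i = 0"
  shows "poly_fun I (\<lambda>x. \<Sum>k\<in>K. b k * (\<Prod>i\<in>I. x i ^ \<alpha> k i))"
proof -
  have "(\<Sum>k\<in>K. b k * (\<Prod>i\<in>I. x i ^ \<alpha> k i)) =
      (\<Sum>\<beta>\<in>\<alpha> ` K. (\<Sum>k\<in>{k\<in>K. \<alpha> k = \<beta>}. b k) * (\<Prod>i\<in>I. x i ^ \<beta> i))" for x
    by (subst sum.image_gen[OF assms(1), of _ \<alpha>]) (auto simp: sum_distrib_right intro!: sum.cong)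
  then show ?thesis unfolding poly_fun_def
    by (intro exI[of _ "\<alpha> ` K"] exI[of _ "\<lambda>\<beta>. \<Sum>k\<in>{k\<in>K. \<alpha> k = \<beta>}. b k"]) (use assms in auto)
qed

lemma poly_fun_const: "poly_fun I (\<lambda>x. r)"
  using poly_fun_indexed_sum[of "{()}" I "\<lambda>_ _. 0" "\<lambda>_. r"] by simp

lemma poly_fun_var:
  assumes "finite I" "i \<in> I"
  shows "poly_fun I (\<lambda>x. x i)"
proof -
  have "(\<Prod>j\<in>I. x j ^ (if j = i then 1 else 0)) = (\<Prod>j\<in>I. if j = i then x j else 1)"
    for x :: "'a \<Rightarrow> real" by (intro prod.cong) auto
  then have "(\<lambda>x :: 'a \<Rightarrow> real. x i) = (\<lambda>x. \<Sum>k\<in>{()}. 1 * (\<Prod>j\<in>I. x j ^ (if j = i then 1 else 0)))"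
    using assms by simp
  moreover have "poly_fun I \<dots>" using assms(2) by (intro poly_fun_indexed_sum) auto
  ultimately show ?thesis by simp
qed

lemma poly_fun_add:
  assumes "poly_fun I f" "poly_fun I g"
  shows "poly_fun I (\<lambda>x. f x + g x)"
proof -
  obtain S a where S: "finite S" "\<forall>\<alpha>\<in>S. \<forall>i. i \<notin> I \<longrightarrow> \<alpha> i = (0::nat)"
    "f = (\<lambda>x. \<Sum>\<alpha>\<in>S. a \<alpha> * (\<Prod>i\<in>I. x i ^ \<alpha> i))" using assms(1) unfolding poly_fun_def by blast
  obtain T b where T: "finite T" "\<forall>\<alpha>\<in>T. \<forall>i. i \<notin> I \<longrightarrow> \<alpha> i = (0::nat)"
    "g = (\<lambda>x. \<Sum>\<alpha>\<in>T. b \<alpha> * (\<Prod>i\<in>I. x i ^ \<alpha> i))" using assms(2) unfolding poly_fun_def by blast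
  have "(\<lambda>x. f x + g x) = (\<lambda>x. \<Sum>k\<in>S <+> T. case_sum a b k * (\<Prod>i\<in>I. x i ^ (case_sum id id k) i))"
    using S(1) T(1) unfolding S(3) T(3) by (simp add: sum.Plus)
  moreover have "poly_fun I \<dots>"
    by (intro poly_fun_indexed_sum) (use S T in auto)
  ultimately show ?thesis by simp
qed

lemma poly_fun_mult:
  assumes "poly_fun I f" "poly_fun I g"
  shows "poly_fun I (\<lambda>x. f x * g x)"
proof -
  obtain S a where S: "finite S" "\<forall>\<alpha>\<in>S. \<forall>i. i \<notin> I \<longrightarrow> \<alpha> i = (0::nat)"
    "f = (\<lambda>x. \<Sum>\<alpha>\<in>S. a \<alpha> * (\<Prod>i\<in>I. x i ^ \<alpha> i))" using assms(1) unfolding poly_fun_def by blast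
  obtain T b where T: "finite T" "\<forall>\<alpha>\<in>T. \<forall>i. i \<notin> I \<longrightarrow> \<alpha> i = (0::nat)"
    "g = (\<lambda>x. \<Sum>\<alpha>\<in>T. b \<alpha> * (\<Prod>i\<in>I. x i ^ \<alpha> i))" using assms(2) unfolding poly_fun_def by blast
  have "(\<lambda>x. f x * g x) =
      (\<lambda>x. \<Sum>k\<in>S \<times> T. (a (fst k) * b (snd k)) * (\<Prod>i\<in>I. x i ^ (fst k i + snd k i)))"
    unfolding S(3) T(3)
    by (simp add: sum_product sum.cartesian_product case_prod_beta power_add prod.distrib mult_ac)
  moreover have "poly_fun I \<dots>"
    using S T by (intro poly_fun_indexed_sum) auto
  ultimately show ?thesis by simp
qed

text \<open>Coordinates outside \<open>I\<close> are frozen at real values \<open>w\<close>. As the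
  constants of \<open>pfun\<close> are real, the restriction to real points is real, which yields an
  exceptional set over the reals.\<close>

lemma pfun_imp_poly_fun:
  assumes "f \<in> pfun" "finite I"
  shows "\<exists>h. poly_fun I h \<and> (\<forall>c. f (\<lambda>i. of_real (if i \<in> I then c i else w i)) = of_real (h c))"
  using assms(1)
proof induction
  case (const r)
  show ?case by (intro exI[of _ "\<lambda>_. r"]) (simp add: poly_fun_const)
next
  case (var i)
  show ?case
  proof (cases "i \<in> I")
    case True
    then show ?thesis using poly_fun_var[OF assms(2)] by (intro exI[of _ "\<lambda>c. c i"]) simp
  next
    case False
    then show ?thesis by (intro exI[of _ "\<lambda>_. w i"]) (simp add: poly_fun_const)
  qed
next
  case (add f g)
  then obtain h k where "poly_fun I h" "poly_fun I k"
    and *: "\<And>c. f (\<lambda>i. of_real (if i \<in> I then c i else w i)) = of_real (h c)"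
      "\<And>c. g (\<lambda>i. of_real (if i \<in> I then c i else w i)) = of_real (k c)" by metis
  then show ?case by (intro exI[of _ "\<lambda>c. h c + k c"]) (simp only: * poly_fun_add of_real_add simp_thms)
next
  case (mult f g)
  then obtain h k where "poly_fun I h" "poly_fun I k"
    and *: "\<And>c. f (\<lambda>i. of_real (if i \<in> I then c i else w i)) = of_real (h c)"
      "\<And>c. g (\<lambda>i. of_real (if i \<in> I then c i else w i)) = of_real (k c)" by metis
  then show ?case by (intro exI[of _ "\<lambda>c. h c * k c"]) (simp only: * poly_fun_mult of_real_mult simp_thms)
qed

section \<open>Counting solutions\<close>

text \<open>A \<open>K\<close>-tuple of pairwise distinct solutions is a quantifier over the
  finitely many coordinates \<open>{..<K} \<times> B\<close>. Distinctness is a finite disjunction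
  because all points vanish outside \<open>B\<close>.\<close>

lemma constructible_at_least:
  fixes S :: "('a + 'b \<Rightarrow> complex) set" and B :: "'b set"
  assumes "S \<in> constructible" "finite B"
  shows "{c. \<exists>xs :: nat \<Rightarrow> 'b \<Rightarrow> complex. inj_on xs {..<K} \<and>
      (\<forall>k<K. (\<forall>b. b \<notin> B \<longrightarrow> xs k b = 0) \<and> case_sum c (xs k) \<in> S)} \<in> constructible" (is "?A \<in> _")
proof -
  \<comment> \<open>\<open>\<theta> k\<close> reads the parameters and the \<open>k\<close>-th point
    out of a joint assignment, inserting 0 outside \<open>B\<close>.\<close>
  define \<theta> :: "nat \<Rightarrow> 'a + 'b \<Rightarrow> ('a + nat \<times> 'b \<Rightarrow> complex) \<Rightarrow> complex" where
    "\<theta> k i v = (case i of Inl a \<Rightarrow> v (Inl a) | Inr b \<Rightarrow> if b \<in> B then v (Inr (k, b)) else 0)" for k i v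
  have \<theta>: "\<theta> k i \<in> pfun" for k i
  proof (cases i)
    case (Inl a)
    then have "\<theta> k i = (\<lambda>v. v (Inl a))" by (auto simp: \<theta>_def)
    then show ?thesis by (simp add: pfun.var)
  next
    case (Inr b)
    then have "\<theta> k i = (if b \<in> B then \<lambda>v. v (Inr (k, b)) else (\<lambda>_. 0))" by (auto simp: \<theta>_def)
    then show ?thesis by (simp add: pfun.var pfun_0)
  qed
  define T where "T = {v. \<forall>k\<in>{..<K}. (\<lambda>i. \<theta> k i v) \<in> S} \<inter>
     {v. \<forall>k\<in>{..<K}. \<forall>l\<in>{..<K}-{k}. \<exists>b\<in>B. v (Inr (k, b)) \<noteq> v (Inr (l, b))}"
  have "T \<in> constructible" unfolding T_def
    by (intro constructible.inter constructible_ball constructible_bex constructible_neq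
        constructible_subst pfun.var \<theta> assms finite_lessThan finite_Diff)
  from constructible_ex_finite[OF _ this, of "Inr ` ({..<K} \<times> B)"] assms(2)
  have "{v. \<exists>w. (\<forall>i. i \<notin> Inr ` ({..<K} \<times> B) \<longrightarrow> w i = v i) \<and> w \<in> T} \<in> constructible" by simp
  \<comment> \<open>The parameters are embedded with all auxiliary coordinates 0; the quantifier
    then replaces those indexed by \<open>{..<K} \<times> B\<close>.\<close>
  from constructible_subst[OF this, of "case_sum (\<lambda>a c. c a) (\<lambda>_ _. 0)"]
  have "{c. (\<lambda>i. case_sum (\<lambda>a c. c a) (\<lambda>_ _. 0) i c) \<in>
      {v. \<exists>w. (\<forall>i. i \<notin> Inr ` ({..<K} \<times> B) \<longrightarrow> w i = v i) \<and> w \<in> T}} \<in> constructible"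
    by (simp add: pfun.var pfun_0 split: sum.split)
  also have "{c. (\<lambda>i. case_sum (\<lambda>a c. c a) (\<lambda>_ _. 0) i c) \<in>
      {v. \<exists>w. (\<forall>i. i \<notin> Inr ` ({..<K} \<times> B) \<longrightarrow> w i = v i) \<and> w \<in> T}} = ?A"
  proof (intro set_eqI iffI)
    fix c assume "c \<in> {c. (\<lambda>i. case_sum (\<lambda>a c. c a) (\<lambda>_ _. 0) i c) \<in>
      {v. \<exists>w. (\<forall>i. i \<notin> Inr ` ({..<K} \<times> B) \<longrightarrow> w i = v i) \<and> w \<in> T}}"
    then obtain w where w: "\<And>i. i \<notin> Inr ` ({..<K} \<times> B) \<Longrightarrow> w i = case_sum (\<lambda>a c. c a) (\<lambda>_ _. 0) i c"
      and T: "w \<in> T" by auto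
    define xs where "xs k b = (if b \<in> B then w (Inr (k, b)) else 0)" for k b
    have "w (Inl a) = c a" for a using w[of "Inl a"] by auto
    then have "(\<lambda>i. \<theta> k i w) = case_sum c (xs k)" for k
      by (auto simp: fun_eq_iff \<theta>_def xs_def split: sum.split)
    then have "\<forall>k<K. case_sum c (xs k) \<in> S" using T by (simp add: T_def)
    moreover have "inj_on xs {..<K}"
    proof (rule inj_onI, rule ccontr)
      fix k l assume "k \<in> {..<K}" "l \<in> {..<K}" "xs k = xs l" "k \<noteq> l"
      then have "\<exists>b\<in>B. w (Inr (k, b)) \<noteq> w (Inr (l, b))" using T unfolding T_def by blast
      then obtain b where "b \<in> B" "w (Inr (k, b)) \<noteq> w (Inr (l, b))" ..
      with fun_cong[OF \<open>xs k = xs l\<close>, of b] show False by (simp add: xs_def)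
    qed
    moreover have "\<forall>k<K. \<forall>b. b \<notin> B \<longrightarrow> xs k b = 0" by (simp add: xs_def)
    ultimately show "c \<in> ?A" by blast
  next
    fix c assume "c \<in> ?A"
    then obtain xs where xs: "inj_on xs {..<K}" "\<And>k b. k < K \<Longrightarrow> b \<notin> B \<Longrightarrow> xs k b = 0"
      "\<And>k. k < K \<Longrightarrow> case_sum c (xs k) \<in> S" by blast
    define w where "w = case_sum c (\<lambda>(k, b). if k < K \<and> b \<in> B then xs k b else 0)"
    have "(\<lambda>i. \<theta> k i w) = case_sum c (xs k)" if "k < K" for k
      using that xs(2) by (auto simp: fun_eq_iff \<theta>_def w_def split: sum.split)
    moreover have "\<exists>b\<in>B. w (Inr (k, b)) \<noteq> w (Inr (l, b))" if "k < K" "l < K" "k \<noteq> l" for k l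
    proof -
      have "xs k \<noteq> xs l" using xs(1) that by (auto simp: inj_on_def)
      then obtain b where b: "xs k b \<noteq> xs l b" by auto
      then have "b \<in> B" using xs(2) that by metis
      with b that show ?thesis by (intro bexI[of _ b]) (auto simp: w_def)
    qed
    ultimately have "w \<in> T" using xs(3) by (simp add: T_def)
    moreover have "w i = case_sum (\<lambda>a c. c a) (\<lambda>_ _. 0) i c" if "i \<notin> Inr ` ({..<K} \<times> B)" for i
      using that by (auto simp: w_def split: sum.split)
    ultimately show "c \<in> {c. (\<lambda>i. case_sum (\<lambda>a c. c a) (\<lambda>_ _. 0) i c) \<in>
      {v. \<exists>w. (\<forall>i. i \<notin> Inr ` ({..<K} \<times> B) \<longrightarrow> w i = v i) \<and> w \<in> T}}" by blast
  qed
  finally show ?thesis .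
qed

text \<open>The implication accounts for infinite sets, which contain \<open>K\<close> distinct
  points for every \<open>K\<close> although their \<open>card\<close> is 0.\<close>

lemma ex_inj_lessThan_iff:
  "(\<exists>xs :: nat \<Rightarrow> 'x. inj_on xs {..<K} \<and> (\<forall>k<K. xs k \<in> X)) \<longleftrightarrow> (finite X \<longrightarrow> K \<le> card X)"
proof
  assume "\<exists>xs :: nat \<Rightarrow> 'x. inj_on xs {..<K} \<and> (\<forall>k<K. xs k \<in> X)"
  then obtain xs :: "nat \<Rightarrow> 'x" where "inj_on xs {..<K}" "xs ` {..<K} \<subseteq> X" by auto
  then show "finite X \<longrightarrow> K \<le> card X" using card_inj_on_le[of xs "{..<K}" X] by simp
next
  assume "finite X \<longrightarrow> K \<le> card X"
  then obtain Y where Y: "Y \<subseteq> X" "card Y = K" "finite Y"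
    by (metis infinite_arbitrarily_large obtain_subset_with_card_n)
  then obtain xs where "bij_betw xs {0..<K} Y" using ex_bij_betw_nat_finite by blast
  then show "\<exists>xs. inj_on xs {..<K} \<and> (\<forall>k<K. xs k \<in> X)"
    using Y(1) by (intro exI[of _ xs]) (auto simp: bij_betw_def atLeast0LessThan)
qed

text \<open>The absence of \<open>Suc K\<close> distinct solutions gives finiteness together with
  the upper bound.\<close>

lemma constructible_card_eq:
  fixes S :: "('a + 'b \<Rightarrow> complex) set" and B :: "'b set"
  assumes "S \<in> constructible" "finite B"
  shows "{c. finite {x. (\<forall>b. b \<notin> B \<longrightarrow> x b = 0) \<and> case_sum c x \<in> S} \<and>
      card {x. (\<forall>b. b \<notin> B \<longrightarrow> x b = 0) \<and> case_sum c x \<in> S} = K} \<in> constructible"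
proof -
  let ?X = "\<lambda>c. {x. (\<forall>b. b \<notin> B \<longrightarrow> x b = 0) \<and> case_sum c x \<in> S}"
  have *: "{c. finite (?X c) \<longrightarrow> K \<le> card (?X c)} \<in> constructible" for K
    using constructible_at_least[OF assms, of K] unfolding ex_inj_lessThan_iff[symmetric] by simp
  have "{c. finite (?X c) \<and> card (?X c) = K} =
      {c. finite (?X c) \<longrightarrow> K \<le> card (?X c)} \<inter> - {c. finite (?X c) \<longrightarrow> Suc K \<le> card (?X c)}"
    by auto
  with constructible.inter[OF *[of K] constructible.compl[OF *[of "Suc K"]]] show ?thesis by simp
qed

subsection \<open>Arcs of high contact\<close>

definition curve_subst :: "nat \<Rightarrow> (nat \<times> nat \<Rightarrow> complex) \<Rightarrow> complex poly \<Rightarrow> complex poly \<Rightarrow> complex poly" where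
  "curve_subst d c p q = (\<Sum>(i, j)\<in>mon_set d. smult (c (i, j)) (p ^ i * q ^ j))"

definition arcs :: "nat \<Rightarrow> (complex poly \<times> complex poly) set" where
  "arcs d = {(p, q). degree p \<le> d \<and> degree q \<le> d \<and> coeff p 0 = 0 \<and> coeff q 0 = 0}"

text \<open>Replacing t by lambda t multiplies the product of the top coefficients by the
  \<open>2 * d\<close>-th power of lambda, so fixing it removes the scaling up to
  \<open>2 * d\<close>-th roots of unity. It also forces both degrees to be exactly
  \<open>d\<close>.\<close>

definition contact_arcs :: "nat \<Rightarrow> (nat \<times> nat \<Rightarrow> complex) \<Rightarrow> (complex poly \<times> complex poly) set" where
  "contact_arcs d c = {(p, q) \<in> arcs d. coeff p d * coeff q d = -1 \<and>
     (\<forall>k<2*d. coeff (curve_subst d c p q) k = 0)}"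

text \<open>An open condition, definable by polynomial equations, that substitutes for generic injectivity.\<close>

definition simple_at :: "complex poly \<Rightarrow> complex poly \<Rightarrow> complex \<Rightarrow> bool" where
  "simple_at p q t \<longleftrightarrow> poly (pderiv p) t \<noteq> 0 \<and> (\<forall>s. poly p s = poly p t \<and> poly q s = poly q t \<longrightarrow> s = t)"

lemma finite_mon_set: "finite (mon_set d)"
proof -
  have "mon_set d \<subseteq> {..2*d} \<times> {..2*d}" by (auto simp: mon_set_def)
  then show ?thesis by (rule finite_subset) simp
qed

section \<open>Limits of polynomials and of their preimages\<close>

lemma tendsto_poly:
  assumes "\<And>k. (\<lambda>n. coeff (P n) k) \<longlonglongrightarrow> coeff p k" "\<And>n. degree (P n) \<le> d" "degree p \<le> d"
    "x \<longlonglongrightarrow> (y :: complex)"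
  shows "(\<lambda>n. poly (P n) (x n)) \<longlonglongrightarrow> poly p y"
  using assms by (simp add: poly_eq_sum[of _ d]) (intro tendsto_sum tendsto_mult tendsto_power)

text \<open>The sum is the divided difference of \<open>p\<close> at \<open>s\<close> and
  \<open>t\<close>, obtained by factoring s^k - t^k. As \<open>s\<close> tends to \<open>t\<close>
  it becomes the derivative.\<close>

lemma poly_diff_eq_0:
  fixes p :: "complex poly"
  assumes "degree p \<le> d" "poly p s = poly p t" "s \<noteq> t"
  shows "(\<Sum>k\<le>d. coeff p k * (\<Sum>i<k. t ^ (k - Suc i) * s ^ i)) = 0"
proof -
  have "(s - t) * (\<Sum>k\<le>d. coeff p k * (\<Sum>i<k. t ^ (k - Suc i) * s ^ i)) =
      (\<Sum>k\<le>d. coeff p k * (s ^ k - t ^ k))"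
    by (simp add: power_diff_sumr2 sum_distrib_left mult_ac)
  also have "\<dots> = poly p s - poly p t"
    by (simp add: poly_eq_sum[OF assms(1)] right_diff_distrib sum_subtractf)
  finally show ?thesis using assms by simp
qed

text \<open>The top coefficients tend to a nonzero limit, so the leading term outgrows the others
  and preimages of bounded values cannot escape to infinity.\<close>

lemma poly_preimages_bounded:
  fixes P :: "nat \<Rightarrow> complex poly"
  assumes "\<And>k. (\<lambda>n. coeff (P n) k) \<longlonglongrightarrow> coeff p k" "\<And>n. degree (P n) \<le> Suc d" "coeff p (Suc d) \<noteq> 0"
    "Bseq (\<lambda>n. poly (P n) (s n))"
  shows "Bseq s"
proof -
  have "Bseq (\<lambda>n. coeff (P n) k)" for k using assms(1) convergentI Bseq_conv_Bfun convergent_imp_Bseq by blast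
  then obtain M where M: "\<And>k n. cmod (coeff (P n) k) \<le> M k" unfolding Bseq_def by metis
  obtain N where N: "N > 0" "\<And>n. cmod (poly (P n) (s n)) \<le> N" using assms(4) unfolding Bseq_def by blast
  define a where "a = cmod (coeff p (Suc d))"
  have a: "a > 0" using assms(3) by (simp add: a_def)
  have "(\<lambda>n. cmod (coeff (P n) (Suc d))) \<longlonglongrightarrow> a" unfolding a_def using assms(1) by (intro tendsto_norm)
  then have "\<forall>\<^sub>F n in sequentially. cmod (coeff (P n) (Suc d)) > a / 2"
    using a by (intro order_tendstoD) auto
  then obtain n0 where n0: "\<And>n. n \<ge> n0 \<Longrightarrow> cmod (coeff (P n) (Suc d)) > a / 2"
    unfolding eventually_sequentially by blast
  \<comment> \<open>For \<open>|s n| > 1\<close> the estimate below reads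
    \<open>a / 2 * |s n| \<le> N + (\<Sum>k\<le>d. M k)\<close> after division by the
    \<open>d\<close>-th power; the maximum with 1 covers the remaining case.\<close>
  define K where "K = max 1 ((N + (\<Sum>k\<le>d. M k)) / (a / 2))"
  have "cmod (s n) \<le> K" if "n \<ge> n0" for n
  proof (cases "cmod (s n) \<le> 1")
    case False
    let ?s = "cmod (s n)"
    have s1: "?s > 1" using False by simp
    have M0: "M k \<ge> 0" for k using M[of n k] norm_ge_zero order_trans by blast
    have "a / 2 * ?s ^ Suc d \<le> cmod (coeff (P n) (Suc d)) * ?s ^ Suc d"
      using n0[OF that] by (intro mult_right_mono) auto
    then have "a / 2 * ?s ^ Suc d \<le> cmod (coeff (P n) (Suc d) * s n ^ Suc d)"
      by (simp only: norm_mult norm_power)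
    also have "coeff (P n) (Suc d) * s n ^ Suc d = poly (P n) (s n) - (\<Sum>k\<le>d. coeff (P n) k * s n ^ k)"
      by (simp add: poly_eq_sum[OF assms(2)])
    also have "cmod \<dots> \<le> cmod (poly (P n) (s n)) + cmod (\<Sum>k\<le>d. coeff (P n) k * s n ^ k)"
      by (rule norm_triangle_ineq4)
    also have "\<dots> \<le> N * ?s ^ d + (\<Sum>k\<le>d. M k * ?s ^ d)"
    proof (intro add_mono sum_norm_le)
      have "1 \<le> ?s ^ d" using s1 by simp
      then have "N * 1 \<le> N * ?s ^ d" using N(1) by (intro mult_left_mono) auto
      then show "cmod (poly (P n) (s n)) \<le> N * ?s ^ d" using N(2)[of n] by linarith
      show "cmod (coeff (P n) k * s n ^ k) \<le> M k * ?s ^ d" if "k \<in> {..d}" for k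
        unfolding norm_mult norm_power using M M0 s1 that by (intro mult_mono power_increasing) auto
    qed
    also have "\<dots> = (N + (\<Sum>k\<le>d. M k)) * ?s ^ d" by (simp add: algebra_simps sum_distrib_left sum_distrib_right)
    finally have "a / 2 * ?s * ?s ^ d \<le> (N + (\<Sum>k\<le>d. M k)) * ?s ^ d" by (simp add: mult_ac)
    moreover have "?s ^ d > 0" using s1 by (intro zero_less_power) linarith
    ultimately have "a / 2 * ?s \<le> N + (\<Sum>k\<le>d. M k)" by (meson mult_le_cancel_right_pos)
    then have "?s \<le> (N + (\<Sum>k\<le>d. M k)) / (a / 2)" using a by (simp add: field_simps)
    then show ?thesis by (simp add: K_def)
  qed (simp add: K_def)
  then have "Bseq (\<lambda>n. s (n + n0))" by (intro BseqI'[of _ K]) simp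
  then show ?thesis by (simp add: Bseq_add_iff Bseq_offset)
qed

text \<open>The second preimages \<open>S n\<close> stay bounded, and by uniqueness at
  \<open>t\<close> a subsequence tends to \<open>t\<close>; the divided differences, all zero, then
  force the derivative of \<open>p\<close> at \<open>t\<close> to vanish. Constant sequences of
  polynomials give injectivity of an arc near \<open>t\<close>, varying ones give openness of
  \<open>simple_at\<close>.\<close>

lemma simple_at_limit:
  fixes P Q :: "nat \<Rightarrow> complex poly"
  assumes P: "\<And>k. (\<lambda>n. coeff (P n) k) \<longlonglongrightarrow> coeff p k" "\<And>n. degree (P n) \<le> d" "degree p \<le> d"
    and Q: "\<And>k. (\<lambda>n. coeff (Q n) k) \<longlonglongrightarrow> coeff q k" "\<And>n. degree (Q n) \<le> d" "degree q \<le> d"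
    and lead: "coeff p d \<noteq> 0" and simple: "simple_at p q t" and t: "T \<longlonglongrightarrow> t"
    and s: "\<And>n. S n \<noteq> T n" "\<And>n. poly (P n) (S n) = poly (P n) (T n)" "\<And>n. poly (Q n) (S n) = poly (Q n) (T n)"
  shows False
proof -
  have pd: "poly (pderiv p) t \<noteq> 0" and uniq: "\<And>s. poly p s = poly p t \<Longrightarrow> poly q s = poly q t \<Longrightarrow> s = t"
    using simple by (auto simp: simple_at_def)
  obtain d' where d': "d = Suc d'"
  proof (cases d)
    case 0
    then have "degree p = 0" using P(3) by simp
    then obtain a where "p = [:a:]" by (rule degree_eq_zeroE)
    then show ?thesis using pd by (simp add: pderiv_pCons)
  qed auto
  have lim: "(\<lambda>n. poly (P n) (T n)) \<longlonglongrightarrow> poly p t" "(\<lambda>n. poly (Q n) (T n)) \<longlonglongrightarrow> poly q t"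
    using tendsto_poly[OF P t] tendsto_poly[OF Q t] by simp_all
  have "Bseq (\<lambda>n. poly (P n) (S n))"
    unfolding s(2) using lim(1) convergentI convergent_imp_Bseq by blast
  then have "Bseq S" using poly_preimages_bounded[of P p d' S] P lead d' by simp
  then have "bounded (range S)" by (simp add: Bseq_eq_bounded)
  then obtain s' r where r: "strict_mono r" "(S \<circ> r) \<longlonglongrightarrow> s'"
    using bounded_imp_convergent_subsequence by blast
  have sub: "(\<lambda>n. X (r n)) \<longlonglongrightarrow> L" if "X \<longlonglongrightarrow> L" for X and L :: complex
    using LIMSEQ_subseq_LIMSEQ[OF that r(1)] by (simp add: o_def)
  have Sr: "(\<lambda>n. S (r n)) \<longlonglongrightarrow> s'" using r(2) by (simp add: o_def)
  have "(\<lambda>n. poly (P (r n)) (S (r n))) \<longlonglongrightarrow> poly p s'"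
    by (rule tendsto_poly[of "\<lambda>n. P (r n)" p d, OF _ P(2,3) Sr]) (rule sub[OF P(1)])
  moreover have "(\<lambda>n. poly (P (r n)) (S (r n))) \<longlonglongrightarrow> poly p t"
    unfolding s(2) by (rule sub[OF lim(1)])
  ultimately have eq1: "poly p s' = poly p t" by (rule LIMSEQ_unique)
  have "(\<lambda>n. poly (Q (r n)) (S (r n))) \<longlonglongrightarrow> poly q s'"
    by (rule tendsto_poly[of "\<lambda>n. Q (r n)" q d, OF _ Q(2,3) Sr]) (rule sub[OF Q(1)])
  moreover have "(\<lambda>n. poly (Q (r n)) (S (r n))) \<longlonglongrightarrow> poly q t"
    unfolding s(3) by (rule sub[OF lim(2)])
  ultimately have "poly q s' = poly q t" by (rule LIMSEQ_unique)
  with eq1 have "s' = t" by (rule uniq)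
  have "(\<lambda>n. \<Sum>k\<le>d. coeff (P (r n)) k * (\<Sum>i<k. T (r n) ^ (k - Suc i) * S (r n) ^ i)) \<longlonglongrightarrow>
      (\<Sum>k\<le>d. coeff p k * (\<Sum>i<k. t ^ (k - Suc i) * t ^ i))"
    using Sr unfolding \<open>s' = t\<close>
    by (intro tendsto_sum tendsto_mult tendsto_power sub[OF P(1)] sub[OF t])
  also have "(\<lambda>n. \<Sum>k\<le>d. coeff (P (r n)) k * (\<Sum>i<k. T (r n) ^ (k - Suc i) * S (r n) ^ i)) = (\<lambda>_. 0)"
    using poly_diff_eq_0[OF P(2) s(2,1)] by simp
  finally have "(\<Sum>k\<le>d. coeff p k * (\<Sum>i<k. t ^ (k - Suc i) * t ^ i)) = 0"
    by (simp only: LIMSEQ_const_iff)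
  moreover have "(\<Sum>i<k. t ^ (k - Suc i) * t ^ i) = of_nat k * t ^ (k - 1)" for k
    by (simp add: power_add[symmetric])
  ultimately have "(\<Sum>k\<le>d. coeff p k * (of_nat k * t ^ (k - 1))) = 0" by simp
  also have "(\<Sum>k\<le>d. coeff p k * (of_nat k * t ^ (k - 1))) = (\<Sum>k\<le>d'. coeff (pderiv p) k * t ^ k)"
    unfolding d' by (subst sum.atMost_Suc_shift) (simp add: coeff_pderiv mult_ac)
  also have "\<dots> = poly (pderiv p) t"
    using P(3) d' by (intro poly_eq_sum[symmetric]) (simp add: degree_pderiv)
  finally show False using pd by simp
qed

section \<open>Arcs in coordinates\<close>

text \<open>Slots 1 to \<open>d\<close> hold the first polynomial and slots \<open>d + 1\<close> to
  \<open>2 * d\<close> the second. Slot 0 stays free for a parameter value t and slot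
  \<open>2 * d + 1\<close> for a competing value s, over which the conditions below
  quantify.\<close>

definition arc_fst :: "nat \<Rightarrow> (nat \<Rightarrow> complex) \<Rightarrow> complex poly" where
  "arc_fst d x = (\<Sum>i\<in>{1..d}. monom (x i) i)"

definition arc_snd :: "nat \<Rightarrow> (nat \<Rightarrow> complex) \<Rightarrow> complex poly" where
  "arc_snd d x = (\<Sum>i\<in>{1..d}. monom (x (d + i)) i)"

lemma coeff_arc_fst: "coeff (arc_fst d x) k = (if k \<in> {1..d} then x k else 0)"
  and coeff_arc_snd: "coeff (arc_snd d x) k = (if k \<in> {1..d} then x (d + k) else 0)"
  by (simp_all add: arc_fst_def arc_snd_def coeff_sum)

lemma bij_betw_arcs:
  "bij_betw (\<lambda>x. (arc_fst d x, arc_snd d x)) {x. \<forall>i. i \<notin> {1..2*d} \<longrightarrow> x i = 0} (arcs d)"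
  unfolding bij_betw_def
proof
  show "inj_on (\<lambda>x. (arc_fst d x, arc_snd d x)) {x. \<forall>i. i \<notin> {1..2*d} \<longrightarrow> x i = 0}"
  proof (rule inj_onI, rule ext)
    fix x y i
    assume x: "x \<in> {x. \<forall>i. i \<notin> {1..2*d} \<longrightarrow> x i = 0}" and y: "y \<in> {x. \<forall>i. i \<notin> {1..2*d} \<longrightarrow> x i = 0}"
      and eq: "(arc_fst d x, arc_snd d x) = (arc_fst d y, arc_snd d y)"
    have 1: "x k = y k" if "k \<in> {1..d}" for k
      using arg_cong[OF eq, of "\<lambda>z. coeff (fst z) k"] that by (simp add: coeff_arc_fst)
    have 2: "x (d + k) = y (d + k)" if "k \<in> {1..d}" for k
      using arg_cong[OF eq, of "\<lambda>z. coeff (snd z) k"] that by (simp add: coeff_arc_snd)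
    consider "i \<in> {1..d}" | j where "j \<in> {1..d}" "i = d + j" | "i \<notin> {1..2*d}"
    proof -
      have "i \<in> {1..d} \<or> (i - d \<in> {1..d} \<and> i = d + (i - d)) \<or> i \<notin> {1..2*d}" by auto
      then show ?thesis using that by blast
    qed
    then show "x i = y i" using 1 2 x y by cases simp_all
  qed
next
  have "(p, q) \<in> (\<lambda>x. (arc_fst d x, arc_snd d x)) ` {x. \<forall>i. i \<notin> {1..2*d} \<longrightarrow> x i = 0}"
    if "(p, q) \<in> arcs d" for p q
  proof -
    have pq: "coeff p k = 0" "coeff q k = 0" if "k \<notin> {1..d}" for k
      using \<open>(p, q) \<in> arcs d\<close> that by (cases "k = 0"; auto simp: arcs_def intro!: coeff_eq_0)+
    define x where "x i = (if i \<in> {1..d} then coeff p i else if i \<in> {d+1..2*d} then coeff q (i - d) else 0)" for i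
    have "arc_fst d x = p" "arc_snd d x = q"
      using pq by (auto simp: poly_eq_iff coeff_arc_fst coeff_arc_snd x_def)
    then show ?thesis by (intro image_eqI[of _ _ x]) (auto simp: x_def)
  qed
  then show "(\<lambda>x. (arc_fst d x, arc_snd d x)) ` {x. \<forall>i. i \<notin> {1..2*d} \<longrightarrow> x i = 0} = arcs d"
    by (auto simp: arcs_def coeff_arc_fst coeff_arc_snd intro!: degree_le)
qed

lemma pfun_polys_sum:
  assumes "finite A" "\<And>a. a \<in> A \<Longrightarrow> \<exists>n. F a \<in> pfun_polys n"
  shows "\<exists>n. (\<lambda>v. \<Sum>a\<in>A. F a v) \<in> pfun_polys n"
  using assms
proof (induction A rule: finite_induct)
  case empty
  show ?case by (intro exI[of _ 0]) (simp add: pfun_polys_def pfun_0)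
next
  case (insert a A)
  from insert.IH insert.prems obtain m where "(\<lambda>v. \<Sum>a\<in>A. F a v) \<in> pfun_polys m" by blast
  moreover from insert.prems obtain n where "F a \<in> pfun_polys n" by blast
  ultimately have "(\<lambda>v. F a v + (\<Sum>a\<in>A. F a v)) \<in> pfun_polys (m + n)"
    by (intro pfun_polys_add) (auto intro: pfun_polys_mono)
  with insert.hyps show ?case by (intro exI[of _ "m + n"]) simp
qed

lemma pfun_polys_pderiv:
  assumes "F \<in> pfun_polys n"
  shows "(\<lambda>v. pderiv (F v)) \<in> pfun_polys n"
proof -
  have "(\<lambda>v. of_nat (Suc k) * coeff (F v) (Suc k)) \<in> pfun" for k
    using pfun.mult[OF pfun.const[of "of_nat (Suc k)"] pfun_polys_coeff[OF assms, of "Suc k"]] by simp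
  then show ?thesis using assms by (simp add: pfun_polys_def coeff_pderiv)
qed

lemma pfun_polys_arcs:
  "\<exists>n. (\<lambda>v :: 'a + nat \<Rightarrow> complex. arc_fst d (v \<circ> Inr)) \<in> pfun_polys n"
  "\<exists>n. (\<lambda>v :: 'a + nat \<Rightarrow> complex. arc_snd d (v \<circ> Inr)) \<in> pfun_polys n"
proof -
  have "\<exists>n. (\<lambda>v :: 'a + nat \<Rightarrow> complex. monom (v (Inr j)) i) \<in> pfun_polys n" for i j
    using pfun_polys_monom[OF pfun.var] ..
  then show "\<exists>n. (\<lambda>v :: 'a + nat \<Rightarrow> complex. arc_fst d (v \<circ> Inr)) \<in> pfun_polys n"
    "\<exists>n. (\<lambda>v :: 'a + nat \<Rightarrow> complex. arc_snd d (v \<circ> Inr)) \<in> pfun_polys n"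
    unfolding arc_fst_def arc_snd_def o_def by (intro pfun_polys_sum; simp)+
qed

lemma constructible_contact:
  "{v :: nat \<times> nat + nat \<Rightarrow> complex.
      (arc_fst d (v \<circ> Inr), arc_snd d (v \<circ> Inr)) \<in> contact_arcs d (v \<circ> Inl)} \<in> constructible"
proof -
  obtain n where F: "(\<lambda>v :: nat \<times> nat + nat \<Rightarrow> complex. arc_fst d (v \<circ> Inr)) \<in> pfun_polys n"
    using pfun_polys_arcs(1) by blast
  obtain m where G: "(\<lambda>v :: nat \<times> nat + nat \<Rightarrow> complex. arc_snd d (v \<circ> Inr)) \<in> pfun_polys m"
    using pfun_polys_arcs(2) by blast
  have "\<exists>N. (\<lambda>v :: nat \<times> nat + nat \<Rightarrow> complex. smult (v (Inl (i, j)))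
      (arc_fst d (v \<circ> Inr) ^ i * arc_snd d (v \<circ> Inr) ^ j)) \<in> pfun_polys N" for i j
    using pfun_polys_smult[OF pfun.var pfun_polys_mult[OF pfun_polys_power[OF F] pfun_polys_power[OF G]]] ..
  then have "\<exists>N. (\<lambda>v :: nat \<times> nat + nat \<Rightarrow> complex. \<Sum>ij\<in>mon_set d. smult (v (Inl (fst ij, snd ij)))
      (arc_fst d (v \<circ> Inr) ^ fst ij * arc_snd d (v \<circ> Inr) ^ snd ij)) \<in> pfun_polys N"
    by (intro pfun_polys_sum finite_mon_set)
  then obtain N where N: "(\<lambda>v :: nat \<times> nat + nat \<Rightarrow> complex.
      curve_subst d (v \<circ> Inl) (arc_fst d (v \<circ> Inr)) (arc_snd d (v \<circ> Inr))) \<in> pfun_polys N"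
    by (auto simp: curve_subst_def case_prod_beta)
  have "{v :: nat \<times> nat + nat \<Rightarrow> complex.
      (arc_fst d (v \<circ> Inr), arc_snd d (v \<circ> Inr)) \<in> contact_arcs d (v \<circ> Inl)} =
    {v. coeff (arc_fst d (v \<circ> Inr)) d * coeff (arc_snd d (v \<circ> Inr)) d = of_real (-1)} \<inter>
    {v. \<forall>k\<in>{..<2*d}. coeff (curve_subst d (v \<circ> Inl) (arc_fst d (v \<circ> Inr)) (arc_snd d (v \<circ> Inr))) k = of_real 0}"
    by (auto simp: contact_arcs_def arcs_def coeff_arc_fst coeff_arc_snd intro!: degree_le)
  also have "\<dots> \<in> constructible"
    by (intro constructible.inter constructible_ball constructible_eq pfun.mult pfun.const
        pfun_polys_coeff[OF F] pfun_polys_coeff[OF G] pfun_polys_coeff[OF N] finite_lessThan)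
  finally show ?thesis .
qed

lemma arc_upd:
  "j \<notin> {1..2*d} \<Longrightarrow> arc_fst d (v(Inr j := t) \<circ> Inr) = arc_fst d (v \<circ> Inr)"
  "j \<notin> {1..2*d} \<Longrightarrow> arc_snd d (v(Inr j := t) \<circ> Inr) = arc_snd d (v \<circ> Inr)"
  by (auto simp: poly_eq_iff coeff_arc_fst coeff_arc_snd)

text \<open>The universal quantifier is the complement of an existential one over the spare slot
  \<open>2*d+1\<close>; the parameter itself sits in slot 0.\<close>

lemma constructible_unique_preimage:
  "{v :: 'a + nat \<Rightarrow> complex. \<forall>s. poly (arc_fst d (v \<circ> Inr)) s = poly (arc_fst d (v \<circ> Inr)) (v (Inr 0)) \<and>
      poly (arc_snd d (v \<circ> Inr)) s = poly (arc_snd d (v \<circ> Inr)) (v (Inr 0)) \<longrightarrow> s = v (Inr 0)} \<in> constructible"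
proof -
  obtain n where F: "(\<lambda>v :: 'a + nat \<Rightarrow> complex. arc_fst d (v \<circ> Inr)) \<in> pfun_polys n"
    using pfun_polys_arcs(1) by blast
  obtain m where G: "(\<lambda>v :: 'a + nat \<Rightarrow> complex. arc_snd d (v \<circ> Inr)) \<in> pfun_polys m"
    using pfun_polys_arcs(2) by blast
  define S where "S = {v :: 'a + nat \<Rightarrow> complex.
     poly (arc_fst d (v \<circ> Inr)) (v (Inr (2*d+1))) = poly (arc_fst d (v \<circ> Inr)) (v (Inr 0))} \<inter>
     {v. poly (arc_snd d (v \<circ> Inr)) (v (Inr (2*d+1))) = poly (arc_snd d (v \<circ> Inr)) (v (Inr 0))} \<inter>
     - {v. v (Inr (2*d+1)) = v (Inr 0)}"
  have "S \<in> constructible" unfolding S_def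
    by (intro constructible.inter constructible.compl constructible_eq pfun.var
        pfun_polys_poly[OF F] pfun_polys_poly[OF G])
  then have "- {v. \<exists>s. v(Inr (2*d+1) := s) \<in> S} \<in> constructible"
    by (intro constructible.compl constructible_ex)
  also have "- {v. \<exists>s. v(Inr (2*d+1) := s) \<in> S} = {v :: 'a + nat \<Rightarrow> complex.
      \<forall>s. poly (arc_fst d (v \<circ> Inr)) s = poly (arc_fst d (v \<circ> Inr)) (v (Inr 0)) \<and>
      poly (arc_snd d (v \<circ> Inr)) s = poly (arc_snd d (v \<circ> Inr)) (v (Inr 0)) \<longrightarrow> s = v (Inr 0)}"
  proof -
    have "v(Inr (2*d+1) := s) \<in> S \<longleftrightarrow> poly (arc_fst d (v \<circ> Inr)) s = poly (arc_fst d (v \<circ> Inr)) (v (Inr 0)) \<and>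
      poly (arc_snd d (v \<circ> Inr)) s = poly (arc_snd d (v \<circ> Inr)) (v (Inr 0)) \<and> s \<noteq> v (Inr 0)" for v s
    proof -
      have *: "arc_fst d (v(Inr (2*d+1) := s) \<circ> Inr) = arc_fst d (v \<circ> Inr)"
        "arc_snd d (v(Inr (2*d+1) := s) \<circ> Inr) = arc_snd d (v \<circ> Inr)"
        by (rule arc_upd; simp)+
      show ?thesis unfolding S_def Int_iff mem_Collect_eq Compl_iff * by simp
    qed
    then show ?thesis by auto
  qed
  finally show ?thesis .
qed

lemma constructible_simple_at:
  "{v :: 'a + nat \<Rightarrow> complex. \<exists>t. simple_at (arc_fst d (v \<circ> Inr)) (arc_snd d (v \<circ> Inr)) t} \<in> constructible"
proof -
  obtain n where F: "(\<lambda>v :: 'a + nat \<Rightarrow> complex. arc_fst d (v \<circ> Inr)) \<in> pfun_polys n"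
    using pfun_polys_arcs(1) by blast
  have D: "(\<lambda>v :: 'a + nat \<Rightarrow> complex. poly (pderiv (arc_fst d (v \<circ> Inr))) (v (Inr 0))) \<in> pfun"
    by (rule pfun_polys_poly[OF pfun_polys_pderiv[OF F] pfun.var])
  define S where "S = - {v :: 'a + nat \<Rightarrow> complex. poly (pderiv (arc_fst d (v \<circ> Inr))) (v (Inr 0)) = 0} \<inter>
    {v. \<forall>s. poly (arc_fst d (v \<circ> Inr)) s = poly (arc_fst d (v \<circ> Inr)) (v (Inr 0)) \<and>
      poly (arc_snd d (v \<circ> Inr)) s = poly (arc_snd d (v \<circ> Inr)) (v (Inr 0)) \<longrightarrow> s = v (Inr 0)}"
  have "S \<in> constructible" unfolding S_def
    by (intro constructible.inter constructible.compl constructible.zero D constructible_unique_preimage)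
  then have "{v. \<exists>t. v(Inr 0 := t) \<in> S} \<in> constructible" by (rule constructible_ex)
  moreover have "v(Inr 0 := t) \<in> S \<longleftrightarrow> simple_at (arc_fst d (v \<circ> Inr)) (arc_snd d (v \<circ> Inr)) t" for v t
    unfolding S_def simple_at_def Int_iff mem_Collect_eq Compl_iff arc_upd[of 0 d, simplified]
    by (simp add: arc_upd[of 0 d, simplified] del: o_apply)
  ultimately show ?thesis by simp
qed

text \<open>The non-injective parameters form a finite or cofinite set by
  \<open>constructible_slice\<close>. If they were cofinite they would accumulate at
  \<open>t\<close>, against \<open>simple_at_limit\<close> applied to the constant arc.\<close>

lemma simple_at_imp_generically_injective:
  assumes "(p, q) \<in> arcs d" "coeff p d \<noteq> 0" "simple_at p q t"
  shows "generically_injective p q"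
proof -
  obtain x where x: "p = arc_fst d x" "q = arc_snd d x"
    using bij_betw_arcs[of d] assms(1) unfolding bij_betw_def by blast
  define v :: "unit + nat \<Rightarrow> complex" where "v = case_sum (\<lambda>_. 0) x"
  have v: "v \<circ> Inr = x" by (simp add: v_def fun_eq_iff)
  define bad where "bad = {t. \<exists>s. s \<noteq> t \<and> poly p s = poly p t \<and> poly q s = poly q t}"
  define S where "S = {v :: unit + nat \<Rightarrow> complex.
      \<forall>s. poly (arc_fst d (v \<circ> Inr)) s = poly (arc_fst d (v \<circ> Inr)) (v (Inr 0)) \<and>
      poly (arc_snd d (v \<circ> Inr)) s = poly (arc_snd d (v \<circ> Inr)) (v (Inr 0)) \<longrightarrow> s = v (Inr 0)}"
  have *: "arc_fst d (v(Inr 0 := t) \<circ> Inr) = p" "arc_snd d (v(Inr 0 := t) \<circ> Inr) = q" for t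
    using arc_upd[of 0 d v t] unfolding v x by (simp_all only: atLeastAtMost_iff) simp_all
  have "v(Inr 0 := t) \<in> S \<longleftrightarrow> t \<notin> bad" for t
    unfolding S_def bad_def mem_Collect_eq * by auto
  then have "{t. v(Inr 0 := t) \<in> S} = - bad" "{t. v(Inr 0 := t) \<notin> S} = bad"
    by (simp_all only: set_eq_iff mem_Collect_eq Compl_iff not_not simp_thms)
  then have "finite (- bad) \<or> finite bad"
    using constructible_slice[OF constructible_unique_preimage[of d], of v "Inr 0", folded S_def] by simp
  moreover have False if "finite (- bad)"
  proof -
    \<comment> \<open>A cofinite set meets every ball, since balls are infinite.\<close>
    have "\<exists>u. dist u t < 1 / Suc n \<and> u \<in> bad" for n
    proof (rule ccontr)
      assume "\<nexists>u. dist u t < 1 / Suc n \<and> u \<in> bad"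
      then have "ball t (1 / Suc n) \<subseteq> - bad" by (auto simp: dist_commute)
      then have "finite (ball t (1 / Suc n))" using that finite_subset by blast
      moreover have "open (ball t (1 / Suc n))" "ball t (1 / Suc n) \<noteq> {}" by simp_all
      ultimately show False using finite_imp_not_open by blast
    qed
    then have "\<forall>n. \<exists>u. dist u t < 1 / Suc n \<and> u \<in> bad" by (rule allI)
    from choice[OF this] obtain T where T: "\<And>n. dist (T n) t < 1 / Suc n" "\<And>n. T n \<in> bad" by blast
    have "T \<longlonglongrightarrow> t"
    proof (rule metric_LIMSEQ_I)
      fix e :: real assume "e > 0"
      then obtain N where N: "1 / real (Suc N) < e" using nat_approx_posE by blast
      have "dist (T n) t < e" if "n \<ge> N" for n
      proof -
        have "1 / real (Suc n) \<le> 1 / real (Suc N)" using that by (intro divide_left_mono) auto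
        with T(1)[of n] N show ?thesis by linarith
      qed
      then show "\<exists>N. \<forall>n\<ge>N. dist (T n) t < e" by blast
    qed
    moreover have "\<forall>n. \<exists>s. s \<noteq> T n \<and> poly p s = poly p (T n) \<and> poly q s = poly q (T n)"
      using T(2) by (simp add: bad_def)
    from choice[OF this] obtain S where
      "\<And>n. S n \<noteq> T n" "\<And>n. poly p (S n) = poly p (T n)" "\<And>n. poly q (S n) = poly q (T n)" by blast
    ultimately show False
      using assms by (intro simple_at_limit[of "\<lambda>_. p" p d "\<lambda>_. q" q t T S]) (simp_all add: arcs_def)
  qed
  ultimately have "finite bad" by blast
  then show ?thesis by (simp only: generically_injective_def bad_def)
qed

subsection \<open>Aperiodic antisymmetric necklaces\<close>

text \<open>
  Indicator functions \<open>k \<mapsto> (\<omega>\<^sup>k \<in> S)\<close> of the sets \<open>S\<close> of \<open>2n\<close>-th roots of unity whose complement is \<open>-S\<close>,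
  where \<open>\<omega>\<close> is a primitive root.
\<close>

definition alternating :: "nat \<Rightarrow> (int \<Rightarrow> bool) set" where
  "alternating n = {s. \<forall>i. s (i + int n) \<noteq> s i}"

definition primitive_alternating :: "nat \<Rightarrow> (int \<Rightarrow> bool) set" where
  "primitive_alternating n = {s \<in> alternating n. \<forall>j. (\<forall>i. s (i + j) = s i) \<longrightarrow> 2 * int n dvd j}"

lemma alternating_shift:
  assumes "s \<in> alternating n"
  shows "s (i + int n * k) = (s i \<noteq> odd k)"
proof (induction k rule: int_induct[where k = 0])
  case base
  show ?case by simp
next
  case (step1 k)
  have "s (i + int n * k + int n) \<noteq> s (i + int n * k)" using assms by (simp add: alternating_def)
  with step1 show ?case by (auto simp: algebra_simps)
next
  case (step2 k)
  have "s (i + int n * (k - 1) + int n) \<noteq> s (i + int n * (k - 1))" using assms by (simp add: alternating_def)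
  moreover have "i + int n * (k - 1) + int n = i + int n * k" by (simp add: algebra_simps)
  ultimately show ?case using step2 by auto
qed

lemma alternating_mult:
  assumes "s \<in> alternating n" "odd e"
  shows "s \<in> alternating (n * e)"
  unfolding alternating_def using alternating_shift[OF assms(1), of _ "int e"] assms(2) by auto

text \<open>The values on one block of length \<open>n\<close> are arbitrary, and each following
  block is the negation of the preceding one.\<close>

lemma card_alternating:
  assumes "n > 0"
  shows "finite (alternating n)" "card (alternating n) = 2 ^ n"
proof -
  have "bij_betw (\<lambda>s. {i \<in> {0..<int n}. s i}) (alternating n) (Pow {0..<int n})"
    unfolding bij_betw_def
  proof
    show "inj_on (\<lambda>s. {i \<in> {0..<int n}. s i}) (alternating n)"
    proof (rule inj_onI, rule ext)
      fix s t i assume s: "s \<in> alternating n" and t: "t \<in> alternating n"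
        and eq: "{i \<in> {0..<int n}. s i} = {i \<in> {0..<int n}. t i}"
      have "i mod int n \<in> {0..<int n}" using assms by simp
      with eq have "s (i mod int n) = t (i mod int n)" by blast
      then show "s i = t i"
        using alternating_shift[OF s, of "i mod int n" "i div int n"]
          alternating_shift[OF t, of "i mod int n" "i div int n"] by (simp add: mod_mult_div_eq)
    qed
    show "(\<lambda>s. {i \<in> {0..<int n}. s i}) ` alternating n = Pow {0..<int n}"
    proof (intro equalityI subsetI)
      fix T assume T: "T \<in> Pow {0..<int n}"
      define s where "s i = ((i mod int n \<in> T) \<noteq> odd (i div int n))" for i
      have "s \<in> alternating n" using assms by (auto simp: alternating_def s_def)
      moreover have "T = {i \<in> {0..<int n}. s i}" using T by (auto simp: s_def)
      ultimately show "T \<in> (\<lambda>s. {i \<in> {0..<int n}. s i}) ` alternating n" by blast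
    qed auto
  qed
  then show "finite (alternating n)" "card (alternating n) = 2 ^ n"
    using bij_betw_finite bij_betw_same_card by (fastforce simp: card_Pow)+
qed

text \<open>The least period \<open>T\<close> of \<open>s\<close> divides \<open>2 * d\<close> but
  not \<open>d\<close>. Hence \<open>2 * d\<close> is an odd multiple of \<open>T\<close>, so
  \<open>T = 2 * k\<close> is even, and \<open>s\<close> is primitive for \<open>k\<close>.\<close>

lemma alternating_decompose:
  assumes "d > 0"
  shows "alternating d = (\<Union>k\<in>{k. k dvd d \<and> odd (d div k)}. primitive_alternating k)"
proof (intro equalityI subsetI)
  fix s assume s: "s \<in> alternating d"
  define period where "period j \<longleftrightarrow> (\<forall>i. s (i + j) = s i)" for j :: int
  have p_add: "period (a + b)" if "period a" "period b" for a b
    using that unfolding period_def by (metis add.assoc)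
  have p_neg: "period (- a)" if "period a" for a
    using that unfolding period_def by (metis diff_add_cancel uminus_add_conv_diff add.commute)
  have p_mult: "period (a * k)" if "period a" for a k
  proof (induction k rule: int_induct[where k = 0])
    case base
    show ?case by (simp add: period_def)
  next
    case (step1 i)
    from p_add[OF step1(2) that] show ?case by (simp add: algebra_simps)
  next
    case (step2 i)
    from p_add[OF step2(2) p_neg[OF that]] show ?case by (simp add: algebra_simps)
  qed
  define T where "T = (LEAST t. t > 0 \<and> period (int t))"
  have "period (int (2 * d))" unfolding period_def using alternating_shift[OF s, of _ 2] by (simp add: mult.commute)
  then have "2 * d > 0 \<and> period (int (2 * d))" using assms by simp
  then have T: "T > 0 \<and> period (int T)" unfolding T_def by (rule LeastI)
  have T_least: "T \<le> t" if "t > 0" "period (int t)" for t unfolding T_def using that by (intro Least_le) simp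
  have T_dvd: "int T dvd j" if "period j" for j
  proof (rule ccontr)
    assume nd: "\<not> int T dvd j"
    have "period (j + int T * (- (j div int T)))" using p_add p_mult that T by blast
    then have "period (j mod int T)" by (simp add: minus_div_mult_eq_mod[symmetric] mult.commute)
    moreover have "j mod int T \<noteq> 0" using nd by (simp only: dvd_eq_mod_eq_0 not_False_eq_True)
    moreover have "j mod int T \<ge> 0" using T by simp
    ultimately have "int T \<le> j mod int T" using T_least[of "nat (j mod int T)"] by simp
    moreover have "j mod int T < int T" using T by simp
    ultimately show False by linarith
  qed
  obtain e where e: "2 * d = T * e"
    using T_dvd[OF \<open>period (int (2 * d))\<close>] by (metis dvdE int_dvd_int_iff)
  have "\<not> period (int d)" using s by (auto simp: alternating_def period_def)
  have "odd e"
  proof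
    assume "even e"
    then obtain f where "e = 2 * f" by blast
    then have "int d = int T * int f" using e by (metis mult.left_commute mult_left_cancel of_nat_mult zero_neq_numeral)
    then show False using p_mult[of "int T" "int f"] T \<open>\<not> period (int d)\<close> by simp
  qed
  then have "even T" using e by (metis dvd_triv_left even_mult_iff)
  then obtain k where k: "T = 2 * k" by blast
  have dk: "d = k * e" using e k by simp
  have k0: "k > 0" using T k by simp
  obtain f where f: "e = 2 * f + 1" using \<open>odd e\<close> by (rule oddE)
  \<comment> \<open>A shift by \<open>d = k * (2 * f + 1)\<close> is a shift by \<open>k\<close>
    followed by \<open>f\<close> periods \<open>T\<close>, so negation under \<open>d\<close> is
    negation under \<open>k\<close>.\<close>
  have "s (i + int k) \<noteq> s i" for i
  proof -
    have "s (i + int k + int T * int f) = s (i + int k)" using p_mult[of "int T" "int f"] T by (simp add: period_def)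
    moreover have "i + int k + int T * int f = i + int d" unfolding dk f k by (simp add: algebra_simps)
    ultimately show ?thesis using s by (simp add: alternating_def)
  qed
  then have "s \<in> primitive_alternating k"
    using T_dvd k unfolding primitive_alternating_def alternating_def period_def by simp
  then show "s \<in> (\<Union>k\<in>{k. k dvd d \<and> odd (d div k)}. primitive_alternating k)"
    using dk k0 \<open>odd e\<close> by (intro UN_I[of k]) auto
next
  fix s assume "s \<in> (\<Union>k\<in>{k. k dvd d \<and> odd (d div k)}. primitive_alternating k)"
  then obtain k where k: "k dvd d" "odd (d div k)" "s \<in> alternating k" by (auto simp: primitive_alternating_def)
  from alternating_mult[OF k(3,2)] show "s \<in> alternating d" using k(1) by simp
qed

lemma primitive_alternating_disjoint:
  assumes "s \<in> primitive_alternating k" "s \<in> primitive_alternating l"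
  shows "k = l"
proof -
  have "2 * int l dvd int m * 2" if "s \<in> primitive_alternating m" "s \<in> primitive_alternating l" for m l
    using that alternating_shift[of s m _ 2] by (auto simp: primitive_alternating_def)
  from this[OF assms] this[OF assms(2,1)] have "int l dvd int k" "int k dvd int l" by simp_all
  then show ?thesis by (simp add: dvd_antisym)
qed

lemma sum_card_primitive_alternating:
  assumes "d > 0"
  shows "2 ^ d = (\<Sum>k\<in>{k. k dvd d \<and> odd (d div k)}. card (primitive_alternating k))"
proof -
  let ?D = "{k. k dvd d \<and> odd (d div k)}"
  have fin: "finite ?D" using assms by (intro finite_subset[OF _ finite_divisors_nat[of d]]) auto
  have pos: "k > 0" if "k \<in> ?D" for k using that assms by (auto intro!: Nat.gr0I)
  have "card (alternating d) = (\<Sum>k\<in>?D. card (primitive_alternating k))"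
    unfolding alternating_decompose[OF assms]
  proof (rule card_UN_disjoint[OF fin])
    show "\<forall>k\<in>?D. finite (primitive_alternating k)"
      using card_alternating(1)[OF pos] by (auto simp: primitive_alternating_def)
    show "\<forall>k\<in>?D. \<forall>l\<in>?D. k \<noteq> l \<longrightarrow> primitive_alternating k \<inter> primitive_alternating l = {}"
      using primitive_alternating_disjoint by blast
  qed
  then show ?thesis using card_alternating(2)[OF assms] by simp
qed

lemma squarefree_odd_prime_divisor:
  fixes d :: nat
  assumes "squarefree d" "d > 2"
  obtains l where "prime l" "odd l" "l dvd d"
proof (cases "odd d")
  case True
  obtain l where "prime l" "l dvd d" using prime_factor_nat[of d] assms(2) by auto
  with True that show ?thesis using dvd_trans by blast
next
  case False
  then obtain m where m: "d = 2 * m" by blast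
  have "odd m"
  proof
    assume "even m"
    then have "2 ^ 2 dvd d" using m by auto
    then have "is_unit (2 :: nat)" using assms(1) unfolding squarefree_def by blast
    then show False by simp
  qed
  obtain l where "prime l" "l dvd m" using prime_factor_nat[of m] assms(2) m by auto
  with \<open>odd m\<close> that m show ?thesis by (meson dvd_trans dvd_triv_right)
qed

text \<open>For an odd prime \<open>l\<close> dividing \<open>d\<close>, multiplication by
  \<open>l\<close> pairs the divisors not divisible by \<open>l\<close> with those that are.
  Squarefreeness makes this a bijection, and oddness of \<open>l\<close> keeps the codivisor
  odd.\<close>

lemma even_card_odd_codivisors:
  fixes d :: nat
  assumes "squarefree d" "d > 2"
  shows "even (card {k. k dvd d \<and> odd (d div k)})"
proof -
  obtain l where l: "prime l" "odd l" "l dvd d" using squarefree_odd_prime_divisor[OF assms] .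
  let ?D = "{k. k dvd d \<and> odd (d div k)}"
  let ?A = "{k \<in> ?D. \<not> l dvd k}"
  have fin: "finite ?D" using assms by (intro finite_subset[OF _ finite_divisors_nat[of d]]) auto
  have l0: "l > 0" using l(1) prime_gt_0_nat by blast
  have sub: "k * l \<in> ?D" if "k \<in> ?A" for k
  proof -
    have "coprime k l" using l(1) that by (metis (mono_tags, lifting) coprime_commute mem_Collect_eq prime_imp_coprime)
    then have *: "k * l dvd d" using that l(3) by (intro divides_mult) auto
    then obtain m where m: "d = k * l * m" by blast
    then have "d div k = l * m" "d div (k * l) = m" using assms(2) by auto
    with that * show ?thesis by simp
  qed
  have "{k \<in> ?D. l dvd k} = (\<lambda>k. k * l) ` ?A"
  proof (intro equalityI subsetI)
    fix k assume k: "k \<in> {k \<in> ?D. l dvd k}"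
    then obtain j where j: "k = j * l" by (metis (mono_tags, lifting) dvd_def mem_Collect_eq mult.commute)
    obtain m where m: "d = k * m" using k by blast
    have nz: "k > 0" "j > 0" using m j assms(2) by (auto intro!: Nat.gr0I)
    have "odd m" using k m nz by auto
    have "\<not> l dvd j"
    proof
      assume "l dvd j"
      then have "l ^ 2 dvd d" unfolding m j by (auto simp: power2_eq_square)
      then have "is_unit l" using assms(1) unfolding squarefree_def by blast
      then show False using l(1) by (simp add: prime_nat_iff)
    qed
    moreover have "d div j = l * m" using m j nz by simp
    ultimately have "j \<in> ?A" using m j l(2) \<open>odd m\<close> by simp
    then show "k \<in> (\<lambda>k. k * l) ` ?A" using j by blast
  next
    fix k assume "k \<in> (\<lambda>k. k * l) ` ?A"
    then obtain j where "j \<in> ?A" "k = j * l" by (rule imageE)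
    with sub[of j] show "k \<in> {k \<in> ?D. l dvd k}" by simp
  qed
  then have "card {k \<in> ?D. l dvd k} = card ?A" using l0 by (simp add: card_image inj_on_def)
  moreover have "card ?D = card {k \<in> ?D. l dvd k} + card ?A"
  proof -
    have "?D = {k \<in> ?D. l dvd k} \<union> ?A" by blast
    then show ?thesis using fin by (metis (no_types, lifting) card_Un_disjoint disjoint_iff finite_Un mem_Collect_eq)
  qed
  ultimately show ?thesis by simp
qed

text \<open>
  All primitive counts below \<open>d\<close> have the same residue and there is an odd number of them,
  while \<open>2\<^sup>d\<close> vanishes for the modulus in question.
\<close>

lemma card_primitive_alternating_mod:
  fixes d :: nat
  assumes "squarefree d" "d > 0"
  shows "card (primitive_alternating d) mod (if even d then 8 else 4) = (if even d then 4 else 2)"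
  using assms
proof (induction d rule: less_induct)
  case (less d)
  let ?D = "{k. k dvd d \<and> odd (d div k)}"
  let ?f = "\<lambda>k. card (primitive_alternating k)"
  have fin: "finite ?D" using less.prems by (intro finite_subset[OF _ finite_divisors_nat[of d]]) auto
  have mem: "d \<in> ?D" using less.prems by simp
  have sum: "2 ^ d = ?f d + (\<Sum>k\<in>?D - {d}. ?f k)"
    using sum_card_primitive_alternating[OF less.prems(2)] by (simp add: sum.remove[OF fin mem])
  show ?case
  proof (cases "d > 2")
    case False
    have "?D - {d} = {}"
    proof -
      have "d = 1 \<or> d = 2" using False less.prems(2) by auto
      moreover have "k = 2" if "k dvd 2" "odd (2 div k)" for k :: nat
      proof -
        have "k \<le> 2" using that(1) by (simp add: dvd_imp_le)
        then have "k = 0 \<or> k = 1 \<or> k = 2" by auto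
        with that show ?thesis by auto
      qed
      ultimately show ?thesis by auto
    qed
    then have "?f d = 2 ^ d" using sum by (simp only: sum.empty add_0_right)
    moreover have "d = 1 \<or> d = 2" using False less.prems(2) by auto
    ultimately show ?thesis by auto
  next
    case True
    \<comment> \<open>\<open>h\<close> is the value \<open>2 ^ d\<close> of the base cases 2 and 1,
      and \<open>M = 2 * h\<close>, so an odd number of terms congruent to \<open>h\<close> adds up
      to \<open>h\<close> modulo \<open>M\<close>. From \<open>d = 3\<close> on, \<open>M\<close>
      divides \<open>2 ^ d\<close>.\<close>
    define M where "M = (if even d then 8 else 4 :: nat)"
    define h where "h = (if even d then 4 else 2 :: nat)"
    have M: "M = 2 * h" by (simp add: M_def h_def)
    have IH: "?f k mod M = h" if "k \<in> ?D - {d}" for k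
    proof -
      have k: "k dvd d" "odd (d div k)" "k \<noteq> d" using that by auto
      then have "k < d" using less.prems(2) dvd_imp_le by (simp add: order_le_neq_trans)
      moreover have "squarefree k" using less.prems(1) k(1) squarefree_mono by blast
      moreover have "k > 0" using k(1) less.prems(2) by (auto intro!: Nat.gr0I)
      \<comment> \<open>The codivisor is odd, so \<open>k\<close> has the parity of \<open>d\<close>
        and the induction hypothesis carries the same modulus and residue.\<close>
      moreover have "even k \<longleftrightarrow> even d" using k by (metis dvd_mult_div_cancel even_mult_iff)
      ultimately show ?thesis using less.IH[of k] by (simp add: M_def h_def)
    qed
    have "even (Suc (card (?D - {d})))"
      unfolding card_Suc_Diff1[OF fin mem] by (rule even_card_odd_codivisors[OF less.prems(1) True])
    then have "odd (card (?D - {d}))" by (simp only: even_Suc not_False_eq_True)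
    then obtain r where r: "card (?D - {d}) = 2 * r + 1" by (rule oddE)
    have "(\<Sum>k\<in>?D - {d}. ?f k) mod M = (\<Sum>k\<in>?D - {d}. ?f k mod M) mod M"
      by (rule mod_sum_eq[symmetric])
    also have "(\<Sum>k\<in>?D - {d}. ?f k mod M) = card (?D - {d}) * h" using IH by simp
    also have "\<dots> = M * r + h" unfolding r M by (simp add: algebra_simps)
    also have "\<dots> mod M = h" by (simp add: M_def h_def)
    finally have S: "(\<Sum>k\<in>?D - {d}. ?f k) mod M = h" .
    have "M dvd 2 ^ 3" "d \<ge> 3" using True by (auto simp: M_def)
    then have "M dvd 2 ^ d" using le_imp_power_dvd dvd_trans by blast
    then have "(?f d + (\<Sum>k\<in>?D - {d}. ?f k)) mod M = 0" unfolding sum by simp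
    then have fh: "(?f d + h) mod M = 0" by (metis S mod_add_right_eq)
    have *: "x mod M = h" if "(x + h) mod M = 0" for x
    proof (cases "even d")
      case True
      with that show ?thesis unfolding M_def h_def by simp presburger
    next
      case False
      with that show ?thesis unfolding M_def h_def by simp presburger
    qed
    have "?f d mod M = h" by (rule *[OF fh])
    then show ?thesis by (simp add: M_def h_def)
  qed
qed

text \<open>The modulus 8 or 4 divides \<open>4 * d\<close>, but the count is 4 or 2 modulo
  it.\<close>

lemma not_4d_dvd_card_primitive_alternating:
  fixes d :: nat
  assumes "squarefree d" "d > 0"
  shows "\<not> 4 * d dvd card (primitive_alternating d)"
proof
  assume *: "4 * d dvd card (primitive_alternating d)"
  have "(if even d then 8 else 4) dvd 4 * d" by (auto elim!: evenE)
  from dvd_trans[OF this *] card_primitive_alternating_mod[OF assms] show False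
    by (auto split: if_splits)
qed

subsection \<open>Rotations of the parameter\<close>

definition rot :: "complex \<Rightarrow> complex poly \<times> complex poly \<Rightarrow> complex poly \<times> complex poly" where
  "rot z x = (pcompose (fst x) [:0, z:], pcompose (snd x) [:0, z:])"

lemma rot_1 [simp]: "rot 1 x = x"
  by (simp add: rot_def poly_eq_iff coeff_pcompose_linear prod_eq_iff)

lemma rot_rot: "rot z (rot w x) = rot (z * w) x"
  by (simp add: rot_def poly_eq_iff coeff_pcompose_linear power_mult_distrib mult_ac)

lemma pcompose_power:
  fixes p q :: "'a :: comm_semiring_1 poly"
  shows "pcompose (p ^ n) q = pcompose p q ^ n"
  by (induction n) (simp_all add: pcompose_1 pcompose_mult)

lemma curve_subst_pcompose:
  "curve_subst d c (pcompose p r) (pcompose q r) = pcompose (curve_subst d c p q) r"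
  unfolding curve_subst_def pcompose_sum
  by (intro sum.cong refl) (simp add: case_prod_beta pcompose_smult pcompose_mult pcompose_power)

lemma degree_pcompose_linear_le:
  fixes p :: "complex poly"
  shows "degree (pcompose p [:0, z:]) \<le> degree p"
  by (rule degree_le) (simp add: coeff_pcompose_linear coeff_eq_0)

lemma rot_arcs:
  assumes "x \<in> arcs d"
  shows "rot z x \<in> arcs d"
proof -
  obtain p q where x: "x = (p, q)" by fastforce
  have "degree (pcompose p [:0, z:]) \<le> degree p" "degree (pcompose q [:0, z:]) \<le> degree q"
    by (rule degree_pcompose_linear_le)+
  then show ?thesis using assms by (simp add: x arcs_def rot_def poly_0_coeff_0)
qed

lemma rot_contact_arcs:
  assumes "x \<in> contact_arcs d c" "z ^ (2*d) = 1"
  shows "rot z x \<in> contact_arcs d c"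
proof -
  obtain p q where x: "x = (p, q)" by fastforce
  have a: "(p, q) \<in> arcs d" and l: "coeff p d * coeff q d = -1"
    and k: "\<And>k. k < 2*d \<Longrightarrow> coeff (curve_subst d c p q) k = 0"
    using assms(1) by (auto simp: x contact_arcs_def)
  have "(z ^ d * coeff p d) * (z ^ d * coeff q d) = z ^ (2*d) * (coeff p d * coeff q d)"
    by (simp add: mult_2 power_add)
  then show ?thesis
    using rot_arcs[OF a, of z] k l assms(2)
    by (simp add: x rot_def contact_arcs_def coeff_pcompose_linear curve_subst_pcompose)
qed

lemma simple_at_rot:
  assumes "z \<noteq> 0" "simple_at p q t"
  shows "simple_at (pcompose p [:0, z:]) (pcompose q [:0, z:]) (t / z)"
proof -
  have "s = t / z" if "poly p (z * s) = poly p t" "poly q (z * s) = poly q t" for s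
  proof -
    have "z * s = t" using assms(2) that by (simp add: simple_at_def)
    then show ?thesis using assms(1) by (simp add: field_simps)
  qed
  then show ?thesis
    using assms by (simp add: simple_at_def pderiv_pcompose poly_pcompose pderiv_pCons mult.commute)
qed

text \<open>The parameters \<open>t\<close> and \<open>t * z\<close> have the same image, hence
  coincide. For \<open>t = 0\<close> this says nothing, but then the linear coefficient of
  \<open>p\<close> is nonzero and is multiplied by \<open>z\<close>.\<close>

lemma simple_at_rot_fixed:
  assumes "simple_at p q t" "rot z (p, q) = (p, q)"
  shows "z = 1"
proof -
  have p: "pcompose p [:0, z:] = p" and q: "pcompose q [:0, z:] = q" using assms(2) by (simp_all add: rot_def)
  have "poly p (t * z) = poly p t" "poly q (t * z) = poly q t"
    using arg_cong[OF p, of "\<lambda>r. poly r t"] arg_cong[OF q, of "\<lambda>r. poly r t"] by (simp_all add: poly_pcompose)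
  then have *: "t * z = t" using assms(1) unfolding simple_at_def by blast
  show ?thesis
  proof (cases "t = 0")
    case False
    with * show ?thesis by simp
  next
    case True
    then have "coeff p 1 \<noteq> 0" using assms(1) by (simp add: simple_at_def poly_0_coeff_0 coeff_pderiv)
    moreover have "z * coeff p 1 = coeff p 1"
      using arg_cong[OF p, of "\<lambda>r. coeff r 1"] by (simp add: coeff_pcompose_linear)
    ultimately show ?thesis by simp
  qed
qed

lemma finite_roots_of_unity:
  assumes "d > 0"
  shows "finite {z :: complex. z ^ (2*d) = 1}" "card {z :: complex. z ^ (2*d) = 1} = 2 * d"
  using card_roots_unity_eq[of "2*d"] finite_roots_unity[of "2*d"] assms by simp_all

text \<open>The rotations and the involution \<open>\<sigma>\<close> generate orbits
  \<open>R x \<union> R (\<sigma> x)\<close>: \<open>free1\<close> gives each half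
  \<open>2 * d\<close> elements and \<open>free2\<close> makes the halves disjoint. The twist
  \<open>\<tau>\<close> allows both the exchange of coordinates, which commutes with rotations, and
  complex conjugation, which inverts them.\<close>

lemma free_action_dvd_card:
  fixes X :: "(complex poly \<times> complex poly) set" and \<sigma> :: "complex poly \<times> complex poly \<Rightarrow> complex poly \<times> complex poly"
  assumes fin: "finite X" and d: "d > 0"
    and rot: "\<And>x z. x \<in> X \<Longrightarrow> z ^ (2*d) = 1 \<Longrightarrow> rot z x \<in> X"
    and sig: "\<And>x. x \<in> X \<Longrightarrow> \<sigma> x \<in> X" and sig2: "\<And>x. \<sigma> (\<sigma> x) = x"
    and comm: "\<And>x z. \<sigma> (rot z x) = rot (\<tau> z) (\<sigma> x)" and \<tau>: "\<And>z. z ^ (2*d) = 1 \<Longrightarrow> \<tau> z ^ (2*d) = 1"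
    and free1: "\<And>x z. x \<in> X \<Longrightarrow> z ^ (2*d) = 1 \<Longrightarrow> rot z x = x \<Longrightarrow> z = 1"
    and free2: "\<And>x z. x \<in> X \<Longrightarrow> z ^ (2*d) = 1 \<Longrightarrow> \<sigma> x \<noteq> rot z x"
  shows "4 * d dvd card X"
proof -
  define U where "U = {z :: complex. z ^ (2*d) = 1}"
  have U: "finite U" "card U = 2 * d" using finite_roots_of_unity[OF d] by (simp_all add: U_def)
  have nz: "z \<noteq> 0" if "z \<in> U" for z using that d by (auto simp: U_def power_0_left)
  have U_mult: "z * w \<in> U" "z / w \<in> U" "inverse w \<in> U" if "z \<in> U" "w \<in> U" for z w
    using that by (simp_all add: U_def power_mult_distrib power_divide power_inverse)
  have U1: "1 \<in> U" by (simp add: U_def)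
  define R where "R x = (\<lambda>z. rot z x) ` U" for x
  define Orb where "Orb x = R x \<union> R (\<sigma> x)" for x
  have R_rot: "R (rot w x) = R x" if "w \<in> U" for w x
  proof
    show "R (rot w x) \<subseteq> R x" using U_mult(1)[OF _ that] by (auto simp: R_def rot_rot)
    show "R x \<subseteq> R (rot w x)"
    proof
      fix y assume "y \<in> R x"
      then obtain z where z: "z \<in> U" "y = rot z x" by (auto simp: R_def)
      then have "y = rot (z / w) (rot w x)" using nz[OF that] by (simp add: rot_rot)
      with U_mult(2)[OF z(1) that] show "y \<in> R (rot w x)" by (auto simp: R_def)
    qed
  qed
  have rot_eq: "z = w" if "x \<in> X" "z \<in> U" "w \<in> U" "rot z x = rot w x" for x z w
  proof -
    have "rot (inverse w * z) x = rot (inverse w) (rot z x)" by (simp add: rot_rot)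
    also have "\<dots> = rot (inverse w * w) x" by (simp add: that(4) rot_rot)
    also have "\<dots> = x" using nz[OF that(3)] by simp
    finally have fixed: "rot (inverse w * z) x = x" .
    have "(inverse w * z) ^ (2*d) = 1"
      using U_mult(1)[OF U_mult(3)[OF U1 that(3)] that(2)] by (simp only: U_def mem_Collect_eq)
    from free1[OF that(1) this fixed] have "inverse w * z = 1" .
    then show ?thesis using nz[OF that(3)] by (simp add: field_simps)
  qed
  have R_card: "finite (R x)" "card (R x) = 2 * d" if "x \<in> X" for x
    using U rot_eq[OF that] by (simp_all add: R_def card_image inj_on_def)
  have R_sub: "R x \<subseteq> X" if "x \<in> X" for x using rot[OF that] by (auto simp: R_def U_def)
  have R_disj: "R x \<inter> R (\<sigma> x) = {}" if "x \<in> X" for x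
  proof (rule ccontr)
    assume "R x \<inter> R (\<sigma> x) \<noteq> {}"
    then obtain y where "y \<in> R x" "y \<in> R (\<sigma> x)" by blast
    then obtain z w where zw: "z \<in> U" "w \<in> U" "rot z x = rot w (\<sigma> x)"
      unfolding R_def by (elim imageE) simp
    have "\<sigma> x = rot (inverse w) (rot w (\<sigma> x))" using nz[OF zw(2)] by (simp add: rot_rot)
    also have "\<dots> = rot (inverse w * z) x" by (simp add: zw(3)[symmetric] rot_rot)
    finally have "\<sigma> x = rot (inverse w * z) x" .
    moreover have "(inverse w * z) ^ (2*d) = 1"
      using U_mult(1)[OF U_mult(3)[OF U1 zw(2)] zw(1)] by (simp only: U_def mem_Collect_eq)
    ultimately show False using free2[OF that] by blast
  qed
  have Orb_eq: "Orb y = Orb x" if "y \<in> Orb x" for x y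
  proof -
    from that consider w where "w \<in> U" "y = rot w x" | w where "w \<in> U" "y = rot w (\<sigma> x)"
      by (auto simp: Orb_def R_def)
    then show ?thesis
    proof cases
      case 1
      then have "\<tau> w \<in> U" using \<tau> by (simp add: U_def)
      with 1 show ?thesis by (simp add: Orb_def comm R_rot)
    next
      case 2
      then have "\<tau> w \<in> U" using \<tau> by (simp add: U_def)
      with 2 show ?thesis by (simp add: Orb_def comm R_rot sig2 Un_commute)
    qed
  qed
  have "rot 1 x \<in> R x" for x using U1 unfolding R_def by (rule imageI)
  then have x_Orb: "x \<in> Orb x" for x by (simp add: Orb_def)
  have Union: "\<Union> (Orb ` X) = X"
    using x_Orb R_sub R_sub[OF sig] by (fastforce simp: Orb_def)
  have "4 * d * card (Orb ` X) = card (\<Union> (Orb ` X))"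
  proof (rule card_partition)
    show "card O' = 4 * d" if "O' \<in> Orb ` X" for O'
      using that R_card R_card[OF sig] R_disj by (auto simp: Orb_def card_Un_disjoint)
    show "O1 \<inter> O2 = {}" if "O1 \<in> Orb ` X" "O2 \<in> Orb ` X" "O1 \<noteq> O2" for O1 O2
    proof (rule ccontr)
      assume "O1 \<inter> O2 \<noteq> {}"
      then obtain y where "y \<in> O1" "y \<in> O2" by blast
      moreover obtain x1 x2 where "O1 = Orb x1" "O2 = Orb x2" using \<open>O1 \<in> _\<close> \<open>O2 \<in> _\<close> by blast
      ultimately have "O1 = Orb y" "O2 = Orb y" using Orb_eq by blast+
      with \<open>O1 \<noteq> O2\<close> show False by simp
    qed
  qed (simp_all add: fin Union)
  then have "card X = 4 * d * card (Orb ` X)" by (simp only: Union)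
  then show ?thesis by (rule dvdI)
qed

subsection \<open>The conic\<close>

definition model_conic :: "nat \<times> nat \<Rightarrow> complex" where
  "model_conic ij = (if ij \<in> {(1, 0), (0, 1), (1, 1)} then 1 else 0)"

lemma curve_subst_conic:
  assumes "d > 0"
  shows "curve_subst d model_conic p q = p + q + p * q"
proof -
  have sub: "{(1, 0), (0, 1), (1, 1)} \<subseteq> mon_set d" using assms by (auto simp: mon_set_def)
  have "curve_subst d model_conic p q =
      (\<Sum>(i, j)\<in>{(1, 0), (0, 1), (1, 1)}. smult (model_conic (i, j)) (p ^ i * q ^ j))"
    unfolding curve_subst_def
    by (rule sum.mono_neutral_right[OF finite_mon_set sub]) (auto simp: model_conic_def split: if_splits)
  also have "\<dots> = p + q + p * q" by (simp add: model_conic_def)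
  finally show ?thesis .
qed

lemma coeff_mult_arcs:
  assumes "(p, q) \<in> arcs d"
  shows "coeff (p * q) (2 * d) = coeff p d * coeff q d"
proof -
  have deg: "degree p \<le> d" "degree q \<le> d" using assms by (auto simp: arcs_def)
  have "coeff (p * q) (2 * d) = (\<Sum>i\<in>{d}. coeff p i * coeff q (2 * d - i))"
    unfolding coeff_mult
  proof (rule sum.mono_neutral_right)
    show "\<forall>i\<in>{..2 * d} - {d}. coeff p i * coeff q (2 * d - i) = 0"
    proof
      fix i assume "i \<in> {..2 * d} - {d}"
      then consider "i > d" | "2 * d - i > d" by fastforce
      then show "coeff p i * coeff q (2 * d - i) = 0"
        using deg by cases (simp_all add: coeff_eq_0)
    qed
  qed auto
  then show ?thesis by simp
qed

text \<open>Contact controls the coefficients below \<open>2*d\<close> and the normalisation is the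
  coefficient at \<open>2*d\<close>, beyond which p + q + p q has none. So the conditions merge into
  one polynomial identity, in which a general curve appears as a truncated correction to the
  conic.\<close>

lemma contact_arcs_alt:
  assumes "d > 0"
  shows "(p, q) \<in> contact_arcs d c \<longleftrightarrow> (p, q) \<in> arcs d \<and>
    p + q + p * q + poly_cutoff (2*d) (curve_subst d c p q - (p + q + p * q)) = - monom 1 (2*d)"
proof (cases "(p, q) \<in> arcs d")
  case True
  then have deg: "degree p \<le> d" "degree q \<le> d" by (auto simp: arcs_def)
  have "coeff (p + q + p * q) k = 0" if "k > 2 * d" for k
    using that deg degree_mult_le[of p q] by (simp add: coeff_eq_0)
  moreover have "coeff (p + q + p * q) (2 * d) = coeff p d * coeff q d"
    using assms deg coeff_mult_arcs[OF True] by (simp add: coeff_eq_0)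
  ultimately have "p + q + p * q + poly_cutoff (2*d) (curve_subst d c p q - (p + q + p * q)) = - monom 1 (2*d)
      \<longleftrightarrow> (coeff p d * coeff q d = -1 \<and> (\<forall>k<2*d. coeff (curve_subst d c p q) k = 0))"
    unfolding poly_eq_iff
  proof (intro iffI conjI allI impI, goal_cases)
    case 1
    from 1(3)[rule_format, of "2 * d"] 1(2) show ?case by (simp only: coeff_add coeff_poly_cutoff) simp
  next
    case (2 k)
    from 2(3)[rule_format, of k] 2(4) show ?case by (simp add: coeff_poly_cutoff)
  next
    case (3 k)
    consider "k < 2*d" | "k = 2*d" | "k > 2*d" by linarith
    then show ?case
    proof cases
      case 1
      then show ?thesis using 3(3) by (simp add: coeff_poly_cutoff)
    next
      case 2
      have "coeff (p + q + p * q + poly_cutoff (2*d) (curve_subst d c p q - (p + q + p * q))) k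
          = coeff (p + q + p * q) (2*d)"
        using 2 by (simp add: coeff_poly_cutoff)
      then show ?thesis using 3 2 by simp
    next
      case k: 3
      have "coeff (p + q + p * q + poly_cutoff (2*d) (curve_subst d c p q - (p + q + p * q))) k
          = coeff (p + q + p * q) k"
        using k by (simp add: coeff_poly_cutoff)
      then show ?thesis using 3(1)[OF k] k by simp
    qed
  qed
  with True show ?thesis by (auto simp: contact_arcs_def)
qed (auto simp: contact_arcs_def)

lemma contact_arcs_conic:
  assumes "d > 0"
  shows "(p, q) \<in> contact_arcs d model_conic \<longleftrightarrow> (p, q) \<in> arcs d \<and> (1 + p) * (1 + q) = 1 - monom 1 (2*d)"
proof -
  have "(1 + p) * (1 + q) = 1 + (p + q + p * q)" by (simp add: algebra_simps)
  moreover have "1 + x = 1 - y \<longleftrightarrow> x = - y" for x y :: "complex poly"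
    by (metis add_left_cancel diff_conv_add_uminus)
  ultimately have "(1 + p) * (1 + q) = 1 - monom 1 (2*d) \<longleftrightarrow> p + q + p * q = - monom 1 (2*d)"
    by (simp only:)
  then show ?thesis
    using contact_arcs_alt[OF assms, of p q model_conic] by (simp add: curve_subst_conic[OF assms])
qed

definition shifted_roots :: "complex poly \<Rightarrow> complex set" where
  "shifted_roots p = {z. poly (1 + p) z = 0}"

text \<open>The \<open>2 * d\<close> distinct roots of unity are shared between two factors of
  degree at most \<open>d\<close>, which forces each to take exactly \<open>d\<close> of them and
  none in common.\<close>

lemma shifted_roots_conic:
  assumes d: "d > 0" and pq: "(p, q) \<in> contact_arcs d model_conic"
  shows "shifted_roots p \<union> shifted_roots q = {z. z ^ (2*d) = 1}" (is "?P \<union> ?Q = ?U")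
    "shifted_roots p \<inter> shifted_roots q = {}"
    "card (shifted_roots p) = d" "finite (shifted_roots p)"
proof -
  have eq: "(1 + p) * (1 + q) = 1 - monom 1 (2*d)" and a: "(p, q) \<in> arcs d"
    using pq contact_arcs_conic[OF d] by auto
  have "poly (1 + p) z * poly (1 + q) z = 1 - z ^ (2*d)" for z
    using arg_cong[OF eq, of "\<lambda>r. poly r z"] by (simp only: poly_mult) (simp add: poly_monom)
  then have "poly (1 + p) z = 0 \<or> poly (1 + q) z = 0 \<longleftrightarrow> z ^ (2*d) = 1" for z
    by (metis mult_eq_0_iff right_minus_eq)
  then show U: "?P \<union> ?Q = ?U" by (auto simp: shifted_roots_def)
  have "poly (1 + p) 0 = 1" "poly (1 + q) 0 = 1" using a by (simp_all add: arcs_def poly_0_coeff_0)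
  then have nz: "1 + p \<noteq> 0" "1 + q \<noteq> 0" by (metis poly_0 zero_neq_one)+
  have deg: "degree (1 + p) \<le> d" "degree (1 + q) \<le> d"
    using a by (auto simp: arcs_def intro!: degree_add_le)
  have fin: "finite ?P" "finite ?Q" unfolding shifted_roots_def using nz by (blast intro: poly_roots_finite)+
  then show "finite ?P" by simp
  have c: "card ?P \<le> d" "card ?Q \<le> d"
    using card_poly_roots_bound[OF nz(1)] card_poly_roots_bound[OF nz(2)] deg
    unfolding shifted_roots_def by linarith+
  have "card ?U = 2 * d" using finite_roots_of_unity[OF d] by simp
  then have "2 * d + card (?P \<inter> ?Q) = card ?P + card ?Q"
    using card_Un_Int[OF fin] U by simp
  with c have "card (?P \<inter> ?Q) = 0" "card ?P = d" by linarith+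
  then show "?P \<inter> ?Q = {}" "card ?P = d" using fin by simp_all
qed

text \<open>\<open>1 + p\<close> has degree at most \<open>d\<close> and is determined by its
  \<open>d\<close> roots and its value 1 at 0; \<open>1 + q\<close> is then the cofactor.\<close>

lemma conic_eqI:
  assumes d: "d > 0" and x: "(p, q) \<in> contact_arcs d model_conic" and y: "(p', q') \<in> contact_arcs d model_conic"
    and roots: "shifted_roots p = shifted_roots p'"
  shows "p = p'" "q = q'"
proof -
  have ax: "(p, q) \<in> arcs d" "(1 + p) * (1 + q) = 1 - monom 1 (2*d)"
    and ay: "(p', q') \<in> arcs d" "(1 + p') * (1 + q') = 1 - monom 1 (2*d)"
    using x y contact_arcs_conic[OF d] by auto
  note P = shifted_roots_conic[OF d x]
  have deg: "degree (1 + p) \<le> d" "degree (1 + p') \<le> d"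
    using ax ay by (auto simp: arcs_def intro!: degree_add_le)
  have p0: "poly p 0 = 0" "poly p' 0 = 0" using ax(1) ay(1) by (simp_all add: arcs_def poly_0_coeff_0)
  have "0 \<notin> shifted_roots p" using p0 by (simp add: shifted_roots_def)
  then have "card (insert 0 (shifted_roots p)) = d + 1" using P(3,4) by simp
  moreover have "poly (1 + p) z = poly (1 + p') z" if "z \<in> insert 0 (shifted_roots p)" for z
  proof (cases "z = 0")
    case True
    then show ?thesis using p0 by simp
  next
    case False
    then have "z \<in> shifted_roots p" "z \<in> shifted_roots p'" using that roots by auto
    then show ?thesis by (simp only: shifted_roots_def mem_Collect_eq)
  qed
  ultimately have "1 + p = 1 + p'" using deg
    by (intro poly_eqI_degree[of "insert 0 (shifted_roots p)"]) auto
  then show "p = p'" by simp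
  moreover have "1 + p \<noteq> 0" using p0(1) by (metis add.right_neutral poly_0 poly_1 poly_add zero_neq_one)
  ultimately have "1 + q = 1 + q'" using ax(2) ay(2) by (metis mult_left_cancel)
  then show "q = q'" by simp
qed

lemma finite_contact_conic:
  assumes "d > 0"
  shows "finite (contact_arcs d model_conic)"
proof (rule inj_on_finite)
  show "inj_on (shifted_roots \<circ> fst) (contact_arcs d model_conic)"
    using conic_eqI[OF assms] by (auto simp: inj_on_def)
  show "(shifted_roots \<circ> fst) ` contact_arcs d model_conic \<subseteq> Pow {z. z ^ (2*d) = 1}"
    using shifted_roots_conic(1)[OF assms] by fastforce
  show "finite (Pow {z :: complex. z ^ (2*d) = 1})" using finite_roots_of_unity[OF assms] by simp
qed

definition primitive_arcs :: "nat \<Rightarrow> (complex poly \<times> complex poly) set" where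
  "primitive_arcs d = {x \<in> contact_arcs d model_conic. \<forall>z. z ^ (2*d) = 1 \<and> rot z x = x \<longrightarrow> z = 1}"

text \<open>Since (1 + p)(1 + q) determines the \<open>2*d\<close>-th power of the parameter, two
  parameters with equal image differ by a root of unity. Without a rotational symmetry each such
  coincidence happens for finitely many parameters only.\<close>

lemma simple_at_conic_iff:
  assumes d: "d > 0" and pq: "(p, q) \<in> contact_arcs d model_conic"
  shows "(\<exists>t. simple_at p q t) \<longleftrightarrow> (p, q) \<in> primitive_arcs d"
proof
  assume "\<exists>t. simple_at p q t"
  then show "(p, q) \<in> primitive_arcs d" using simple_at_rot_fixed pq unfolding primitive_arcs_def by blast
next
  assume prim: "(p, q) \<in> primitive_arcs d"
  let ?U = "{z :: complex. z ^ (2*d) = 1}"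
  have eq: "(1 + p) * (1 + q) = 1 - monom 1 (2*d)" and a: "(p, q) \<in> arcs d"
    using pq contact_arcs_conic[OF d] by auto
  have pd: "coeff p d \<noteq> 0" using pq by (auto simp: contact_arcs_def)
  have val: "t ^ (2*d) = 1 - (1 + poly p t) * (1 + poly q t)" for t
    using arg_cong[OF eq, of "\<lambda>r. poly r t"] by (simp only: poly_mult) (simp add: poly_monom)
  \<comment> \<open>Parameters identified with their rotation by \<open>z\<close>. This set is
    finite unless \<open>rot z\<close> fixes the arc, so some \<open>t\<close> avoids all of them
    and the critical points of \<open>p\<close>.\<close>
  define E where "E z = {t. poly p (t * z) = poly p t \<and> poly q (t * z) = poly q t}" for z
  have E: "finite (E z)" if "z \<in> ?U - {1}" for z
  proof -
    have "rot z (p, q) \<noteq> (p, q)" using prim that by (auto simp: primitive_arcs_def)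
    then have "pcompose p [:0, z:] - p \<noteq> 0 \<or> pcompose q [:0, z:] - q \<noteq> 0" by (simp add: rot_def)
    then have "finite {t. poly (pcompose p [:0, z:] - p) t = 0} \<or> finite {t. poly (pcompose q [:0, z:] - q) t = 0}"
      using poly_roots_finite by blast
    moreover have "E z \<subseteq> {t. poly (pcompose p [:0, z:] - p) t = 0}" "E z \<subseteq> {t. poly (pcompose q [:0, z:] - q) t = 0}"
      by (auto simp: E_def poly_pcompose)
    ultimately show ?thesis using finite_subset by blast
  qed
  have "pderiv p \<noteq> 0"
  proof
    assume "pderiv p = 0"
    then have "coeff (pderiv p) (d - 1) = 0" by simp
    then show False using pd d by (simp add: coeff_pderiv)
  qed
  then have "finite ((\<Union>z\<in>?U - {1}. E z) \<union> {t. poly (pderiv p) t = 0})"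
    using E finite_roots_of_unity[OF d] by (simp add: poly_roots_finite)
  then obtain t where t: "t \<notin> (\<Union>z\<in>?U - {1}. E z) \<union> {t. poly (pderiv p) t = 0}"
    using ex_new_if_finite[OF infinite_UNIV_char_0] by blast
  have "s = t" if s: "poly p s = poly p t" "poly q s = poly q t" for s
  proof -
    have st: "s ^ (2*d) = t ^ (2*d)" unfolding val using s by simp
    show ?thesis
    proof (cases "t = 0")
      case True
      then have "s ^ (2*d) = 0" using st d by (simp add: power_0_left)
      then show ?thesis using True by simp
    next
      case False
      then have "(s / t) ^ (2*d) = 1" using st by (simp add: power_divide)
      moreover have "t \<in> E (s / t)" using s False by (simp add: E_def)
      ultimately have "s / t = 1" using t by blast
      then show ?thesis using False by simp
    qed
  qed
  then have "simple_at p q t" using t by (auto simp: simple_at_def)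
  then show "\<exists>t. simple_at p q t" ..
qed

lemma finite_primitive_arcs: "d > 0 \<Longrightarrow> finite (primitive_arcs d)"
  using finite_contact_conic by (auto simp: primitive_arcs_def)

lemma rot_primitive_arcs:
  assumes "d > 0" "x \<in> primitive_arcs d" "w ^ (2*d) = 1"
  shows "rot w x \<in> primitive_arcs d"
proof -
  have w: "w \<noteq> 0" using assms(1,3) by (auto simp: power_0_left)
  have fixed: "z = 1" if "z ^ (2*d) = 1" "rot z (rot w x) = rot w x" for z
  proof -
    have "rot (inverse w) (rot z (rot w x)) = rot (inverse w) (rot w x)" using that(2) by simp
    moreover have "inverse w * (z * w) = z" "inverse w * w = 1" using w by simp_all
    ultimately have "rot z x = x" by (simp only: rot_rot rot_1)
    with assms(2) that(1) show ?thesis by (simp add: primitive_arcs_def)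
  qed
  have "x \<in> contact_arcs d model_conic" using assms(2) by (simp add: primitive_arcs_def)
  then have "rot w x \<in> contact_arcs d model_conic" using assms(3) by (rule rot_contact_arcs)
  with fixed show ?thesis unfolding primitive_arcs_def by blast
qed

section \<open>Reduction of the count modulo 4d to antisymmetric necklaces\<close>

definition swap_arcs :: "nat \<Rightarrow> (complex poly \<times> complex poly) set" where
  "swap_arcs d = {x \<in> primitive_arcs d. prod.swap x = rot (-1) x}"

text \<open>If the exchange of coordinates acts on \<open>x\<close> as the rotation by
  \<open>z\<close>, applying it twice gives \<open>z * z = 1\<close>. The value 1 would make both
  factors equal although their root sets are disjoint, so only the half turn -1 obstructs freeness,
  and those arcs are removed.\<close>

lemma card_primitive_arcs_cong:
  assumes d: "d > 0"
  shows "4 * d dvd card (primitive_arcs d - swap_arcs d)"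
proof (rule free_action_dvd_card[where \<sigma> = prod.swap and \<tau> = "\<lambda>z. z"])
  have swap_rot: "prod.swap (rot z x) = rot z (prod.swap x)" for z x by (simp add: rot_def prod.swap_def)
  have swap_contact: "prod.swap x \<in> contact_arcs d model_conic" if "x \<in> contact_arcs d model_conic" for x
  proof -
    obtain p q where x: "x = (p, q)" by fastforce
    then show ?thesis using that contact_arcs_conic[OF d] by (simp add: arcs_def mult.commute[of "1 + p"] conj_ac)
  qed
  show "finite (primitive_arcs d - swap_arcs d)" using finite_primitive_arcs[OF d] by simp
  show "d > 0" by fact
  show "prod.swap (prod.swap x) = x" for x :: "complex poly \<times> complex poly" by simp
  show "prod.swap (rot z x) = rot z (prod.swap x)" for z x by (rule swap_rot)
  show "z ^ (2*d) = 1" if "z ^ (2*d) = 1" for z :: complex using that .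
  show "rot z x \<in> primitive_arcs d - swap_arcs d" if "x \<in> primitive_arcs d - swap_arcs d" "z ^ (2*d) = 1" for x z
  proof -
    have z: "z \<noteq> 0" using that(2) d by (auto simp: power_0_left)
    have "prod.swap x = rot (-1) x" if "prod.swap (rot z x) = rot (-1) (rot z x)"
    proof -
      have "rot (inverse z) (rot z (prod.swap x)) = rot (inverse z) (rot (-1) (rot z x))"
        using that by (simp add: swap_rot)
      then show ?thesis using z by (simp add: rot_rot)
    qed
    with that rot_primitive_arcs[OF d] show ?thesis by (auto simp: swap_arcs_def)
  qed
  show "prod.swap x \<in> primitive_arcs d - swap_arcs d" if "x \<in> primitive_arcs d - swap_arcs d" for x
  proof -
    have "prod.swap x = rot (-1) x" if "prod.swap (prod.swap x) = rot (-1) (prod.swap x)"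
    proof -
      have "x = rot (-1) (prod.swap x)" using that by simp
      then have "rot (-1) x = rot (-1) (rot (-1) (prod.swap x))" by simp
      then show ?thesis by (simp add: rot_rot)
    qed
    moreover have "rot z x = x" if "rot z (prod.swap x) = prod.swap x" for z
    proof -
      have "prod.swap (rot z x) = prod.swap x" using that by (simp add: swap_rot)
      then show ?thesis by (metis swap_swap)
    qed
    ultimately show ?thesis using that swap_contact by (auto simp: swap_arcs_def primitive_arcs_def)
  qed
  show "z = 1" if "x \<in> primitive_arcs d - swap_arcs d" "z ^ (2*d) = 1" "rot z x = x" for x z
    using that by (auto simp: primitive_arcs_def)
  show "prod.swap x \<noteq> rot z x" if x: "x \<in> primitive_arcs d - swap_arcs d" and z: "z ^ (2*d) = 1" for x z
  proof
    assume eq: "prod.swap x = rot z x"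
    have "x = prod.swap (prod.swap x)" by simp
    also have "\<dots> = rot (z * z) x" by (simp only: eq swap_rot rot_rot)
    finally have "rot (z * z) x = x" by simp
    moreover have "(z * z) ^ (2*d) = 1" using z by (simp add: power_mult_distrib)
    ultimately have "z * z = 1" using x by (simp add: primitive_arcs_def)
    then consider "z = 1" | "z = -1" by (metis square_eq_1_iff)
    then show False
    proof cases
      case 1
      obtain p q where pq: "x = (p, q)" by fastforce
      from eq have "(q, p) = (p, q)" by (simp only: 1 pq rot_1 swap_simp)
      then have "p = q" by (elim Pair_inject)
      moreover have "(p, q) \<in> contact_arcs d model_conic" using x pq by (simp add: primitive_arcs_def)
      ultimately have "shifted_roots p = {}" "card (shifted_roots p) = d"
        using shifted_roots_conic[OF d, of p q] by auto
      then show False using d by simp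
    next
      case 2
      then show False using x eq by (simp add: swap_arcs_def)
    qed
  qed
qed

definition unity_root :: "nat \<Rightarrow> int \<Rightarrow> complex" where
  "unity_root d i = cis (pi * real_of_int i / real d)"

lemma unity_root_add: "unity_root d (i + j) = unity_root d i * unity_root d j"
  by (simp add: unity_root_def cis_mult add_divide_distrib distrib_left)

lemma unity_root_d: "d > 0 \<Longrightarrow> unity_root d (int d) = -1"
  by (simp add: unity_root_def)

lemma unity_root_eq_1_iff:
  assumes "d > 0"
  shows "unity_root d i = 1 \<longleftrightarrow> 2 * int d dvd i"
proof
  assume "unity_root d i = 1"
  then have "exp (\<i> * of_real (pi * real_of_int i / real d)) = 1" by (simp add: unity_root_def cis_conv_exp)
  then obtain n :: int where "pi * real_of_int i / real d = of_int (2 * n) * pi"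
    unfolding exp_eq_1 by auto
  then have "real_of_int i = of_int (2 * n) * real d" using assms by (simp add: field_simps)
  then have "real_of_int i = of_int (2 * int d * n)" by simp
  then have "i = 2 * int d * n" by (simp only: of_int_eq_iff)
  then show "2 * int d dvd i" by simp
next
  assume "2 * int d dvd i"
  then obtain n where "i = 2 * int d * n" by (rule dvdE)
  then have "pi * real_of_int i / real d = 2 * pi * of_int n" using assms by (simp add: field_simps)
  then show "unity_root d i = 1" by (simp only: unity_root_def) simp
qed

lemma range_unity_root:
  assumes "d > 0"
  shows "range (unity_root d) = {z. z ^ (2*d) = 1}"
proof (intro equalityI subsetI)
  fix z assume "z \<in> range (unity_root d)"
  then obtain i where i: "z = unity_root d i" by blast
  have "real (2*d) * (pi * real_of_int i / real d) = 2 * pi * of_int i" using assms by (simp add: field_simps)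
  then have "z ^ (2*d) = cis (2 * pi * of_int i)" by (simp only: i unity_root_def Complex.DeMoivre)
  then show "z \<in> {z. z ^ (2*d) = 1}" by (simp only: mem_Collect_eq) simp
next
  fix z :: complex assume "z \<in> {z. z ^ (2*d) = 1}"
  moreover have "bij_betw (\<lambda>k. cis (2 * pi * real k / real (2*d))) {..<2*d} {z. z ^ (2*d) = 1}"
    by (rule Complex.bij_betw_roots_unity) (use assms in simp)
  ultimately obtain k where "z = cis (2 * pi * real k / real (2*d))" unfolding bij_betw_def by blast
  then have "z = unity_root d (int k)" by (simp add: unity_root_def)
  then show "z \<in> range (unity_root d)" by blast
qed

lemma unity_root_power: "d > 0 \<Longrightarrow> unity_root d i ^ (2*d) = 1"
  using range_unity_root[of d] rangeI[of "unity_root d" i] by simp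

lemma unity_root_exhaust:
  assumes "d > 0" "z ^ (2*d) = 1"
  obtains i where "z = unity_root d i"
proof -
  have "z \<in> range (unity_root d)" using range_unity_root[OF assms(1)] assms(2) by simp
  then show ?thesis by (elim rangeE) (rule that)
qed

lemma unity_root_nonzero: "unity_root d i \<noteq> 0"
  by (simp add: unity_root_def)

lemma shifted_roots_pcompose:
  "shifted_roots (pcompose p [:0, w:]) = {t. t * w \<in> shifted_roots p}"
  by (simp add: shifted_roots_def poly_pcompose)

text \<open>With q(t) = p(-t), the complement of the root set S of \<open>1 + p\<close> is -S, which
  is antisymmetry under a shift by \<open>d\<close>. A period \<open>j\<close> of the pattern is a
  rotation preserving S, hence fixing the arc, hence trivial.\<close>

lemma swap_arcs_pattern:
  assumes d: "d > 0" and x: "(p, q) \<in> swap_arcs d"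
  shows "(\<lambda>i. unity_root d i \<in> shifted_roots p) \<in> primitive_alternating d"
proof -
  let ?s = "\<lambda>i. unity_root d i \<in> shifted_roots p"
  have prim: "(p, q) \<in> primitive_arcs d" using x by (simp only: swap_arcs_def mem_Collect_eq)
  have "prod.swap (p, q) = rot (-1) (p, q)" using x by (simp only: swap_arcs_def mem_Collect_eq)
  then have q: "q = pcompose p [:0, -1:]" unfolding rot_def swap_simp fst_conv snd_conv by (elim Pair_inject)
  have c: "(p, q) \<in> contact_arcs d model_conic" using prim by (simp add: primitive_arcs_def)
  note P = shifted_roots_conic[OF d c]
  have "?s (i + int d) \<noteq> ?s i" for i
  proof -
    have "unity_root d i \<in> shifted_roots p \<union> shifted_roots q" using unity_root_power[OF d] by (simp only: P(1) mem_Collect_eq)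
    then have "unity_root d i \<in> shifted_roots q \<longleftrightarrow> \<not> ?s i" using P(2) by blast
    then show ?thesis by (simp add: q shifted_roots_pcompose unity_root_add unity_root_d[OF d])
  qed
  moreover have "2 * int d dvd j" if j: "\<forall>i. ?s (i + j) = ?s i" for j
  proof -
    let ?w = "unity_root d j"
    have w: "?w ^ (2*d) = 1" by (rule unity_root_power[OF d])
    have "t * ?w \<in> shifted_roots p \<longleftrightarrow> t \<in> shifted_roots p" for t
    proof (cases "t ^ (2*d) = 1")
      case True
      then obtain i where "t = unity_root d i" by (rule unity_root_exhaust[OF d])
      then show ?thesis using j by (simp add: unity_root_add)
    next
      case False
      then have "t \<notin> shifted_roots p" using P(1) by blast
      moreover have "(t * ?w) ^ (2*d) \<noteq> 1" using False w by (simp add: power_mult_distrib)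
      then have "t * ?w \<notin> shifted_roots p" using P(1) by blast
      ultimately show ?thesis by blast
    qed
    then have "shifted_roots (pcompose p [:0, ?w:]) = shifted_roots p"
      by (simp add: shifted_roots_pcompose)
    moreover have "(pcompose p [:0, ?w:], pcompose q [:0, ?w:]) \<in> contact_arcs d model_conic"
      using rot_contact_arcs[OF c w] by (simp add: rot_def)
    ultimately have "pcompose p [:0, ?w:] = p" "pcompose q [:0, ?w:] = q" using conic_eqI[OF d _ c] by blast+
    then have "rot ?w (p, q) = (p, q)" by (simp add: rot_def)
    then have "?w = 1" using prim w by (simp add: primitive_arcs_def)
    then show ?thesis using unity_root_eq_1_iff[OF d] by blast
  qed
  ultimately show ?thesis by (simp add: primitive_alternating_def alternating_def)
qed

text \<open>The arc is rebuilt from its necklace: antisymmetry gives exactly \<open>d\<close> roots,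
  their product polynomial \<open>A\<close> is \<open>1 + p\<close>, and q(t) = p(-t).\<close>

lemma swap_arcs_surj:
  assumes d: "d > 0" and s: "s \<in> primitive_alternating d"
  shows "\<exists>p q. (p, q) \<in> swap_arcs d \<and> s = (\<lambda>i. unity_root d i \<in> shifted_roots p)"
proof -
  have alt: "s \<in> alternating d" using s by (simp add: primitive_alternating_def)
  define R where "R = unity_root d ` {i. s i}"
  have RU: "R \<subseteq> {z. z ^ (2*d) = 1}" using unity_root_power[OF d] by (auto simp: R_def)
  then have finR: "finite R" using finite_roots_of_unity[OF d] finite_subset by blast
  have R_iff: "unity_root d i \<in> R \<longleftrightarrow> s i" for i
  proof
    assume "unity_root d i \<in> R"
    then obtain j where j: "s j" "unity_root d i = unity_root d j" by (auto simp: R_def)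
    have "unity_root d i = unity_root d j * unity_root d (i - j)" by (simp add: unity_root_add[symmetric])
    then have "unity_root d (i - j) = 1" using j unity_root_nonzero[of d j] by simp
    then obtain k where "i - j = 2 * int d * k" using unity_root_eq_1_iff[OF d] by (metis dvdE)
    then have "i = j + int d * (2 * k)" by simp
    then show "s i" using alternating_shift[OF alt, of j "2 * k"] j(1) by simp
  qed (auto simp: R_def)
  have neg: "- unity_root d i = unity_root d (i + int d)" for i
    by (simp add: unity_root_add unity_root_d[OF d])
  have R_neg: "- z \<in> R \<longleftrightarrow> z \<notin> R" if z: "z ^ (2*d) = 1" for z
  proof -
    obtain i where i: "z = unity_root d i" using unity_root_exhaust[OF d z] .
    show ?thesis using alt by (simp add: i neg R_iff alternating_def)
  qed
  have "{z. z ^ (2*d) = 1} = R \<union> uminus ` R"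
  proof (intro equalityI subsetI)
    fix z :: complex assume z: "z \<in> {z. z ^ (2*d) = 1}"
    show "z \<in> R \<union> uminus ` R"
    proof (cases "z \<in> R")
      case False
      then have "- z \<in> R" using R_neg z by simp
      then have "- (- z) \<in> uminus ` R" by (rule imageI)
      then show ?thesis by simp
    qed simp
  qed (use RU in \<open>auto simp: power_minus_even\<close>)
  moreover have "R \<inter> uminus ` R = {}" using R_neg RU by fastforce
  ultimately have "card {z :: complex. z ^ (2*d) = 1} = card R + card (uminus ` R)"
    using finR by (simp add: card_Un_disjoint)
  then have cardR: "card R = d" using finite_roots_of_unity[OF d] by (simp add: card_image inj_on_def)
  have R0: "0 \<notin> R" using unity_root_nonzero by (auto simp: R_def)
  \<comment> \<open>The factors are scaled to take the value 1 at 0, so that \<open>A - 1\<close>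
    vanishes there.\<close>
  define A where "A = (\<Prod>w\<in>R. [:1, - (1 / w):])"
  have degA: "degree A \<le> d"
  proof -
    have "degree A \<le> sum (degree \<circ> (\<lambda>w. [:1, - (1 / w):])) R" unfolding A_def by (rule degree_prod_sum_le[OF finR])
    also have "\<dots> \<le> (\<Sum>w\<in>R. 1)" by (rule sum_mono) simp
    finally show ?thesis using cardR by simp
  qed
  have polyA: "poly A z = 0 \<longleftrightarrow> z \<in> R" for z
  proof -
    have "poly A z = 0 \<longleftrightarrow> (\<exists>w\<in>R. 1 - z / w = 0)" using finR by (simp add: A_def poly_prod)
    also have "\<dots> \<longleftrightarrow> z \<in> R" using R0 by (auto simp: field_simps)
    finally show ?thesis .
  qed
  have A0: "poly A 0 = 1" by (simp add: A_def poly_prod)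
  define p where "p = A - 1"
  define q where "q = pcompose p [:0, -1:]"
  have A: "A = 1 + p" by (simp add: p_def)
  have arcs: "(p, q) \<in> arcs d"
  proof -
    have "degree p \<le> d" unfolding p_def using degA by (intro degree_diff_le) auto
    moreover have "degree q \<le> degree p" unfolding q_def by (rule degree_pcompose_linear_le)
    moreover have "poly p 0 = 0" "poly q 0 = 0" using A0 by (simp_all add: q_def p_def poly_pcompose)
    ultimately show ?thesis by (simp add: arcs_def flip: poly_0_coeff_0)
  qed
  have "A * (1 + q) = 1 - monom 1 (2*d)"
  \<comment> \<open>Both sides have degree at most \<open>2 * d\<close>, so it suffices to compare
    them at the \<open>2 * d\<close> roots of unity and at 0.\<close>
  proof (rule poly_eqI_degree[of "insert 0 {z. z ^ (2*d) = 1}"])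
    have c: "card (insert 0 {z :: complex. z ^ (2*d) = 1}) = 2 * d + 1"
      using finite_roots_of_unity[OF d] d by (simp add: power_0_left)
    have "degree (1 + q) \<le> d" using arcs by (auto simp: arcs_def intro!: degree_add_le)
    then have "degree (A * (1 + q)) \<le> d + d" using degA degree_mult_le[of A "1 + q"] by linarith
    then show "card (insert 0 {z :: complex. z ^ (2*d) = 1}) > degree (A * (1 + q))" using c by linarith
    have "degree (1 - monom 1 (2*d) :: complex poly) \<le> 2 * d"
      by (intro degree_diff_le) (auto simp: degree_monom_le)
    then show "card (insert 0 {z :: complex. z ^ (2*d) = 1}) > degree (1 - monom 1 (2*d) :: complex poly)"
      using c by linarith
    fix z :: complex assume z: "z \<in> insert 0 {z. z ^ (2*d) = 1}"
    have qz: "poly (1 + q) z = poly A (- z)" by (simp add: q_def A poly_pcompose)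
    show "poly (A * (1 + q)) z = poly (1 - monom 1 (2*d)) z"
    proof (cases "z = 0")
      case True
      have "poly (A * (1 + q)) z = poly A z * poly A (- z)" by (simp only: poly_mult qz)
      then show ?thesis using d True by (simp add: A0 poly_monom power_0_left)
    next
      case False
      with z have zU: "z ^ (2*d) = 1" by simp
      have "poly A z = 0 \<or> poly A (- z) = 0" using polyA R_neg[OF zU] by blast
      then show ?thesis by (simp only: poly_mult qz) (auto simp: poly_monom zU)
    qed
  qed
  then have c: "(p, q) \<in> contact_arcs d model_conic" using arcs contact_arcs_conic[OF d] A by simp
  have roots: "shifted_roots p = R" using polyA by (simp add: shifted_roots_def A)
  have pat: "s = (\<lambda>i. unity_root d i \<in> shifted_roots p)" using R_iff by (simp add: roots)
  have "z = 1" if z: "z ^ (2*d) = 1" "rot z (p, q) = (p, q)" for z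
  proof -
    obtain j where j: "z = unity_root d j" using unity_root_exhaust[OF d z(1)] .
    have "pcompose p [:0, z:] = p" using z(2) by (simp add: rot_def)
    then have "t * z \<in> R \<longleftrightarrow> t \<in> R" for t using shifted_roots_pcompose[of p z] roots by auto
    then have "unity_root d i * unity_root d j \<in> R \<longleftrightarrow> unity_root d i \<in> R" for i unfolding j .
    then have "s (i + j) = s i" for i by (simp only: R_iff flip: unity_root_add)
    then have "2 * int d dvd j" using s by (simp add: primitive_alternating_def)
    then show ?thesis using j unity_root_eq_1_iff[OF d] by blast
  qed
  then have "(p, q) \<in> primitive_arcs d" using c by (simp add: primitive_arcs_def)
  moreover have "prod.swap (p, q) = rot (-1) (p, q)"
  proof -
    have "pcompose q [:0, -1:] = p"
      by (simp add: q_def poly_eq_iff coeff_pcompose_linear flip: power_mult_distrib mult.assoc)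
    then show ?thesis by (simp add: rot_def q_def)
  qed
  ultimately have "(p, q) \<in> swap_arcs d" by (simp add: swap_arcs_def)
  with pat show ?thesis by blast
qed

lemma card_swap_arcs:
  assumes d: "d > 0"
  shows "card (swap_arcs d) = card (primitive_alternating d)"
proof (rule bij_betw_same_card)
  let ?f = "\<lambda>x i. unity_root d i \<in> shifted_roots (fst x)"
  show "bij_betw ?f (swap_arcs d) (primitive_alternating d)"
    unfolding bij_betw_def
  proof
    show "inj_on ?f (swap_arcs d)"
    proof (rule inj_onI)
      fix x y assume x: "x \<in> swap_arcs d" and y: "y \<in> swap_arcs d" and eq: "?f x = ?f y"
      obtain p q where pq: "x = (p, q)" by fastforce
      obtain p' q' where pq': "y = (p', q')" by fastforce
      have c: "(p, q) \<in> contact_arcs d model_conic" "(p', q') \<in> contact_arcs d model_conic"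
        using x y by (auto simp: pq pq' swap_arcs_def primitive_arcs_def)
      have "z \<in> shifted_roots p \<longleftrightarrow> z \<in> shifted_roots p'" if z: "z ^ (2*d) = 1" for z
      proof -
        obtain i where "z = unity_root d i" using unity_root_exhaust[OF d z] .
        then show ?thesis using fun_cong[OF eq, of i] by (simp add: pq pq')
      qed
      moreover have "shifted_roots p \<subseteq> {z. z ^ (2*d) = 1}" "shifted_roots p' \<subseteq> {z. z ^ (2*d) = 1}"
        using shifted_roots_conic(1)[OF d] c by blast+
      ultimately have "shifted_roots p = shifted_roots p'" by blast
      from conic_eqI[OF d c this] show "x = y" by (simp add: pq pq')
    qed
    show "?f ` swap_arcs d = primitive_alternating d"
    proof (intro equalityI subsetI)
      fix s assume "s \<in> ?f ` swap_arcs d"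
      then show "s \<in> primitive_alternating d" using swap_arcs_pattern[OF d] by auto
    next
      fix s assume "s \<in> primitive_alternating d"
      then obtain p q where "(p, q) \<in> swap_arcs d" "s = (\<lambda>i. unity_root d i \<in> shifted_roots p)"
        using swap_arcs_surj[OF d] by blast
      then show "s \<in> ?f ` swap_arcs d" by (intro image_eqI[of _ _ "(p, q)"]) auto
    qed
  qed
qed

lemma not_4d_dvd_card_primitive_arcs:
  assumes "d > 0" "squarefree d"
  shows "\<not> 4 * d dvd card (primitive_arcs d)"
proof
  assume *: "4 * d dvd card (primitive_arcs d)"
  have sub: "swap_arcs d \<subseteq> primitive_arcs d" by (auto simp: swap_arcs_def)
  have "card (primitive_arcs d) = card (primitive_arcs d - swap_arcs d) + card (swap_arcs d)"
    using card_Diff_subset[OF finite_subset[OF sub] sub] card_mono[OF _ sub] finite_primitive_arcs[OF assms(1)]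
    by simp
  then have "4 * d dvd card (swap_arcs d)"
    using * card_primitive_arcs_cong[OF assms(1)] by (metis dvd_add_right_iff)
  then show False
    using not_4d_dvd_card_primitive_alternating[OF assms(2,1)] card_swap_arcs[OF assms(1)] by simp
qed

subsection \<open>The coefficient norm\<close>

text \<open>This norm is submultiplicative, does not grow under truncation, and is invariant under
  rotation by unit complex numbers; the perturbation argument uses all three properties.\<close>

definition l1 :: "complex poly \<Rightarrow> real" where
  "l1 p = (\<Sum>i\<le>degree p. cmod (coeff p i))"

lemma l1_eq_sum:
  assumes "degree p \<le> n"
  shows "l1 p = (\<Sum>i\<le>n. cmod (coeff p i))"
  unfolding l1_def using assms by (intro sum.mono_neutral_left) (auto simp: coeff_eq_0)

lemma l1_0 [simp]: "l1 0 = 0"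
  by (simp add: l1_def)

lemma l1_nonneg [simp]: "l1 p \<ge> 0"
  by (simp add: l1_def sum_nonneg)

lemma l1_pCons: "l1 (pCons a p) = cmod a + l1 p"
proof -
  have "l1 (pCons a p) = (\<Sum>i\<le>Suc (degree p). cmod (coeff (pCons a p) i))"
    by (rule l1_eq_sum) (rule degree_pCons_le)
  also have "\<dots> = cmod a + l1 p" by (subst sum.atMost_Suc_shift) (simp add: l1_def)
  finally show ?thesis .
qed

lemma norm_coeff_le_l1: "cmod (coeff p k) \<le> l1 p"
proof (cases "k \<le> degree p")
  case True
  then show ?thesis unfolding l1_def by (intro member_le_sum) auto
qed (simp add: coeff_eq_0)

lemma l1_eq_0_iff [simp]: "l1 p = 0 \<longleftrightarrow> p = 0"
proof
  assume "l1 p = 0"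
  then have "cmod (coeff p k) \<le> 0" for k using norm_coeff_le_l1[of p k] by simp
  then show "p = 0" by (simp add: poly_eq_iff)
qed simp

lemma l1_add: "l1 (p + q) \<le> l1 p + l1 q"
proof -
  let ?n = "max (degree p) (degree q)"
  have "l1 (p + q) = (\<Sum>i\<le>?n. cmod (coeff (p + q) i))" by (intro l1_eq_sum degree_add_le_max)
  also have "\<dots> \<le> (\<Sum>i\<le>?n. cmod (coeff p i) + cmod (coeff q i))" by (intro sum_mono) (simp add: norm_triangle_ineq)
  also have "\<dots> = l1 p + l1 q" by (simp add: sum.distrib l1_eq_sum[of p ?n] l1_eq_sum[of q ?n])
  finally show ?thesis .
qed

lemma l1_minus [simp]: "l1 (- p) = l1 p"
  by (simp add: l1_def)

lemma l1_minus_commute: "l1 (p - q) = l1 (q - p)"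
  using l1_minus[of "q - p"] by simp

lemma l1_smult: "l1 (smult a p) = cmod a * l1 p"
  by (subst l1_eq_sum[OF degree_smult_le]) (simp add: norm_mult sum_distrib_left l1_def)

lemma l1_mult: "l1 (p * q) \<le> l1 p * l1 q"
proof (induction p)
  case 0
  show ?case by simp
next
  case (pCons a p)
  have "l1 (pCons a p * q) \<le> l1 (smult a q) + l1 (pCons 0 (p * q))"
    unfolding mult_pCons_left by (rule l1_add)
  also have "\<dots> = cmod a * l1 q + l1 (p * q)" by (simp add: l1_smult l1_pCons)
  also have "\<dots> \<le> l1 (pCons a p) * l1 q" using pCons.IH by (simp add: l1_pCons algebra_simps)
  finally show ?case .
qed

lemma l1_mult_le: "l1 p \<le> a \<Longrightarrow> l1 q \<le> b \<Longrightarrow> l1 (p * q) \<le> a * b"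
  by (rule order_trans[OF l1_mult]) (intro mult_mono; simp add: order_trans[OF l1_nonneg])

lemma l1_power_le: "l1 p \<le> a \<Longrightarrow> l1 (p ^ n) \<le> a ^ n"
proof (induction n)
  case 0
  have "l1 1 = 1" by (simp add: l1_def)
  then show ?case by simp
next
  case (Suc n)
  then show ?case by (simp add: l1_mult_le)
qed

lemma l1_sum: "l1 (\<Sum>x\<in>A. f x) \<le> (\<Sum>x\<in>A. l1 (f x))"
proof (induction A rule: infinite_finite_induct)
  case (insert x A)
  then show ?case using l1_add[of "f x" "\<Sum>x\<in>A. f x"] by simp
qed simp_all

lemma l1_cutoff: "l1 (poly_cutoff n p) \<le> l1 p"
proof -
  have "degree (poly_cutoff n p) \<le> degree p" by (rule degree_le) (simp add: coeff_poly_cutoff coeff_eq_0)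
  then have "l1 (poly_cutoff n p) = (\<Sum>i\<le>degree p. cmod (coeff (poly_cutoff n p) i))" by (rule l1_eq_sum)
  also have "\<dots> \<le> l1 p" unfolding l1_def by (intro sum_mono) (simp add: coeff_poly_cutoff)
  finally show ?thesis .
qed

definition pair_norm :: "complex poly \<times> complex poly \<Rightarrow> real" where
  "pair_norm x = l1 (fst x) + l1 (snd x)"

lemma pair_norm_nonneg [simp]: "pair_norm x \<ge> 0"
  by (simp add: pair_norm_def)

lemma pair_norm_0 [simp]: "pair_norm 0 = 0"
  by (simp add: pair_norm_def)

lemma pair_norm_eq_0_iff [simp]: "pair_norm x = 0 \<longleftrightarrow> x = 0"
  by (simp add: pair_norm_def add_nonneg_eq_0_iff prod_eq_iff)

lemma pair_norm_add: "pair_norm (x + y) \<le> pair_norm x + pair_norm y"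
  using l1_add[of "fst x" "fst y"] l1_add[of "snd x" "snd y"] by (simp add: pair_norm_def)

lemma pair_norm_minus_commute: "pair_norm (x - y) = pair_norm (y - x)"
  by (simp add: pair_norm_def l1_minus_commute)

lemma pair_norm_triangle: "pair_norm (x - z) \<le> pair_norm (x - y) + pair_norm (y - z)"
  using pair_norm_add[of "x - y" "y - z"] by simp

lemma pair_norm_rot:
  assumes "cmod z = 1"
  shows "pair_norm (rot z x) = pair_norm x"
proof -
  have "l1 (pcompose p [:0, z:]) = l1 p" for p
    using assms by (subst l1_eq_sum[OF degree_pcompose_linear_le])
      (simp add: coeff_pcompose_linear norm_mult norm_power l1_def)
  then show ?thesis by (simp add: pair_norm_def rot_def)
qed

lemma rot_diff: "rot z (x - y) = rot z x - rot z y"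
  by (simp add: rot_def pcompose_diff prod_eq_iff)

lemma arcs_add: "x \<in> arcs d \<Longrightarrow> y \<in> arcs d \<Longrightarrow> x + y \<in> arcs d"
  and arcs_diff: "x \<in> arcs d \<Longrightarrow> y \<in> arcs d \<Longrightarrow> x - y \<in> arcs d"
  and arcs_0: "0 \<in> arcs d"
  by (auto simp: arcs_def case_prod_beta zero_prod_def intro: degree_add_le degree_diff_le)

section \<open>Coefficientwise convergence and compactness\<close>

definition coeffs_tendsto :: "(nat \<Rightarrow> complex poly) \<Rightarrow> complex poly \<Rightarrow> bool" where
  "coeffs_tendsto P p \<longleftrightarrow> (\<forall>k. (\<lambda>n. coeff (P n) k) \<longlonglongrightarrow> coeff p k)"

lemma coeffs_tendsto_const: "coeffs_tendsto (\<lambda>_. p) p"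
  by (simp add: coeffs_tendsto_def)

lemma coeffs_tendsto_mult:
  "coeffs_tendsto P p \<Longrightarrow> coeffs_tendsto Q q \<Longrightarrow> coeffs_tendsto (\<lambda>n. P n * Q n) (p * q)"
  unfolding coeffs_tendsto_def coeff_mult by (intro allI tendsto_sum tendsto_mult) blast+

lemma coeffs_tendsto_power:
  "coeffs_tendsto P p \<Longrightarrow> coeffs_tendsto (\<lambda>n. P n ^ i) (p ^ i)"
  by (induction i) (simp_all add: coeffs_tendsto_const coeffs_tendsto_mult)

lemma coeffs_tendsto_smult:
  "c \<longlonglongrightarrow> a \<Longrightarrow> coeffs_tendsto P p \<Longrightarrow> coeffs_tendsto (\<lambda>n. smult (c n) (P n)) (smult a p)"
  unfolding coeffs_tendsto_def coeff_smult by (intro allI tendsto_mult) blast+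

lemma coeffs_tendsto_sum:
  "(\<And>x. x \<in> A \<Longrightarrow> coeffs_tendsto (P x) (p x)) \<Longrightarrow> coeffs_tendsto (\<lambda>n. \<Sum>x\<in>A. P x n) (\<Sum>x\<in>A. p x)"
  unfolding coeffs_tendsto_def coeff_sum by (intro allI tendsto_sum) blast

lemma coeffs_tendsto_rot:
  "c \<longlonglongrightarrow> a \<Longrightarrow> coeffs_tendsto P p \<Longrightarrow> coeffs_tendsto (\<lambda>n. pcompose (P n) [:0, c n:]) (pcompose p [:0, a:])"
  unfolding coeffs_tendsto_def coeff_pcompose_linear by (intro allI tendsto_mult tendsto_power) blast+

lemma coeffs_tendsto_curve_subst:
  assumes "\<And>ij. ij \<in> mon_set d \<Longrightarrow> (\<lambda>n. c n ij) \<longlonglongrightarrow> a ij" "coeffs_tendsto P p" "coeffs_tendsto Q q"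
  shows "coeffs_tendsto (\<lambda>n. curve_subst d (c n) (P n) (Q n)) (curve_subst d a p q)"
  unfolding curve_subst_def case_prod_beta
  by (intro coeffs_tendsto_sum coeffs_tendsto_smult coeffs_tendsto_mult coeffs_tendsto_power assms(2,3))
    (simp add: assms(1))

lemma coeffs_tendsto_l1:
  assumes "coeffs_tendsto P p" "\<And>n. degree (P n) \<le> d" "degree p \<le> d"
  shows "(\<lambda>n. l1 (P n)) \<longlonglongrightarrow> l1 p"
  using assms unfolding coeffs_tendsto_def l1_eq_sum[OF assms(2)] l1_eq_sum[OF assms(3)]
  by (intro tendsto_sum tendsto_norm) blast

lemma coeffs_tendsto_l1_diff:
  assumes "coeffs_tendsto P p" "\<And>n. degree (P n) \<le> d" "degree p \<le> d"
  shows "(\<lambda>n. l1 (P n - p)) \<longlonglongrightarrow> 0"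
proof -
  have "(\<lambda>n. coeff (P n - p) k) \<longlonglongrightarrow> 0" for k
    using assms(1) tendsto_diff[of "\<lambda>n. coeff (P n) k" "coeff p k" sequentially "\<lambda>_. coeff p k" "coeff p k"]
    by (simp add: coeffs_tendsto_def)
  then have "coeffs_tendsto (\<lambda>n. P n - p) 0" by (simp add: coeffs_tendsto_def)
  from coeffs_tendsto_l1[OF this, of d] assms show ?thesis by (simp add: degree_diff_le)
qed

lemma convergent_subsequence_finite:
  fixes f :: "nat \<Rightarrow> nat \<Rightarrow> complex"
  assumes "\<And>n k. cmod (f n k) \<le> M"
  shows "\<exists>r a. strict_mono r \<and> (\<forall>k<m. (\<lambda>n. f (r n) k) \<longlonglongrightarrow> a k)"
proof (induction m)
  case 0
  show ?case by (intro exI[of _ id]) (simp add: strict_mono_def)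
next
  case (Suc m)
  then obtain r a where r: "strict_mono r" "\<And>k. k < m \<Longrightarrow> (\<lambda>n. f (r n) k) \<longlonglongrightarrow> a k" by blast
  have "bounded (range (\<lambda>n. f (r n) m))" unfolding bounded_iff using assms by blast
  then obtain l s where s: "strict_mono s" "((\<lambda>n. f (r n) m) \<circ> s) \<longlonglongrightarrow> l"
    using bounded_imp_convergent_subsequence by blast
  have "(\<lambda>n. f ((r \<circ> s) n) k) \<longlonglongrightarrow> (a(m := l)) k" if "k < Suc m" for k
  proof (cases "k = m")
    case True
    then show ?thesis using s(2) by (simp add: o_def)
  next
    case False
    then have "(\<lambda>n. f (r n) k) \<longlonglongrightarrow> a k" using that r(2) by simp
    from LIMSEQ_subseq_LIMSEQ[OF this s(1)] show ?thesis using False by (simp add: o_def)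
  qed
  then show ?case using strict_mono_o[OF r(1) s(1)] by blast
qed

lemma arcs_compact:
  fixes x :: "nat \<Rightarrow> complex poly \<times> complex poly"
  assumes x: "\<And>n. x n \<in> arcs d" and M: "\<And>n. pair_norm (x n) \<le> M"
  obtains r y where "strict_mono r" "y \<in> arcs d"
    "coeffs_tendsto (\<lambda>n. fst (x (r n))) (fst y)" "coeffs_tendsto (\<lambda>n. snd (x (r n))) (snd y)"
    "(\<lambda>n. pair_norm (x (r n) - y)) \<longlonglongrightarrow> 0" "(\<lambda>n. pair_norm (x (r n))) \<longlonglongrightarrow> pair_norm y"
proof -
  \<comment> \<open>The coefficients of both components are interleaved, so one extraction of
    \<open>2 * d + 2\<close> convergent coordinate sequences serves both.\<close>
  define f where "f n k = (if even k then coeff (fst (x n)) (k div 2) else coeff (snd (x n)) (k div 2))" for n k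
  have "cmod (f n k) \<le> M" for n k
  proof -
    have "l1 (fst (x n)) \<le> M" "l1 (snd (x n)) \<le> M"
      using M[of n] l1_nonneg[of "fst (x n)"] l1_nonneg[of "snd (x n)"] unfolding pair_norm_def by linarith+
    then show ?thesis unfolding f_def using norm_coeff_le_l1 order_trans by (metis (full_types))
  qed
  from convergent_subsequence_finite[of f M "2 * d + 2", OF this]
  obtain r a where r: "strict_mono r" "\<And>k. k < 2 * d + 2 \<Longrightarrow> (\<lambda>n. f (r n) k) \<longlonglongrightarrow> a k" by blast
  define p where "p = (\<Sum>i\<le>d. monom (a (2 * i)) i)"
  define q where "q = (\<Sum>i\<le>d. monom (a (2 * i + 1)) i)"
  have cp: "coeff p k = (if k \<le> d then a (2 * k) else 0)" for k by (simp add: p_def coeff_sum)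
  have cq: "coeff q k = (if k \<le> d then a (2 * k + 1) else 0)" for k by (simp add: q_def coeff_sum)
  have deg: "degree (fst (x n)) \<le> d" "degree (snd (x n)) \<le> d" for n
    using x[of n] by (auto simp: arcs_def case_prod_beta)
  have P: "coeffs_tendsto (\<lambda>n. fst (x (r n))) p" unfolding coeffs_tendsto_def
  proof
    fix k
    show "(\<lambda>n. coeff (fst (x (r n))) k) \<longlonglongrightarrow> coeff p k"
    proof (cases "k \<le> d")
      case True
      then show ?thesis using r(2)[of "2 * k"] by (simp add: cp f_def)
    next
      case False
      then have "coeff (fst (x (r n))) k = 0" for n using deg(1)[of "r n"] by (intro coeff_eq_0) simp
      then show ?thesis using False by (simp add: cp)
    qed
  qed
  have Q: "coeffs_tendsto (\<lambda>n. snd (x (r n))) q" unfolding coeffs_tendsto_def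
  proof
    fix k
    show "(\<lambda>n. coeff (snd (x (r n))) k) \<longlonglongrightarrow> coeff q k"
    proof (cases "k \<le> d")
      case True
      then show ?thesis using r(2)[of "2 * k + 1"] by (simp add: cq f_def)
    next
      case False
      then have "coeff (snd (x (r n))) k = 0" for n using deg(2)[of "r n"] by (intro coeff_eq_0) simp
      then show ?thesis using False by (simp add: cq)
    qed
  qed
  have degpq: "degree p \<le> d" "degree q \<le> d" by (auto intro!: degree_le simp: cp cq)
  have zero: "coeff (fst (x n)) 0 = 0" "coeff (snd (x n)) 0 = 0" for n
    using x[of n] by (simp_all only: arcs_def case_prod_beta mem_Collect_eq)
  have "(\<lambda>n. coeff (fst (x (r n))) 0) \<longlonglongrightarrow> coeff p 0" "(\<lambda>n. coeff (snd (x (r n))) 0) \<longlonglongrightarrow> coeff q 0"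
    using P Q unfolding coeffs_tendsto_def by blast+
  then have "coeff p 0 = 0" "coeff q 0 = 0" unfolding zero LIMSEQ_const_iff by simp_all
  then have y: "(p, q) \<in> arcs d" using degpq by (simp add: arcs_def)
  have "(\<lambda>n. l1 (fst (x (r n)) - p) + l1 (snd (x (r n)) - q)) \<longlonglongrightarrow> 0 + 0"
    by (intro tendsto_add coeffs_tendsto_l1_diff[of _ _ d] P Q deg degpq)
  then have 1: "(\<lambda>n. pair_norm (x (r n) - (p, q))) \<longlonglongrightarrow> 0" by (simp add: pair_norm_def)
  have "(\<lambda>n. l1 (fst (x (r n))) + l1 (snd (x (r n)))) \<longlonglongrightarrow> l1 p + l1 q"
    by (intro tendsto_add coeffs_tendsto_l1[of _ _ d] P Q deg degpq)
  then have 2: "(\<lambda>n. pair_norm (x (r n))) \<longlonglongrightarrow> pair_norm (p, q)" by (simp add: pair_norm_def)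
  show ?thesis by (rule that[of r "(p, q)"]) (simp_all add: r(1) y P Q 1 2)
qed

text \<open>The displacement of the iterates is halved at each step. Compactness supplies a limit
  point in the ball, and the contraction property makes its displacement zero.\<close>

lemma contraction_fixed_point:
  fixes T :: "complex poly \<times> complex poly \<Rightarrow> complex poly \<times> complex poly"
  assumes self: "\<And>z. z \<in> arcs d \<Longrightarrow> pair_norm z \<le> r \<Longrightarrow> T z \<in> arcs d \<and> pair_norm (T z) \<le> r"
    and contr: "\<And>z w. z \<in> arcs d \<Longrightarrow> pair_norm z \<le> r \<Longrightarrow> w \<in> arcs d \<Longrightarrow> pair_norm w \<le> r \<Longrightarrow>
      pair_norm (T z - T w) \<le> pair_norm (z - w) / 2"
    and r: "r \<ge> 0"
  shows "\<exists>!z. z \<in> arcs d \<and> pair_norm z \<le> r \<and> T z = z"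
proof (rule ex_ex1I)
  define x where "x n = (T ^^ n) 0" for n
  have x: "x n \<in> arcs d \<and> pair_norm (x n) \<le> r" for n
    by (induction n) (use self arcs_0 r in \<open>auto simp: x_def\<close>)
  have step: "pair_norm (T (x n) - x n) \<le> (2 * r) * (1 / 2) ^ n" for n
  proof (induction n)
    case 0
    have "pair_norm (T (x 0) - x 0) \<le> pair_norm (T (x 0)) + pair_norm (x 0)"
      using pair_norm_triangle[of "T (x 0)" "x 0" 0] pair_norm_minus_commute[of 0 "x 0"] by simp
    also have "\<dots> \<le> 2 * r" using x[of 0] self[of "x 0"] by simp
    finally show ?case by simp
  next
    case (Suc n)
    have "pair_norm (T (x (Suc n)) - x (Suc n)) = pair_norm (T (T (x n)) - T (x n))" by (simp add: x_def)
    also have "\<dots> \<le> pair_norm (T (x n) - x n) / 2" using x[of n] self[of "x n"] by (intro contr) auto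
    finally show ?case using Suc by simp
  qed
  obtain s y where s: "strict_mono s" "y \<in> arcs d" "(\<lambda>n. pair_norm (x (s n) - y)) \<longlonglongrightarrow> 0"
    "(\<lambda>n. pair_norm (x (s n))) \<longlonglongrightarrow> pair_norm y"
    using arcs_compact[of x d r] x by metis
  have yr: "pair_norm y \<le> r" by (rule LIMSEQ_le_const2[OF s(4)]) (use x in auto)
  have bound: "pair_norm (T y - y) \<le> 2 * pair_norm (x (s n) - y) + (2 * r) * (1 / 2) ^ s n" for n
  proof -
    have "pair_norm (T y - y) \<le> pair_norm (T y - T (x (s n))) + pair_norm (T (x (s n)) - y)"
      by (rule pair_norm_triangle)
    also have "pair_norm (T y - T (x (s n))) \<le> pair_norm (y - x (s n)) / 2" using x s yr by (intro contr) auto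
    also have "pair_norm (T (x (s n)) - y) \<le> pair_norm (T (x (s n)) - x (s n)) + pair_norm (x (s n) - y)"
      by (rule pair_norm_triangle)
    finally show ?thesis
      using step[of "s n"] pair_norm_minus_commute[of y "x (s n)"] pair_norm_nonneg[of "x (s n) - y"] by linarith
  qed
  have "(\<lambda>n. (1 / 2 :: real) ^ s n) \<longlonglongrightarrow> 0"
    using LIMSEQ_subseq_LIMSEQ[OF LIMSEQ_power_zero[of "1/2 :: real"] s(1)] by (simp add: o_def)
  then have "(\<lambda>n. 2 * pair_norm (x (s n) - y) + (2 * r) * (1 / 2) ^ s n) \<longlonglongrightarrow> 2 * 0 + (2 * r) * 0"
    by (intro tendsto_intros s(3))
  then have "pair_norm (T y - y) \<le> 2 * 0 + (2 * r) * 0"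
    by (rule LIMSEQ_le_const) (use bound in auto)
  then have "pair_norm (T y - y) = 0" using pair_norm_nonneg[of "T y - y"] by linarith
  then have "T y = y" by simp
  with s(2) yr show "\<exists>z. z \<in> arcs d \<and> pair_norm z \<le> r \<and> T z = z" by blast
next
  fix z w assume z: "z \<in> arcs d \<and> pair_norm z \<le> r \<and> T z = z" and w: "w \<in> arcs d \<and> pair_norm w \<le> r \<and> T w = w"
  then have "pair_norm (z - w) \<le> pair_norm (z - w) / 2" using contr[of z w] by simp
  then have "pair_norm (z - w) = 0" using pair_norm_nonneg[of "z - w"] by linarith
  then show "z = w" by simp
qed

subsection \<open>Perturbation of the conic\<close>

lemma l1_power_diff_le:
  assumes "\<rho> \<ge> 0"
  shows "\<exists>M\<ge>0. \<forall>p q. l1 p \<le> \<rho> \<longrightarrow> l1 q \<le> \<rho> \<longrightarrow> l1 (p ^ i - q ^ i) \<le> M * l1 (p - q)"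
proof (induction i)
  case 0
  show ?case by (intro exI[of _ 0]) simp
next
  case (Suc i)
  then obtain M where M: "M \<ge> 0" "\<And>p q. l1 p \<le> \<rho> \<Longrightarrow> l1 q \<le> \<rho> \<Longrightarrow> l1 (p ^ i - q ^ i) \<le> M * l1 (p - q)"
    by blast
  have "l1 (p ^ Suc i - q ^ Suc i) \<le> (\<rho> ^ i + M * \<rho>) * l1 (p - q)" if "l1 p \<le> \<rho>" "l1 q \<le> \<rho>" for p q
  proof -
    have "p ^ Suc i - q ^ Suc i = p ^ i * (p - q) + (p ^ i - q ^ i) * q" by (simp add: algebra_simps)
    then have "l1 (p ^ Suc i - q ^ Suc i) \<le> l1 (p ^ i * (p - q)) + l1 ((p ^ i - q ^ i) * q)"
      using l1_add by metis
    also have "\<dots> \<le> \<rho> ^ i * l1 (p - q) + (M * l1 (p - q)) * \<rho>"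
      using that M by (intro add_mono l1_mult_le l1_power_le) auto
    finally show ?thesis by (simp add: algebra_simps)
  qed
  then show ?case using M(1) assms by (intro exI[of _ "\<rho> ^ i + M * \<rho>"]) simp
qed

lemma l1_monomial_diff_le:
  assumes "\<rho> \<ge> 0"
  shows "\<exists>M\<ge>0. \<forall>p q p' q'. l1 p \<le> \<rho> \<longrightarrow> l1 q \<le> \<rho> \<longrightarrow> l1 p' \<le> \<rho> \<longrightarrow> l1 q' \<le> \<rho> \<longrightarrow>
    l1 (p ^ i * q ^ j - p' ^ i * q' ^ j) \<le> M * (l1 (p - p') + l1 (q - q'))"
proof -
  obtain M where M: "M \<ge> 0" "\<And>p q. l1 p \<le> \<rho> \<Longrightarrow> l1 q \<le> \<rho> \<Longrightarrow> l1 (p ^ i - q ^ i) \<le> M * l1 (p - q)"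
    using l1_power_diff_le[OF assms, of i] by blast
  obtain N where N: "N \<ge> 0" "\<And>p q. l1 p \<le> \<rho> \<Longrightarrow> l1 q \<le> \<rho> \<Longrightarrow> l1 (p ^ j - q ^ j) \<le> N * l1 (p - q)"
    using l1_power_diff_le[OF assms, of j] by blast
  have "l1 (p ^ i * q ^ j - p' ^ i * q' ^ j) \<le> (\<rho> ^ i * N + M * \<rho> ^ j) * (l1 (p - p') + l1 (q - q'))"
    if "l1 p \<le> \<rho>" "l1 q \<le> \<rho>" "l1 p' \<le> \<rho>" "l1 q' \<le> \<rho>" for p q p' q'
  proof -
    have "p ^ i * q ^ j - p' ^ i * q' ^ j = p ^ i * (q ^ j - q' ^ j) + (p ^ i - p' ^ i) * q' ^ j"
      by (simp add: algebra_simps)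
    then have "l1 (p ^ i * q ^ j - p' ^ i * q' ^ j) \<le> l1 (p ^ i * (q ^ j - q' ^ j)) + l1 ((p ^ i - p' ^ i) * q' ^ j)"
      using l1_add by metis
    also have "\<dots> \<le> \<rho> ^ i * (N * l1 (q - q')) + (M * l1 (p - p')) * \<rho> ^ j"
      using that M N by (intro add_mono l1_mult_le l1_power_le) auto
    also have "\<dots> = (\<rho> ^ i * N) * l1 (q - q') + (M * \<rho> ^ j) * l1 (p - p')" by (simp add: algebra_simps)
    also have "\<dots> \<le> (\<rho> ^ i * N) * (l1 (p - p') + l1 (q - q')) + (M * \<rho> ^ j) * (l1 (p - p') + l1 (q - q'))"
      using M(1) N(1) assms by (intro add_mono mult_left_mono) auto
    finally show ?thesis by (simp add: algebra_simps)
  qed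
  then show ?thesis using M(1) N(1) assms by (intro exI[of _ "\<rho> ^ i * N + M * \<rho> ^ j"]) simp
qed

text \<open>The Lipschitz constant is linear in the size \<open>\<delta>\<close> of the
  coefficients, with \<open>M\<close> depending on \<open>\<rho>\<close> and \<open>d\<close> alone.
  A small perturbation of the curve therefore has a small effect on a whole ball of arcs.\<close>

lemma l1_curve_subst_diff_le:
  assumes "\<rho> \<ge> 0" and d: "d > 0"
  shows "\<exists>M>0. \<forall>\<delta> e p q p' q'. (\<forall>ij\<in>mon_set d. cmod (e ij) \<le> \<delta>) \<longrightarrow>
    l1 p \<le> \<rho> \<longrightarrow> l1 q \<le> \<rho> \<longrightarrow> l1 p' \<le> \<rho> \<longrightarrow> l1 q' \<le> \<rho> \<longrightarrow>
    l1 (curve_subst d e p q - curve_subst d e p' q') \<le> \<delta> * M * (l1 (p - p') + l1 (q - q'))"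
proof -
  have "\<forall>ij. \<exists>M\<ge>0. \<forall>p q p' q'. l1 p \<le> \<rho> \<longrightarrow> l1 q \<le> \<rho> \<longrightarrow> l1 p' \<le> \<rho> \<longrightarrow> l1 q' \<le> \<rho> \<longrightarrow>
    l1 (p ^ fst ij * q ^ snd ij - p' ^ fst ij * q' ^ snd ij) \<le> M * (l1 (p - p') + l1 (q - q'))"
    using l1_monomial_diff_le[OF assms(1)] by blast
  from choice[OF this] obtain M where M0: "\<And>ij. M ij \<ge> 0"
    and M: "\<And>ij p q p' q'. l1 p \<le> \<rho> \<Longrightarrow> l1 q \<le> \<rho> \<Longrightarrow> l1 p' \<le> \<rho> \<Longrightarrow> l1 q' \<le> \<rho> \<Longrightarrow>
    l1 (p ^ fst ij * q ^ snd ij - p' ^ fst ij * q' ^ snd ij) \<le> M ij * (l1 (p - p') + l1 (q - q'))" by blast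
  \<comment> \<open>The summand 1 makes the constant strictly positive, so that it may later stand
    in a denominator.\<close>
  have "l1 (curve_subst d e p q - curve_subst d e p' q')
      \<le> \<delta> * (1 + (\<Sum>ij\<in>mon_set d. M ij)) * (l1 (p - p') + l1 (q - q'))"
    if e: "\<forall>ij\<in>mon_set d. cmod (e ij) \<le> \<delta>" and \<rho>: "l1 p \<le> \<rho>" "l1 q \<le> \<rho>" "l1 p' \<le> \<rho>" "l1 q' \<le> \<rho>"
    for \<delta> e p q p' q'
  proof -
    have "(1, 0) \<in> mon_set d" using d by (simp add: mon_set_def)
    with e have \<delta>0: "\<delta> \<ge> 0" using norm_ge_zero order_trans by blast
    let ?s = "l1 (p - p') + l1 (q - q')"
    have "curve_subst d e p q - curve_subst d e p' q' =
        (\<Sum>ij\<in>mon_set d. smult (e ij) (p ^ fst ij * q ^ snd ij - p' ^ fst ij * q' ^ snd ij))"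
      by (simp add: curve_subst_def case_prod_beta sum_subtractf smult_diff_right)
    also have "l1 \<dots> \<le> (\<Sum>ij\<in>mon_set d. l1 (smult (e ij) (p ^ fst ij * q ^ snd ij - p' ^ fst ij * q' ^ snd ij)))"
      by (rule l1_sum)
    also have "\<dots> \<le> (\<Sum>ij\<in>mon_set d. \<delta> * (M ij * ?s))"
    proof (rule sum_mono)
      fix ij assume "ij \<in> mon_set d"
      with e have "cmod (e ij) \<le> \<delta>" by blast
      then show "l1 (smult (e ij) (p ^ fst ij * q ^ snd ij - p' ^ fst ij * q' ^ snd ij)) \<le> \<delta> * (M ij * ?s)"
        unfolding l1_smult using M[OF \<rho>] \<delta>0 by (intro mult_mono) auto
    qed
    also have "\<dots> = \<delta> * (\<Sum>ij\<in>mon_set d. M ij) * ?s"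
      by (simp add: sum_distrib_left sum_distrib_right mult_ac)
    also have "\<dots> \<le> \<delta> * (1 + (\<Sum>ij\<in>mon_set d. M ij)) * ?s"
      using \<delta>0 by (intro mult_right_mono mult_left_mono) auto
    finally show ?thesis .
  qed
  moreover have "1 + (\<Sum>ij\<in>mon_set d. M ij) > 0" using M0 by (smt (verit) sum_nonneg)
  ultimately show ?thesis by blast
qed

text \<open>
  Differentiating \<open>AB = 1 - t\<^sup>2\<^sup>d\<close> gives \<open>t A' B + A t B' = -2d (1 - AB)\<close>, a Bezout identity for \<open>A\<close> and \<open>B\<close>.
\<close>

lemma conic_bezout:
  assumes d: "d > 0" and AB: "A * B = 1 - monom 1 (2*d)"
  obtains \<alpha> \<beta> :: "complex poly" where "A * \<alpha> + B * \<beta> = 1" "degree \<alpha> \<le> degree B" "degree \<beta> \<le> degree A"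
proof -
  let ?c = "1 / of_nat (2*d) :: complex"
  let ?t = "monom 1 1 :: complex poly"
  have deg: "degree (?t * pderiv p) \<le> degree p" for p :: "complex poly"
    by (rule degree_le) (auto simp: coeff_monom_mult coeff_pderiv coeff_eq_0)
  have "pderiv (A * B) = - monom (of_nat (2*d)) (2*d - 1)"
    unfolding AB by (simp add: pderiv_diff pderiv_monom)
  then have "?t * (A * pderiv B + B * pderiv A) = - (?t * monom (of_nat (2*d)) (2*d - 1))"
    by (simp add: pderiv_mult)
  also have "?t * monom (of_nat (2*d)) (2*d - 1) = smult (of_nat (2*d)) (monom 1 (2*d))"
    using d by (simp add: mult_monom smult_monom)
  also have "monom 1 (2*d) = 1 - A * B" by (simp add: AB)
  finally have *: "?t * (A * pderiv B + B * pderiv A) = - smult (of_nat (2*d)) (1 - A * B)" .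
  have "A * (B - smult ?c (?t * pderiv B)) + B * (- smult ?c (?t * pderiv A)) =
      A * B - smult ?c (?t * (A * pderiv B + B * pderiv A))"
    by (simp add: algebra_simps smult_add_right)
  also have "\<dots> = A * B + smult (?c * of_nat (2*d)) (1 - A * B)" unfolding * by simp
  also have "?c * of_nat (2*d) = 1" using d by simp
  finally have "A * (B - smult ?c (?t * pderiv B)) + B * (- smult ?c (?t * pderiv A)) = 1" by simp
  moreover have "degree (B - smult ?c (?t * pderiv B)) \<le> degree B"
    by (intro degree_diff_le order_refl order_trans[OF degree_smult_le deg])
  moreover have "degree (- smult ?c (?t * pderiv A)) \<le> degree A"
    unfolding degree_minus by (rule order_trans[OF degree_smult_le deg])
  ultimately show ?thesis by (rule that)
qed

text \<open>The map \<open>(u, w) \<mapsto> A w + B u\<close> is the derivative of multiplication at \<open>(A, B)\<close>.\<close>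

lemma conic_derivative_inj:
  assumes d: "d > 0" and AB: "A * B = 1 - monom 1 (2*d)" and deg: "degree A = d" and A0: "coeff A 0 = 1"
    and uw: "(u, w) \<in> arcs d" "A * w + B * u = 0"
  shows "u = 0" "w = 0"
proof -
  obtain \<alpha> \<beta> where ab: "A * \<alpha> + B * \<beta> = 1" using conic_bezout[OF d AB] by metis
  \<comment> \<open>Bezout turns \<open>A * w + B * u = 0\<close> into divisibility of
    \<open>u\<close> by \<open>A\<close>. The degrees leave only a constant quotient, and the value
    at 0 makes it zero.\<close>
  have "u = u * (A * \<alpha> + B * \<beta>)" using ab by simp
  also have "\<dots> = A * (\<alpha> * u) + \<beta> * (B * u)" by (simp add: algebra_simps)
  also have "B * u = - (A * w)" using uw(2) by (simp add: add_eq_0_iff)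
  finally have u: "u = A * (\<alpha> * u - \<beta> * w)" by (simp add: algebra_simps)
  define v where "v = \<alpha> * u - \<beta> * w"
  have u: "u = A * v" using u by (simp only: v_def)
  have A: "A \<noteq> 0" using A0 by auto
  show "u = 0"
  proof (rule ccontr)
    assume "u \<noteq> 0"
    then have v: "v \<noteq> 0" using u by auto
    have "degree u = d + degree v" unfolding u deg[symmetric] using A v by (rule degree_mult_eq)
    moreover have "degree u \<le> d" using uw(1) by (simp add: arcs_def)
    ultimately have "degree v = 0" by simp
    then obtain a where a: "v = [:a:]" by (rule degree_eq_zeroE)
    have "coeff u 0 = a" unfolding u a using A0 by simp
    moreover have "coeff u 0 = 0" using uw(1) by (simp add: arcs_def)
    ultimately show False using v a by simp
  qed
  then have "A * w = 0" using uw(2) by simp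
  then show "w = 0" using A by simp
qed

text \<open>Bezout multiplied by t^k gives some solution; reducing its \<open>u\<close> modulo
  \<open>A\<close> bounds that degree, and the equation then bounds the degree of \<open>w\<close>.
  A multiple of the kernel element (-A, B) finally removes both constant terms.\<close>

lemma conic_derivative_surj:
  assumes d: "d > 0" and AB: "A * B = 1 - monom 1 (2*d)" and degA: "degree A = d" and degB: "degree B \<le> d"
    and A0: "coeff A 0 = 1" and B0: "coeff B 0 = 1" and k: "k > 0" "k \<le> 2 * d"
  shows "\<exists>u w. (u, w) \<in> arcs d \<and> A * w + B * u = monom 1 k"
proof -
  obtain \<alpha> \<beta> where ab: "A * \<alpha> + B * \<beta> = 1" using conic_bezout[OF d AB] by metis
  have A: "A \<noteq> 0" using A0 by auto
  have B: "B \<noteq> 0" using B0 by auto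
  define m where "m = monom (1 :: complex) k"
  define u0 where "u0 = (\<beta> * m) mod A"
  define w0 where "w0 = \<alpha> * m + B * ((\<beta> * m) div A)"
  have "A * w0 + B * u0 = (A * \<alpha>) * m + B * (A * ((\<beta> * m) div A) + u0)"
    by (simp add: w0_def algebra_simps)
  also have "A * ((\<beta> * m) div A) + u0 = \<beta> * m" unfolding u0_def by (rule mult_div_mod_eq)
  also have "(A * \<alpha>) * m + B * (\<beta> * m) = (A * \<alpha> + B * \<beta>) * m" by (simp add: algebra_simps)
  finally have eq0: "A * w0 + B * u0 = m" by (simp add: ab)
  have degu0: "degree u0 < d"
  proof -
    have "u0 = 0 \<or> degree u0 < degree A" unfolding u0_def using A by (rule degree_mod_less)
    then show ?thesis using degA d by auto
  qed
  have degw0: "degree w0 \<le> d"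
  proof (cases "w0 = 0")
    case False
    have "degree (A * w0) = d + degree w0" using A False degA by (simp add: degree_mult_eq)
    moreover have "A * w0 = m - B * u0" using eq0 by (simp add: algebra_simps)
    moreover have "degree (m - B * u0) \<le> 2 * d"
    proof (rule degree_diff_le)
      show "degree m \<le> 2 * d" unfolding m_def using k(2) degree_monom_le order_trans by blast
      show "degree (B * u0) \<le> 2 * d" using degree_mult_le[of B u0] degB degu0 by linarith
    qed
    ultimately show ?thesis by simp
  qed simp
  define a where "a = coeff u0 0"
  have "coeff (A * w0 + B * u0) 0 = 0" unfolding eq0 m_def using k(1) by simp
  \<comment> \<open>As \<open>A\<close> and \<open>B\<close> are 1 at 0, the constant terms of
    \<open>w0\<close> and \<open>u0\<close> are opposite, and a single kernel multiple kills
    both.\<close>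
  then have w00: "coeff w0 0 = - a" using A0 B0 by (simp add: coeff_mult_0 a_def add_eq_0_iff)
  define u where "u = u0 - smult a A"
  define w where "w = w0 + smult a B"
  have "A * w + B * u = A * w0 + B * u0" by (simp add: u_def w_def algebra_simps)
  moreover have "(u, w) \<in> arcs d"
  proof -
    have "degree u \<le> d" unfolding u_def using degu0 degA degree_smult_le[of a A]
      by (intro degree_diff_le) linarith+
    moreover have "degree w \<le> d" unfolding w_def using degw0 degB degree_smult_le[of a B]
      by (intro degree_add_le) linarith+
    moreover have "coeff u 0 = 0" "coeff w 0 = 0" using A0 B0 w00 by (simp_all add: u_def w_def a_def)
    ultimately show ?thesis by (simp add: arcs_def)
  qed
  ultimately show ?thesis using eq0 m_def by auto
qed

text \<open>\<open>L\<close> is assembled from solutions for the monomials of exponent 1 to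
  \<open>2*d\<close> and ignores the other coefficients. It is thus linear with values in
  \<open>arcs d\<close> for every \<open>R\<close>, and a right inverse on the polynomials supported
  on those exponents.\<close>

lemma conic_derivative_inverse:
  assumes d: "d > 0" and AB: "A * B = 1 - monom 1 (2*d)" and degA: "degree A = d" and degB: "degree B \<le> d"
    and A0: "coeff A 0 = 1" and B0: "coeff B 0 = 1"
  obtains L :: "complex poly \<Rightarrow> complex poly \<times> complex poly" and C where "C > 0" "\<And>R. L R \<in> arcs d"
    "\<And>R S. L (R - S) = L R - L S" "\<And>R. pair_norm (L R) \<le> C * l1 R"
    "\<And>R. coeff R 0 = 0 \<Longrightarrow> degree R \<le> 2 * d \<Longrightarrow> A * snd (L R) + B * fst (L R) = R"
proof -
  have "\<forall>k. \<exists>x. k > 0 \<and> k \<le> 2 * d \<longrightarrow> x \<in> arcs d \<and> A * snd x + B * fst x = monom 1 k"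
    using conic_derivative_surj[OF assms] by (metis fst_conv snd_conv)
  from choice[OF this] obtain f where f: "\<And>k. k > 0 \<Longrightarrow> k \<le> 2 * d \<Longrightarrow> f k \<in> arcs d"
    "\<And>k. k > 0 \<Longrightarrow> k \<le> 2 * d \<Longrightarrow> A * snd (f k) + B * fst (f k) = monom 1 k" by blast
  define L where "L R = (\<Sum>k\<in>{1..2*d}. smult (coeff R k) (fst (f k)), \<Sum>k\<in>{1..2*d}. smult (coeff R k) (snd (f k)))" for R
  define C where "C = 1 + (\<Sum>k\<in>{1..2*d}. pair_norm (f k))"
  show ?thesis
  proof (rule that[of C L])
    show "C > 0" unfolding C_def by (smt (verit) sum_nonneg pair_norm_nonneg)
    show "L R \<in> arcs d" for R
    proof -
      have fk: "degree (fst (f k)) \<le> d" "degree (snd (f k)) \<le> d" "coeff (fst (f k)) 0 = 0" "coeff (snd (f k)) 0 = 0"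
        if "k \<in> {1..2*d}" for k using f(1)[of k] that by (auto simp: arcs_def case_prod_beta)
      have "degree (fst (L R)) \<le> d" "degree (snd (L R)) \<le> d" unfolding L_def fst_conv snd_conv
        by (intro degree_sum_le finite_atLeastAtMost order_trans[OF degree_smult_le] fk; assumption)+
      moreover have "coeff (fst (L R)) 0 = 0" "coeff (snd (L R)) 0 = 0"
        unfolding L_def fst_conv snd_conv coeff_sum by (simp_all add: fk)
      ultimately show ?thesis by (simp add: arcs_def case_prod_beta)
    qed
    show "L (R - S) = L R - L S" for R S
      by (simp add: L_def smult_diff_left sum_subtractf)
    show "pair_norm (L R) \<le> C * l1 R" for R
    proof -
      have "pair_norm (L R) \<le> (\<Sum>k\<in>{1..2*d}. l1 (smult (coeff R k) (fst (f k)))) + (\<Sum>k\<in>{1..2*d}. l1 (smult (coeff R k) (snd (f k))))"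
        unfolding pair_norm_def L_def fst_conv snd_conv by (intro add_mono l1_sum)
      also have "\<dots> = (\<Sum>k\<in>{1..2*d}. cmod (coeff R k) * pair_norm (f k))"
        by (simp add: l1_smult pair_norm_def sum.distrib distrib_left)
      also have "\<dots> \<le> (\<Sum>k\<in>{1..2*d}. l1 R * pair_norm (f k))"
        by (intro sum_mono mult_right_mono norm_coeff_le_l1) simp
      also have "\<dots> \<le> C * l1 R" by (simp add: C_def sum_distrib_left[symmetric] algebra_simps)
      finally show ?thesis .
    qed
    show "A * snd (L R) + B * fst (L R) = R" if R: "coeff R 0 = 0" "degree R \<le> 2 * d" for R
    proof -
      have "A * snd (L R) + B * fst (L R) = (\<Sum>k\<in>{1..2*d}. smult (coeff R k) (A * snd (f k) + B * fst (f k)))"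
        by (simp add: L_def sum_distrib_left sum.distrib[symmetric] smult_add_right)
      also have "\<dots> = (\<Sum>k\<in>{1..2*d}. monom (coeff R k) k)"
        using f(2) by (intro sum.cong refl) (simp add: smult_monom)
      also have "\<dots> = (\<Sum>k\<le>2*d. monom (coeff R k) k)"
      proof (rule sum.mono_neutral_left)
        show "\<forall>k\<in>{..2*d} - {1..2*d}. monom (coeff R k) k = 0"
        proof
          fix k assume "k \<in> {..2*d} - {1..2*d}"
          then have "k = 0" by auto
          then show "monom (coeff R k) k = 0" using R(1) by simp
        qed
      qed auto
      also have "\<dots> = R" using R(2) by (rule poly_as_sum_of_monoms')
      finally show ?thesis .
    qed
  qed
qed

section \<open>Solutions near a solution of the conic problem\<close>

lemma curve_subst_add:
  "curve_subst d (\<lambda>ij. a ij + b ij) p q = curve_subst d a p q + curve_subst d b p q"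
  by (simp add: curve_subst_def case_prod_beta smult_add_left sum.distrib)

lemma curve_subst_conic_perturb:
  assumes "d > 0"
  shows "curve_subst d c p q = p + q + p * q + curve_subst d (\<lambda>ij. c ij - model_conic ij) p q"
  using curve_subst_add[of d model_conic "\<lambda>ij. c ij - model_conic ij" p q] curve_subst_conic[OF assms, of p q] by simp

lemma coeff_curve_subst_0:
  assumes "(p, q) \<in> arcs d"
  shows "coeff (curve_subst d e p q) 0 = 0"
proof -
  have "poly p 0 = 0" "poly q 0 = 0" using assms by (simp_all add: arcs_def poly_0_coeff_0)
  then have "poly (curve_subst d e p q) 0 = 0"
    unfolding curve_subst_def poly_sum by (intro sum.neutral) (auto simp: mon_set_def power_0_left)
  then show ?thesis by (simp add: poly_0_coeff_0)
qed

text \<open>A quantitative implicit function theorem. With z = (u, w), contact of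
  \<open>x0 + z\<close> says that \<open>A * w + B * u\<close> equals minus the quadratic term
  \<open>u * w\<close> and minus the truncated perturbation; applying \<open>L\<close> makes this a
  fixed point equation for a contraction. All radii below \<open>r0\<close> are allowed because one
  common radius will be chosen for all \<open>x0\<close>.\<close>

lemma local_solution:
  assumes d: "d > 0" and x0: "x0 \<in> contact_arcs d model_conic"
  shows "\<exists>r0>0. \<forall>r. 0 < r \<and> r \<le> r0 \<longrightarrow> (\<exists>\<delta>>0. \<forall>c. (\<forall>ij\<in>mon_set d. cmod (c ij - model_conic ij) \<le> \<delta>) \<longrightarrow>
    (\<exists>!x. x \<in> contact_arcs d c \<and> pair_norm (x - x0) \<le> r))"
proof -
  obtain p0 q0 where x0_eq: "x0 = (p0, q0)" by fastforce
  define A where "A = 1 + p0"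
  define B where "B = 1 + q0"
  have arcs0: "(p0, q0) \<in> arcs d" and AB: "A * B = 1 - monom 1 (2*d)"
    using x0 contact_arcs_conic[OF d, of p0 q0] by (simp_all add: x0_eq A_def B_def)
  have A0: "coeff A 0 = 1" and B0: "coeff B 0 = 1" using arcs0 by (simp_all add: A_def B_def arcs_def)
  have degB: "degree B \<le> d" unfolding B_def using arcs0 by (intro degree_add_le) (simp_all add: arcs_def)
  have "degree A \<le> d" unfolding A_def using arcs0 by (intro degree_add_le) (simp_all add: arcs_def)
  moreover have "coeff p0 d \<noteq> 0" using x0 by (auto simp: contact_arcs_def x0_eq)
  then have "coeff A d \<noteq> 0" using d by (simp add: A_def)
  ultimately have degA: "degree A = d" by (simp add: le_degree le_antisym)
  from conic_derivative_inverse[OF d AB degA degB A0 B0]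
  obtain L :: "complex poly \<Rightarrow> complex poly \<times> complex poly" and C where C: "C > 0" and L_arcs: "\<And>R. L R \<in> arcs d"
    and L_diff: "\<And>R S. L (R - S) = L R - L S" and L_norm: "\<And>R. pair_norm (L R) \<le> C * l1 R"
    and L_inv: "\<And>R. coeff R 0 = 0 \<Longrightarrow> degree R \<le> 2 * d \<Longrightarrow> A * snd (L R) + B * fst (L R) = R" by metis
  \<comment> \<open>With this radius the quadratic term contributes at most 1/4 to the contraction
    factor.\<close>
  define r0 where "r0 = 1 / (4 * C)"
  define \<rho> where "\<rho> = pair_norm x0 + r0"
  have r0: "r0 > 0" using C by (simp add: r0_def)
  then have \<rho>0: "\<rho> > 0" using pair_norm_nonneg[of x0] unfolding \<rho>_def by linarith
  obtain M where M: "M > 0" and lip: "\<And>\<delta> e p q p' q'. (\<forall>ij\<in>mon_set d. cmod (e ij) \<le> \<delta>) \<Longrightarrow>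
    l1 p \<le> \<rho> \<Longrightarrow> l1 q \<le> \<rho> \<Longrightarrow> l1 p' \<le> \<rho> \<Longrightarrow> l1 q' \<le> \<rho> \<Longrightarrow>
    l1 (curve_subst d e p q - curve_subst d e p' q') \<le> \<delta> * M * (l1 (p - p') + l1 (q - q'))"
    using l1_curve_subst_diff_le[OF less_imp_le[OF \<rho>0] d] by metis
  show ?thesis
  proof (rule exI[of _ r0], intro conjI r0 allI impI)
    fix r assume "0 < r \<and> r \<le> r0"
    then have r: "0 < r" "r \<le> r0" by auto
    \<comment> \<open>The first bound limits the contribution of the perturbation to the contraction
      factor to 1/4; the second makes \<open>T 0\<close> at most \<open>r / 4\<close>, so that the
      ball of radius \<open>r\<close> is mapped into itself.\<close>
    define \<delta> where "\<delta> = min (1 / (4 * C * M)) (r / (4 * C * M * \<rho>))"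
    have \<delta>: "\<delta> > 0" "C * (\<delta> * M) \<le> 1 / 4" "C * (\<delta> * M * \<rho>) \<le> r / 4"
    proof -
      show "\<delta> > 0" using C M r \<rho>0 by (simp add: \<delta>_def)
      have "\<delta> * (C * M) \<le> 1 / (4 * C * M) * (C * M)" using C M by (intro mult_right_mono) (auto simp: \<delta>_def)
      also have "\<dots> = 1 / 4" using C M by simp
      finally show "C * (\<delta> * M) \<le> 1 / 4" by (simp add: mult_ac)
      have "\<delta> * (C * M * \<rho>) \<le> r / (4 * C * M * \<rho>) * (C * M * \<rho>)"
        using C M \<rho>0 by (intro mult_right_mono) (auto simp: \<delta>_def)
      also have "\<dots> = r / 4" using C M \<rho>0 by simp
      finally show "C * (\<delta> * M * \<rho>) \<le> r / 4" by (simp add: mult_ac)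
    qed
    show "\<exists>\<delta>>0. \<forall>c. (\<forall>ij\<in>mon_set d. cmod (c ij - model_conic ij) \<le> \<delta>) \<longrightarrow>
      (\<exists>!x. x \<in> contact_arcs d c \<and> pair_norm (x - x0) \<le> r)"
    proof (rule exI[of _ \<delta>], intro conjI \<delta>(1) allI impI)
      fix c assume c: "\<forall>ij\<in>mon_set d. cmod (c ij - model_conic ij) \<le> \<delta>"
      define E where "E p q = curve_subst d (\<lambda>ij. c ij - model_conic ij) p q" for p q
      \<comment> \<open>What remains of the product (A + u)(B + w) and of the perturbation once the
        linear part \<open>A * w + B * u\<close> is isolated.\<close>
      define R where "R z = - (fst z * snd z + poly_cutoff (2*d) (E (p0 + fst z) (q0 + snd z)))" for z
      define T where "T z = L (R z)" for z
      have R_ok: "coeff (R z) 0 = 0" "degree (R z) \<le> 2 * d" if z: "z \<in> arcs d" for z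
      proof -
        have z': "degree (fst z) \<le> d" "degree (snd z) \<le> d" "coeff (fst z) 0 = 0"
          using z by (auto simp: arcs_def case_prod_beta)
        have "(p0 + fst z, q0 + snd z) \<in> arcs d" using arcs_add[OF arcs0 z] by (simp add: plus_prod_def)
        then have "coeff (E (p0 + fst z) (q0 + snd z)) 0 = 0" unfolding E_def by (rule coeff_curve_subst_0)
        then show "coeff (R z) 0 = 0" using z'(3) by (simp add: R_def coeff_mult_0 coeff_poly_cutoff)
        have "degree (poly_cutoff (2*d) f) \<le> 2 * d" for f :: "complex poly"
          by (rule degree_le) (simp add: coeff_poly_cutoff)
        moreover have "degree (fst z * snd z) \<le> 2 * d"
          using degree_mult_le[of "fst z" "snd z"] z' by linarith
        ultimately show "degree (R z) \<le> 2 * d" unfolding R_def degree_minus by (intro degree_add_le)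
      qed
      have contact_iff: "x0 + z \<in> contact_arcs d c \<longleftrightarrow> A * snd z + B * fst z = R z" if z: "z \<in> arcs d" for z
      proof -
        obtain u w where uw: "z = (u, w)" by fastforce
        have arc: "(p0 + u, q0 + w) \<in> arcs d" using arcs_add[OF arcs0 z] by (simp add: uw)
        let ?s = "(p0 + u) + (q0 + w) + (p0 + u) * (q0 + w)"
        have "?s = A * B - 1 + (A * w + B * u) + u * w" by (simp add: A_def B_def algebra_simps)
        also have "A * B - 1 = - monom 1 (2*d)" by (simp add: AB)
        finally have s: "?s = - monom 1 (2*d) + (A * w + B * u) + u * w" .
        have "curve_subst d c (p0 + u) (q0 + w) - ?s = E (p0 + u) (q0 + w)"
          using curve_subst_conic_perturb[OF d, of c "p0 + u" "q0 + w"] by (simp add: E_def)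
        then have "(p0 + u, q0 + w) \<in> contact_arcs d c \<longleftrightarrow>
            ?s + poly_cutoff (2*d) (E (p0 + u) (q0 + w)) = - monom 1 (2*d)"
          using contact_arcs_alt[OF d, of "p0 + u" "q0 + w" c] arc by simp
        also have "\<dots> \<longleftrightarrow> A * w + B * u = - (u * w + poly_cutoff (2*d) (E (p0 + u) (q0 + w)))"
        proof -
          have *: "(- m + a) + b + e = - m \<longleftrightarrow> a = - (b + e)" for m a b e :: "complex poly"
            by (metis (no_types) add.assoc add.right_neutral add_left_cancel add_eq_0_iff2)
          show ?thesis unfolding s by (rule *)
        qed
        finally show ?thesis by (simp add: uw x0_eq R_def)
      qed
      have T_iff: "T z = z \<longleftrightarrow> x0 + z \<in> contact_arcs d c" if z: "z \<in> arcs d" for z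
      proof
        assume "T z = z"
        then show "x0 + z \<in> contact_arcs d c"
          using L_inv[OF R_ok[OF z]] contact_iff[OF z] by (simp add: T_def)
      next
        assume "x0 + z \<in> contact_arcs d c"
        then have eq: "A * snd z + B * fst z = A * snd (T z) + B * fst (T z)"
          using L_inv[OF R_ok[OF z]] contact_iff[OF z] by (simp add: T_def)
        have diff: "(fst (T z) - fst z, snd (T z) - snd z) \<in> arcs d"
          using arcs_diff[OF L_arcs[of "R z"] z] by (simp add: T_def minus_prod_def)
        have "A * (snd (T z) - snd z) + B * (fst (T z) - fst z) = 0" using eq by (simp add: algebra_simps)
        from conic_derivative_inj[OF d AB degA A0 diff this]
        show "T z = z" by (simp add: prod_eq_iff)
      qed
      have ball: "l1 (fst z) \<le> r" "l1 (snd z) \<le> r" "l1 (p0 + fst z) \<le> \<rho>" "l1 (q0 + snd z) \<le> \<rho>"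
        if "pair_norm z \<le> r" for z
      proof -
        show 1: "l1 (fst z) \<le> r" "l1 (snd z) \<le> r"
          using that l1_nonneg[of "fst z"] l1_nonneg[of "snd z"] unfolding pair_norm_def by linarith+
        have "pair_norm x0 = l1 p0 + l1 q0" by (simp add: pair_norm_def x0_eq)
        then show "l1 (p0 + fst z) \<le> \<rho>" "l1 (q0 + snd z) \<le> \<rho>"
          using 1 r(2) l1_add[of p0 "fst z"] l1_add[of q0 "snd z"] l1_nonneg[of p0] l1_nonneg[of q0]
          unfolding \<rho>_def by linarith+
      qed
      have contr: "pair_norm (T z - T w) \<le> pair_norm (z - w) / 2"
        if z: "pair_norm z \<le> r" and w: "pair_norm w \<le> r" for z w
      proof -
        let ?n = "pair_norm (z - w)"
        let ?e = "E (p0 + fst w) (q0 + snd w) - E (p0 + fst z) (q0 + snd z)"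
        have "R z - R w = (fst w * (snd w - snd z) + (fst w - fst z) * snd z) + poly_cutoff (2*d) ?e"
          by (simp add: R_def poly_eq_iff coeff_poly_cutoff algebra_simps)
        then have "l1 (R z - R w) \<le> l1 (fst w * (snd w - snd z) + (fst w - fst z) * snd z) + l1 (poly_cutoff (2*d) ?e)"
          using l1_add by metis
        also have "\<dots> \<le> (l1 (fst w * (snd w - snd z)) + l1 ((fst w - fst z) * snd z)) + l1 ?e"
          by (intro add_mono l1_add l1_cutoff)
        also have "l1 (fst w * (snd w - snd z)) \<le> r * l1 (snd w - snd z)"
          by (intro l1_mult_le ball w order_refl)
        also have "l1 ((fst w - fst z) * snd z) \<le> l1 (fst w - fst z) * r"
          by (intro l1_mult_le ball z order_refl)
        also have "l1 ?e \<le> \<delta> * M * (l1 ((p0 + fst w) - (p0 + fst z)) + l1 ((q0 + snd w) - (q0 + snd z)))"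
          unfolding E_def by (intro lip ball z w c)
        also have "r * l1 (snd w - snd z) + l1 (fst w - fst z) * r +
            \<delta> * M * (l1 ((p0 + fst w) - (p0 + fst z)) + l1 ((q0 + snd w) - (q0 + snd z))) = (r + \<delta> * M) * ?n"
          by (simp add: pair_norm_def l1_minus_commute[of "fst w"] l1_minus_commute[of "snd w"] algebra_simps)
        finally have "l1 (R z - R w) \<le> (r + \<delta> * M) * ?n" by simp
        then have "C * l1 (R z - R w) \<le> C * ((r + \<delta> * M) * ?n)" using C by (intro mult_left_mono) auto
        moreover have "pair_norm (T z - T w) \<le> C * l1 (R z - R w)"
          unfolding T_def L_diff[symmetric] by (rule L_norm)
        moreover have "C * ((r + \<delta> * M) * ?n) = (C * r + C * (\<delta> * M)) * ?n" by (simp add: algebra_simps)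
        moreover have "(C * r + C * (\<delta> * M)) * ?n \<le> (1 / 4 + 1 / 4) * ?n"
        proof (intro mult_right_mono add_mono \<delta>(2) pair_norm_nonneg)
          have "C * r \<le> C * r0" using C r(2) by (intro mult_left_mono) auto
          then show "C * r \<le> 1 / 4" using C by (simp add: r0_def)
        qed
        ultimately show ?thesis by simp
      qed
      have T0: "pair_norm (T 0) \<le> r / 4"
      proof -
        \<comment> \<open>Because the perturbation vanishes at the zero arc, the Lipschitz estimate
          also bounds its size at \<open>x0\<close>.\<close>
        have E00: "E 0 0 = 0" unfolding E_def curve_subst_def
          by (intro sum.neutral) (auto simp: mon_set_def power_0_left)
        have n0: "pair_norm 0 \<le> r" using r(1) by simp
        have "l1 (0 :: complex poly) \<le> \<rho>" using \<rho>0 by simp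
        then have "l1 (E p0 q0 - E 0 0) \<le> \<delta> * M * (l1 (p0 - 0) + l1 (q0 - 0))"
          using ball(3,4)[OF n0] unfolding E_def by (intro lip c) simp_all
        also have "\<dots> \<le> \<delta> * M * \<rho>"
        proof (rule mult_left_mono)
          show "l1 (p0 - 0) + l1 (q0 - 0) \<le> \<rho>" using r0 by (simp add: \<rho>_def pair_norm_def x0_eq)
          show "0 \<le> \<delta> * M" using \<delta>(1) M by simp
        qed
        finally have "l1 (E p0 q0) \<le> \<delta> * M * \<rho>" by (simp add: E00)
        moreover have "l1 (R 0) \<le> l1 (E p0 q0)" using l1_cutoff by (simp add: R_def)
        ultimately have "C * l1 (R 0) \<le> C * (\<delta> * M * \<rho>)" using C by (intro mult_left_mono) auto
        then show ?thesis using L_norm[of "R 0"] \<delta>(3) unfolding T_def by linarith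
      qed
      have self: "T z \<in> arcs d \<and> pair_norm (T z) \<le> r" if "pair_norm z \<le> r" for z
      proof
        show "T z \<in> arcs d" unfolding T_def by (rule L_arcs)
        have "pair_norm (T z - T 0) \<le> pair_norm (z - 0) / 2" using that r(1) by (intro contr) simp_all
        moreover have "pair_norm (T z) \<le> pair_norm (T z - T 0) + pair_norm (T 0)"
          using pair_norm_triangle[of "T z" 0 "T 0"] by simp
        ultimately show "pair_norm (T z) \<le> r" using T0 that r(1) unfolding diff_zero by linarith
      qed
      have "\<exists>!z. z \<in> arcs d \<and> pair_norm z \<le> r \<and> T z = z"
        by (rule contraction_fixed_point) (use self contr r(1) in auto)
      then obtain z where z: "z \<in> arcs d" "pair_norm z \<le> r" "T z = z"
        and uniq: "\<And>z'. z' \<in> arcs d \<Longrightarrow> pair_norm z' \<le> r \<Longrightarrow> T z' = z' \<Longrightarrow> z' = z" by metis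
      show "\<exists>!x. x \<in> contact_arcs d c \<and> pair_norm (x - x0) \<le> r"
      proof (rule ex1I[of _ "x0 + z"])
        show "x0 + z \<in> contact_arcs d c \<and> pair_norm (x0 + z - x0) \<le> r" using z T_iff by simp
        fix x assume x: "x \<in> contact_arcs d c \<and> pair_norm (x - x0) \<le> r"
        then have "x \<in> arcs d" by (auto simp: contact_arcs_def)
        moreover have "x0 \<in> arcs d" using arcs0 by (simp add: x0_eq)
        ultimately have "x - x0 \<in> arcs d" by (rule arcs_diff)
        moreover have "x0 + (x - x0) = x" by simp
        ultimately have "x - x0 = z" using x T_iff[of "x - x0"] by (intro uniq) simp_all
        then show "x = x0 + z" by (metis add.commute diff_add_cancel)
      qed
    qed
  qed
qed

section \<open>No solution escapes to infinity\<close>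

lemma contact_arcs_norm_ge_1:
  assumes "x \<in> contact_arcs d c"
  shows "pair_norm x \<ge> 1"
proof -
  have "coeff (fst x) d * coeff (snd x) d = -1" using assms by (auto simp: contact_arcs_def)
  then have "cmod (coeff (fst x) d) * cmod (coeff (snd x) d) = 1" by (metis norm_minus_cancel norm_mult norm_one)
  moreover have "cmod (coeff (fst x) d) * cmod (coeff (snd x) d) < 1 * 1"
    if "cmod (coeff (fst x) d) < 1" "cmod (coeff (snd x) d) < 1"
    using that by (intro mult_strict_mono) auto
  ultimately have "cmod (coeff (fst x) d) \<ge> 1 \<or> cmod (coeff (snd x) d) \<ge> 1" by force
  then show ?thesis
    using norm_coeff_le_l1[of "fst x" d] norm_coeff_le_l1[of "snd x" d] l1_nonneg[of "fst x"] l1_nonneg[of "snd x"]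
    unfolding pair_norm_def by linarith
qed

text \<open>The substitution of \<open>s\<close> times the parameter, unlike division by the norm,
  preserves the order of contact. Its norm varies continuously from 0 at \<open>s = 0\<close> to at
  least 1 at \<open>s = 1\<close>.\<close>

lemma rescale_to_norm_1:
  assumes "x \<in> arcs d" "pair_norm x \<ge> 1"
  obtains s :: real where "0 < s" "s \<le> 1" "pair_norm (rot (of_real s) x) = 1"
proof -
  have deg: "degree (fst x) \<le> d" "degree (snd x) \<le> d" and zero: "coeff (fst x) 0 = 0" "coeff (snd x) 0 = 0"
    using assms(1) by (auto simp: arcs_def case_prod_beta)
  have norm: "pair_norm (rot (of_real s) x) =
      (\<Sum>i\<le>d. s ^ i * cmod (coeff (fst x) i)) + (\<Sum>i\<le>d. s ^ i * cmod (coeff (snd x) i))" if "s \<ge> 0" for s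
    using that
    by (simp add: pair_norm_def rot_def coeff_pcompose_linear norm_mult norm_power
        l1_eq_sum[OF order_trans[OF degree_pcompose_linear_le deg(1)]]
        l1_eq_sum[OF order_trans[OF degree_pcompose_linear_le deg(2)]])
  define g where "g s = (\<Sum>i\<le>d. s ^ i * cmod (coeff (fst x) i)) + (\<Sum>i\<le>d. s ^ i * cmod (coeff (snd x) i))"
    for s :: real
  have "(\<Sum>i\<le>d. 0 ^ i * cmod (coeff p i)) = 0" if "coeff p 0 = 0" for p :: "complex poly"
    using that by (intro sum.neutral) (auto simp: power_0_left)
  then have g0: "g 0 = 0" using zero by (simp add: g_def)
  have g1: "g 1 \<ge> 1" using assms(2) norm[of 1] by (simp add: g_def)
  have "\<exists>s. 0 \<le> s \<and> s \<le> 1 \<and> g s = 1"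
    by (rule IVT) (use g0 g1 in \<open>auto simp: g_def intro!: continuous_intros\<close>)
  then obtain s where s: "0 \<le> s" "s \<le> 1" "g s = 1" by blast
  have "s \<noteq> 0" using s(3) g0 by auto
  then show ?thesis using s norm[of s] by (intro that[of s]) (auto simp: g_def)
qed

text \<open>
  A sequence of arcs is rescaled to norm 1; its limit cannot have scaling factor 0, because
  \<open>(1 + p) (1 + q) = 1\<close> has only the trivial solution.
\<close>

lemma near_conic:
  assumes d: "d > 0" and r: "r > 0"
  shows "\<exists>\<delta>>0. \<forall>c x. (\<forall>ij\<in>mon_set d. cmod (c ij - model_conic ij) \<le> \<delta>) \<and> x \<in> contact_arcs d c \<longrightarrow>
    (\<exists>x0\<in>contact_arcs d model_conic. pair_norm (x - x0) \<le> r)"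
proof (rule ccontr)
  assume neg: "\<not> ?thesis"
  have "\<exists>c x. (\<forall>ij\<in>mon_set d. cmod (c ij - model_conic ij) \<le> inverse (real (Suc n))) \<and> x \<in> contact_arcs d c \<and>
    \<not> (\<exists>x0\<in>contact_arcs d model_conic. pair_norm (x - x0) \<le> r)" for n
  proof (rule ccontr)
    assume "\<not> ?thesis"
    with neg show False by (metis inverse_positive_iff_positive of_nat_0_less_iff zero_less_Suc)
  qed
  then have "\<forall>n. \<exists>cx. (\<forall>ij\<in>mon_set d. cmod (fst cx ij - model_conic ij) \<le> inverse (real (Suc n))) \<and>
    snd cx \<in> contact_arcs d (fst cx) \<and> (\<forall>x0\<in>contact_arcs d model_conic. pair_norm (snd cx - x0) > r)"
    by (metis fst_conv snd_conv not_le)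
  from choice[OF this] obtain cx where cx:
    "\<And>n ij. ij \<in> mon_set d \<Longrightarrow> cmod (fst (cx n) ij - model_conic ij) \<le> inverse (real (Suc n))"
    "\<And>n. snd (cx n) \<in> contact_arcs d (fst (cx n))"
    "\<And>n x0. x0 \<in> contact_arcs d model_conic \<Longrightarrow> pair_norm (snd (cx n) - x0) > r" by blast
  define c where "c n = fst (cx n)" for n
  define x where "x n = snd (cx n)" for n
  have x: "x n \<in> contact_arcs d (c n)" for n using cx(2) by (simp add: c_def x_def)
  have x_arcs: "x n \<in> arcs d" for n using x[of n] by (auto simp: contact_arcs_def)
  have clim: "(\<lambda>n. c n ij) \<longlonglongrightarrow> model_conic ij" if "ij \<in> mon_set d" for ij
  proof -
    have "(\<lambda>n. c n ij - model_conic ij) \<longlonglongrightarrow> 0"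
      by (rule Lim_null_comparison[OF always_eventually LIMSEQ_inverse_real_of_nat])
        (use cx(1)[OF that] in \<open>auto simp: c_def\<close>)
    then show ?thesis by (simp add: LIM_zero_iff)
  qed
  have "\<forall>n. \<exists>s. 0 < s \<and> s \<le> 1 \<and> pair_norm (rot (of_real s) (x n)) = 1"
    using rescale_to_norm_1[OF x_arcs contact_arcs_norm_ge_1[OF x]] by metis
  from choice[OF this] obtain s :: "nat \<Rightarrow> real" where
    s: "\<And>n. 0 < s n" "\<And>n. s n \<le> 1" "\<And>n. pair_norm (rot (of_real (s n)) (x n)) = 1" by blast
  define y where "y n = rot (of_real (s n)) (x n)" for n
  have y_arcs: "y n \<in> arcs d" for n unfolding y_def by (rule rot_arcs[OF x_arcs])
  have y_norm: "pair_norm (y n) = 1" for n using s(3) by (simp add: y_def)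
  obtain \<phi> z where \<phi>: "strict_mono \<phi>" and z: "z \<in> arcs d"
    and lim: "coeffs_tendsto (\<lambda>n. fst (y (\<phi> n))) (fst z)" "coeffs_tendsto (\<lambda>n. snd (y (\<phi> n))) (snd z)"
      "(\<lambda>n. pair_norm (y (\<phi> n))) \<longlonglongrightarrow> pair_norm z"
    using arcs_compact[of y d 1, OF y_arcs] y_norm by (metis order_refl)
  have z_norm: "pair_norm z = 1" using lim(3) unfolding y_norm LIMSEQ_const_iff by simp
  have "bounded (range (\<lambda>n. s (\<phi> n)))" unfolding bounded_iff using s by (intro exI[of _ 1]) (auto simp: less_imp_le)
  then obtain l \<psi> where \<psi>: "strict_mono \<psi>" "((\<lambda>n. s (\<phi> n)) \<circ> \<psi>) \<longlonglongrightarrow> l"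
    using bounded_imp_convergent_subsequence by blast
  define \<theta> where "\<theta> n = \<phi> (\<psi> n)" for n
  have sub: "(\<lambda>n. X (\<psi> n)) \<longlonglongrightarrow> L" if "X \<longlonglongrightarrow> L" for X and L :: complex
    using LIMSEQ_subseq_LIMSEQ[OF that \<psi>(1)] by (simp add: o_def)
  have \<theta>: "strict_mono \<theta>" using strict_mono_o[OF \<phi> \<psi>(1)] by (simp add: \<theta>_def[abs_def] o_def)
  have slim: "(\<lambda>n. s (\<theta> n)) \<longlonglongrightarrow> l" using \<psi>(2) by (simp add: \<theta>_def o_def)
  have slim': "(\<lambda>n. complex_of_real (s (\<theta> n))) \<longlonglongrightarrow> of_real l" by (rule tendsto_of_real[OF slim])
  have P: "coeffs_tendsto (\<lambda>n. fst (y (\<theta> n))) (fst z)" and Q: "coeffs_tendsto (\<lambda>n. snd (y (\<theta> n))) (snd z)"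
    using lim(1,2) sub unfolding coeffs_tendsto_def \<theta>_def by blast+
  have l: "l \<ge> 0" using slim s(1) by (intro LIMSEQ_le_const) (auto intro: less_imp_le)
  have clim': "(\<lambda>n. c (\<theta> n) ij) \<longlonglongrightarrow> model_conic ij" if "ij \<in> mon_set d" for ij
    using LIMSEQ_subseq_LIMSEQ[OF clim[OF that] \<theta>] by (simp add: o_def)
  have y_subst: "coeff (curve_subst d (c n) (fst (y n)) (snd (y n))) k = 0" if "k < 2 * d" for n k
    using x[of n] that
    by (auto simp: y_def rot_def curve_subst_pcompose coeff_pcompose_linear contact_arcs_def)
  have z_subst: "coeff (curve_subst d model_conic (fst z) (snd z)) k = 0" if "k < 2 * d" for k
  proof -
    have "coeffs_tendsto (\<lambda>n. curve_subst d (c (\<theta> n)) (fst (y (\<theta> n))) (snd (y (\<theta> n))))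
        (curve_subst d model_conic (fst z) (snd z))"
      by (intro coeffs_tendsto_curve_subst clim' P Q)
    then have "(\<lambda>n. coeff (curve_subst d (c (\<theta> n)) (fst (y (\<theta> n))) (snd (y (\<theta> n)))) k)
        \<longlonglongrightarrow> coeff (curve_subst d model_conic (fst z) (snd z)) k" by (simp add: coeffs_tendsto_def)
    then show ?thesis unfolding y_subst[OF that] LIMSEQ_const_iff by simp
  qed
  have y_lead: "coeff (fst (y n)) d * coeff (snd (y n)) d = - (of_real (s n) ^ (2*d))" for n
  proof -
    have "coeff (fst (y n)) d * coeff (snd (y n)) d =
        of_real (s n) ^ (2*d) * (coeff (fst (x n)) d * coeff (snd (x n)) d)"
      by (simp add: y_def rot_def coeff_pcompose_linear mult_2 power_add)
    also have "coeff (fst (x n)) d * coeff (snd (x n)) d = -1" using x[of n] by (auto simp: contact_arcs_def)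
    finally show ?thesis by simp
  qed
  have z_lead: "coeff (fst z) d * coeff (snd z) d = - (of_real l ^ (2*d))"
  proof (rule LIMSEQ_unique)
    show "(\<lambda>n. coeff (fst (y (\<theta> n))) d * coeff (snd (y (\<theta> n))) d) \<longlonglongrightarrow> coeff (fst z) d * coeff (snd z) d"
      using P Q unfolding coeffs_tendsto_def by (intro tendsto_mult) blast+
    show "(\<lambda>n. coeff (fst (y (\<theta> n))) d * coeff (snd (y (\<theta> n))) d) \<longlonglongrightarrow> - (of_real l ^ (2*d))"
      unfolding y_lead by (intro tendsto_minus tendsto_power slim')
  qed
  obtain p q where pq: "z = (p, q)" by fastforce
  have pq_arcs: "(p, q) \<in> arcs d" using z pq by simp
  show False
  proof (cases "l = 0")
    case True
    have deg: "degree p \<le> d" "degree q \<le> d" using pq_arcs by (auto simp: arcs_def)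
    \<comment> \<open>Coefficients below \<open>2 * d\<close> vanish by contact; the one at
      \<open>2 * d\<close> is the product of the top coefficients, a limit of negated powers of
      scaling factors tending to 0.\<close>
    have "p + q + p * q = 0"
    proof (rule poly_eqI)
      fix k
      consider "k < 2 * d" | "k = 2 * d" | "k > 2 * d" by linarith
      then show "coeff (p + q + p * q) k = coeff 0 k"
      proof cases
        case 1
        then show ?thesis using z_subst[of k] by (simp only: pq fst_conv snd_conv curve_subst_conic[OF d]) simp
      next
        case 2
        have "coeff p d * coeff q d = 0" using z_lead True d by (simp add: pq power_0_left)
        then have "coeff (p * q) k = 0" using coeff_mult_arcs[OF pq_arcs] 2 by simp
        moreover have "coeff p k = 0" "coeff q k = 0" using 2 d deg by (simp_all add: coeff_eq_0)
        ultimately show ?thesis by simp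
      next
        case 3
        then have "coeff (p * q) k = 0" "coeff p k = 0" "coeff q k = 0"
          using deg degree_mult_le[of p q] by (simp_all add: coeff_eq_0)
        then show ?thesis by simp
      qed
    qed
    then have prod: "(1 + p) * (1 + q) = 1" by (simp add: algebra_simps)
    have "1 + p \<noteq> 0" "1 + q \<noteq> 0" using prod by auto
    from degree_mult_eq[OF this] have "degree (1 + p) = 0" "degree (1 + q) = 0" unfolding prod by simp_all
    then obtain a b where ab: "1 + p = [:a:]" "1 + q = [:b:]" by (metis degree_eq_zeroE)
    have "p = [:a - 1:]" "q = [:b - 1:]"
      using ab by (metis add_diff_cancel_left' diff_pCons diff_zero one_pCons)+
    then have "p = 0" "q = 0" using pq_arcs by (auto simp: arcs_def)
    then show False using z_norm pq by (simp add: pair_norm_def)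
  next
    case False
    \<comment> \<open>Undoing the rescaling in the limit restores the normalisation, so
      \<open>x'\<close> solves the conic problem; the unscaled arcs tend to it, although they keep
      distance more than \<open>r\<close> from all such solutions.\<close>
    define w where "w = inverse (complex_of_real l)"
    define x' where "x' = rot w z"
    have w: "w ^ (2*d) * of_real l ^ (2*d) = 1" using False by (simp add: w_def flip: power_mult_distrib)
    have x': "x' \<in> contact_arcs d model_conic"
    proof -
      have "(pcompose p [:0, w:], pcompose q [:0, w:]) \<in> arcs d"
        using rot_arcs[OF pq_arcs, of w] by (simp add: rot_def)
      moreover have "coeff (pcompose p [:0, w:]) d * coeff (pcompose q [:0, w:]) d = -1"
      proof -
        have "coeff (pcompose p [:0, w:]) d * coeff (pcompose q [:0, w:]) d = w ^ (2*d) * (coeff p d * coeff q d)"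
          by (simp add: coeff_pcompose_linear mult_2 power_add)
        also have "coeff p d * coeff q d = - (of_real l ^ (2*d))" using z_lead pq by simp
        finally show ?thesis using w by simp
      qed
      moreover have "coeff (curve_subst d model_conic (pcompose p [:0, w:]) (pcompose q [:0, w:])) k = 0" if "k < 2 * d" for k
        using z_subst[OF that] pq by (simp add: curve_subst_pcompose coeff_pcompose_linear)
      ultimately show ?thesis by (simp add: x'_def pq rot_def contact_arcs_def)
    qed
    have winv: "(\<lambda>n. inverse (complex_of_real (s (\<theta> n)))) \<longlonglongrightarrow> w"
      unfolding w_def using slim' False by (intro tendsto_inverse) simp_all
    have xy: "x n = rot (inverse (of_real (s n))) (y n)" for n
      using s(1)[of n] by (simp add: y_def rot_rot)
    have "coeffs_tendsto (\<lambda>n. fst (x (\<theta> n))) (fst x')" "coeffs_tendsto (\<lambda>n. snd (x (\<theta> n))) (snd x')"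
      unfolding xy x'_def rot_def fst_conv snd_conv by (intro coeffs_tendsto_rot winv P Q)+
    moreover have "degree (fst (x n)) \<le> d" "degree (snd (x n)) \<le> d" for n
      using x_arcs[of n] by (auto simp: arcs_def case_prod_beta)
    moreover have "degree (fst x') \<le> d" "degree (snd x') \<le> d"
      using x' by (auto simp: arcs_def contact_arcs_def case_prod_beta)
    ultimately have "(\<lambda>n. l1 (fst (x (\<theta> n)) - fst x') + l1 (snd (x (\<theta> n)) - snd x')) \<longlonglongrightarrow> 0 + 0"
      by (intro tendsto_add coeffs_tendsto_l1_diff[where d = d])
    then have "(\<lambda>n. pair_norm (x (\<theta> n) - x')) \<longlonglongrightarrow> 0" by (simp add: pair_norm_def)
    then have "\<forall>\<^sub>F n in sequentially. pair_norm (x (\<theta> n) - x') < r" using r by (rule order_tendstoD)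
    then obtain n where "pair_norm (x (\<theta> n) - x') < r" unfolding eventually_sequentially by blast
    then show False using cx(3)[OF x', of "\<theta> n"] by (simp add: x_def)
  qed
qed

text \<open>The same parameter \<open>t\<close> serves for all nearby arcs: counterexamples tending
  to \<open>x0\<close> would contradict \<open>simple_at_limit\<close>.\<close>

lemma simple_at_open:
  assumes x0: "x0 \<in> arcs d" "coeff (fst x0) d \<noteq> 0" and t: "simple_at (fst x0) (snd x0) t"
  shows "\<exists>\<rho>>0. \<forall>x\<in>arcs d. pair_norm (x - x0) \<le> \<rho> \<longrightarrow> simple_at (fst x) (snd x) t"
proof (rule ccontr)
  assume neg: "\<not> ?thesis"
  have pd: "poly (pderiv (fst x0)) t \<noteq> 0" using t by (simp add: simple_at_def)
  have "\<forall>n. \<exists>x. x \<in> arcs d \<and> pair_norm (x - x0) \<le> inverse (real (Suc n)) \<and> \<not> simple_at (fst x) (snd x) t"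
  proof
    fix n
    have "inverse (real (Suc n)) > 0" by simp
    with neg show "\<exists>x. x \<in> arcs d \<and> pair_norm (x - x0) \<le> inverse (real (Suc n)) \<and> \<not> simple_at (fst x) (snd x) t"
      by blast
  qed
  from choice[OF this] obtain x where x: "\<And>n. x n \<in> arcs d"
    "\<And>n. pair_norm (x n - x0) \<le> inverse (real (Suc n))" "\<And>n. \<not> simple_at (fst (x n)) (snd (x n)) t" by blast
  have coeff_lim: "(\<lambda>n. coeff (P n) k) \<longlonglongrightarrow> coeff p k"
    if "\<And>n. l1 (P n - p) \<le> pair_norm (x n - x0)" for P p k
  proof -
    have "(\<lambda>n. coeff (P n) k - coeff p k) \<longlonglongrightarrow> 0"
    proof (rule Lim_null_comparison[OF always_eventually LIMSEQ_inverse_real_of_nat], rule allI)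
      fix n
      show "cmod (coeff (P n) k - coeff p k) \<le> inverse (real (Suc n))"
        using norm_coeff_le_l1[of "P n - p" k] that[of n] x(2)[of n] by simp
    qed
    then show ?thesis by (simp add: LIM_zero_iff)
  qed
  have P: "(\<lambda>n. coeff (fst (x n)) k) \<longlonglongrightarrow> coeff (fst x0) k" for k
    by (rule coeff_lim) (simp add: pair_norm_def)
  have Q: "(\<lambda>n. coeff (snd (x n)) k) \<longlonglongrightarrow> coeff (snd x0) k" for k
    by (rule coeff_lim) (simp add: pair_norm_def)
  have deg: "degree (fst (x n)) \<le> d" "degree (snd (x n)) \<le> d" for n
    using x(1)[of n] by (auto simp: arcs_def case_prod_beta)
  have deg0: "degree (fst x0) \<le> d" "degree (snd x0) \<le> d"
    using x0(1) by (auto simp: arcs_def case_prod_beta)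
  have "(\<lambda>n. poly (pderiv (fst (x n))) t) \<longlonglongrightarrow> poly (pderiv (fst x0)) t"
  proof (rule tendsto_poly[of _ _ d])
    show "(\<lambda>n. coeff (pderiv (fst (x n))) k) \<longlonglongrightarrow> coeff (pderiv (fst x0)) k" for k
      unfolding coeff_pderiv by (intro tendsto_mult tendsto_const P)
    show "degree (pderiv (fst (x n))) \<le> d" for n using deg(1)[of n] by (simp add: degree_pderiv)
    show "degree (pderiv (fst x0)) \<le> d" using deg0(1) by (simp add: degree_pderiv)
  qed simp
  then have "\<forall>\<^sub>F n in sequentially. poly (pderiv (fst (x n))) t \<noteq> 0" using pd by (rule tendsto_imp_eventually_ne)
  then obtain N where N: "\<And>n. n \<ge> N \<Longrightarrow> poly (pderiv (fst (x n))) t \<noteq> 0" unfolding eventually_sequentially by blast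
  \<comment> \<open>Past \<open>N\<close> the derivative at \<open>t\<close> is nonzero, so
    \<open>simple_at\<close> can fail only through a second preimage.\<close>
  have "\<forall>n. \<exists>s. s \<noteq> t \<and> poly (fst (x (n + N))) s = poly (fst (x (n + N))) t \<and>
      poly (snd (x (n + N))) s = poly (snd (x (n + N))) t"
  proof
    fix n
    have "poly (pderiv (fst (x (n + N)))) t \<noteq> 0" by (rule N) simp
    with x(3)[of "n + N"] show "\<exists>s. s \<noteq> t \<and> poly (fst (x (n + N))) s = poly (fst (x (n + N))) t \<and>
      poly (snd (x (n + N))) s = poly (snd (x (n + N))) t" unfolding simple_at_def by blast
  qed
  from choice[OF this] obtain S where S: "\<And>n. S n \<noteq> t"
    "\<And>n. poly (fst (x (n + N))) (S n) = poly (fst (x (n + N))) t"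
    "\<And>n. poly (snd (x (n + N))) (S n) = poly (snd (x (n + N))) t" by blast
  show False
    by (rule simple_at_limit[where P = "\<lambda>n. fst (x (n + N))" and Q = "\<lambda>n. snd (x (n + N))" and S = S and T = "\<lambda>_. t",
        OF LIMSEQ_ignore_initial_segment[OF P] deg(1) deg0(1) LIMSEQ_ignore_initial_segment[OF Q] deg(2) deg0(2)
          x0(2) t tendsto_const S])
qed

lemma uniform_positive_radius:
  fixes P :: "'a \<Rightarrow> real \<Rightarrow> bool"
  assumes "finite B" "\<And>x. x \<in> B \<Longrightarrow> \<exists>r0>0. \<forall>r. 0 < r \<and> r \<le> r0 \<longrightarrow> P x r"
  shows "\<exists>r0>0. \<forall>r. 0 < r \<and> r \<le> r0 \<longrightarrow> (\<forall>x\<in>B. P x r)"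
  using assms
proof (induction B rule: finite_induct)
  case empty
  show ?case by (intro exI[of _ 1]) simp
next
  case (insert x B)
  from insert.IH insert.prems obtain r1 where r1: "r1 > 0" "\<And>r. 0 < r \<and> r \<le> r1 \<Longrightarrow> \<forall>x\<in>B. P x r" by blast
  from insert.prems obtain r2 where r2: "r2 > 0" "\<And>r. 0 < r \<and> r \<le> r2 \<Longrightarrow> P x r" by blast
  show ?case using r1 r2 by (intro exI[of _ "min r1 r2"]) auto
qed

section \<open>Local constancy of the count at the conic\<close>

definition simple_arcs :: "nat \<Rightarrow> (nat \<times> nat \<Rightarrow> complex) \<Rightarrow> (complex poly \<times> complex poly) set" where
  "simple_arcs d c = {x \<in> contact_arcs d c. \<exists>t. simple_at (fst x) (snd x) t}"

lemma simple_arcs_conic: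
  assumes "d > 0"
  shows "simple_arcs d model_conic = primitive_arcs d"
proof -
  have "x \<in> simple_arcs d model_conic \<longleftrightarrow> x \<in> primitive_arcs d" if "x \<in> contact_arcs d model_conic" for x
    using simple_at_conic_iff[OF assms, of "fst x" "snd x"] that by (simp add: simple_arcs_def)
  then show ?thesis unfolding simple_arcs_def primitive_arcs_def by blast
qed

text \<open>Each conic solution has exactly one solution of the perturbed problem nearby, and there
  are no others. This correspondence restricts to simple arcs: simplicity is open in one direction,
  and in the other it passes to the conic through triviality of the rotation stabiliser.\<close>

lemma card_simple_arcs_near_conic:
  assumes d: "d > 0"
  shows "\<exists>\<delta>>0. \<forall>c. (\<forall>ij\<in>mon_set d. cmod (c ij - model_conic ij) \<le> \<delta>) \<longrightarrow>
    finite (simple_arcs d c) \<and> card (simple_arcs d c) = card (primitive_arcs d)"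
proof -
  let ?B = "contact_arcs d model_conic"
  have fin: "finite ?B" by (rule finite_contact_conic[OF d])
  define near where "near c \<delta> \<longleftrightarrow> (\<forall>ij\<in>mon_set d. cmod (c ij - model_conic ij) \<le> \<delta>)"
    for c :: "nat \<times> nat \<Rightarrow> complex" and \<delta> :: real
  have near_mono: "near c \<delta>'" if "near c \<delta>" "\<delta> \<le> \<delta>'" for c \<delta> \<delta>'
    using that unfolding near_def by (meson order_trans)
  define isolated where "isolated c x0 r \<longleftrightarrow> (\<exists>!x. x \<in> contact_arcs d c \<and> pair_norm (x - x0) \<le> r)" for c x0 r
  define stable where "stable x0 r \<longleftrightarrow> (\<exists>\<delta>>0. \<forall>c. near c \<delta> \<longrightarrow> isolated c x0 r)" for x0 r
  have "\<exists>r0>0. \<forall>r. 0 < r \<and> r \<le> r0 \<longrightarrow> (\<forall>x0\<in>?B. stable x0 r)"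
    unfolding stable_def near_def isolated_def
    by (rule uniform_positive_radius[OF fin local_solution[OF d]])
  then obtain r1 where r1: "r1 > 0" "\<And>r x0. 0 < r \<Longrightarrow> r \<le> r1 \<Longrightarrow> x0 \<in> ?B \<Longrightarrow> stable x0 r" by blast
  have "\<exists>r0>0. \<forall>r. 0 < r \<and> r \<le> r0 \<longrightarrow> (\<forall>x0\<in>simple_arcs d model_conic.
    (\<forall>x\<in>arcs d. pair_norm (x - x0) \<le> r \<longrightarrow> (\<exists>t. simple_at (fst x) (snd x) t)))"
  proof (rule uniform_positive_radius)
    show "finite (simple_arcs d model_conic)" using fin by (simp add: simple_arcs_def)
    fix x0 assume x0: "x0 \<in> simple_arcs d model_conic"
    then obtain t where t: "simple_at (fst x0) (snd x0) t" by (auto simp: simple_arcs_def)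
    have "x0 \<in> arcs d" "coeff (fst x0) d \<noteq> 0" using x0 by (auto simp: simple_arcs_def contact_arcs_def)
    from simple_at_open[OF this t] obtain \<rho> where "\<rho> > 0"
      "\<And>x. x \<in> arcs d \<Longrightarrow> pair_norm (x - x0) \<le> \<rho> \<Longrightarrow> simple_at (fst x) (snd x) t" by blast
    then show "\<exists>r0>0. \<forall>r. 0 < r \<and> r \<le> r0 \<longrightarrow> (\<forall>x\<in>arcs d. pair_norm (x - x0) \<le> r \<longrightarrow> (\<exists>t. simple_at (fst x) (snd x) t))"
      by (meson order_trans)
  qed
  then obtain r2 where r2: "r2 > 0" "\<And>r x0 x. 0 < r \<Longrightarrow> r \<le> r2 \<Longrightarrow> x0 \<in> simple_arcs d model_conic \<Longrightarrow>
    x \<in> arcs d \<Longrightarrow> pair_norm (x - x0) \<le> r \<Longrightarrow> \<exists>t. simple_at (fst x) (snd x) t" by blast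
  have "\<exists>r0>0. \<forall>r. 0 < r \<and> r \<le> r0 \<longrightarrow> (\<forall>xy\<in>?B \<times> ?B. fst xy \<noteq> snd xy \<longrightarrow> pair_norm (fst xy - snd xy) > 2 * r)"
  proof (rule uniform_positive_radius)
    show "finite (?B \<times> ?B)" using fin by simp
    fix xy :: "(complex poly \<times> complex poly) \<times> (complex poly \<times> complex poly)"
    show "\<exists>r0>0. \<forall>r. 0 < r \<and> r \<le> r0 \<longrightarrow> fst xy \<noteq> snd xy \<longrightarrow> pair_norm (fst xy - snd xy) > 2 * r"
    proof (cases "fst xy = snd xy")
      case True
      then show ?thesis by (intro exI[of _ 1]) simp
    next
      case False
      then have "pair_norm (fst xy - snd xy) \<noteq> 0" by simp
      then have "pair_norm (fst xy - snd xy) > 0" using pair_norm_nonneg[of "fst xy - snd xy"] by linarith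
      then show ?thesis by (intro exI[of _ "pair_norm (fst xy - snd xy) / 3"]) auto
    qed
  qed
  then obtain r3 where r3: "r3 > 0" "\<And>r x y. 0 < r \<Longrightarrow> r \<le> r3 \<Longrightarrow> x \<in> ?B \<Longrightarrow> y \<in> ?B \<Longrightarrow> x \<noteq> y \<Longrightarrow> pair_norm (x - y) > 2 * r"
    by (metis fst_conv mem_Times_iff snd_conv)
  \<comment> \<open>\<open>r1\<close> provides one solution in each ball, \<open>r2\<close> makes
    solutions near a simple arc simple, and \<open>r3\<close> separates the balls.\<close>
  define r where "r = min r1 (min r2 r3)"
  have r: "r > 0" "r \<le> r1" "r \<le> r2" "r \<le> r3" using r1(1) r2(1) r3(1) by (simp_all add: r_def)
  have "\<exists>\<delta>0>0. \<forall>\<delta>. 0 < \<delta> \<and> \<delta> \<le> \<delta>0 \<longrightarrow> (\<forall>x0\<in>?B. \<forall>c. near c \<delta> \<longrightarrow> isolated c x0 r)"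
  proof (rule uniform_positive_radius[OF fin])
    fix x0 assume "x0 \<in> ?B"
    from r1(2)[OF r(1,2) this] obtain \<delta>0 where "\<delta>0 > 0" "\<And>c. near c \<delta>0 \<Longrightarrow> isolated c x0 r"
      unfolding stable_def by blast
    then show "\<exists>\<delta>0>0. \<forall>\<delta>. 0 < \<delta> \<and> \<delta> \<le> \<delta>0 \<longrightarrow> (\<forall>c. near c \<delta> \<longrightarrow> isolated c x0 r)"
      using near_mono by blast
  qed
  then obtain \<delta>1 where \<delta>1: "\<delta>1 > 0" "\<And>\<delta> x0 c. 0 < \<delta> \<Longrightarrow> \<delta> \<le> \<delta>1 \<Longrightarrow> x0 \<in> ?B \<Longrightarrow> near c \<delta> \<Longrightarrow> isolated c x0 r"
    by blast
  have "\<exists>\<delta>>0. \<forall>c x. near c \<delta> \<and> x \<in> contact_arcs d c \<longrightarrow> (\<exists>x0\<in>?B. pair_norm (x - x0) \<le> r)"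
    unfolding near_def by (rule near_conic[OF d r(1)])
  then obtain \<delta>2 where \<delta>2: "\<delta>2 > 0"
    "\<And>c x. near c \<delta>2 \<Longrightarrow> x \<in> contact_arcs d c \<Longrightarrow> \<exists>x0\<in>?B. pair_norm (x - x0) \<le> r" by blast
  \<comment> \<open>\<open>\<delta>1\<close> gives existence and uniqueness inside the balls,
    \<open>\<delta>2\<close> excludes solutions outside them.\<close>
  define \<delta> where "\<delta> = min \<delta>1 \<delta>2"
  have \<delta>: "\<delta> > 0" "\<delta> \<le> \<delta>1" "\<delta> \<le> \<delta>2" using \<delta>1(1) \<delta>2(1) by (simp_all add: \<delta>_def)
  have main: "finite (simple_arcs d c) \<and> card (simple_arcs d c) = card (primitive_arcs d)"
    if c: "near c \<delta>" for c
  proof -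
    have c2: "near c \<delta>2" using near_mono[OF c \<delta>(3)] .
    have iso: "isolated c x0 r" if "x0 \<in> ?B" for x0 using \<delta>1(2)[OF \<delta>(1,2) that c] .
    have "\<forall>x0. \<exists>x. x0 \<in> ?B \<longrightarrow> x \<in> contact_arcs d c \<and> pair_norm (x - x0) \<le> r"
      using iso unfolding isolated_def by blast
    from choice[OF this] obtain s where s: "\<And>x0. x0 \<in> ?B \<Longrightarrow> s x0 \<in> contact_arcs d c"
      "\<And>x0. x0 \<in> ?B \<Longrightarrow> pair_norm (s x0 - x0) \<le> r" by blast
    have uniq: "x = s x0" if "x0 \<in> ?B" "x \<in> contact_arcs d c" "pair_norm (x - x0) \<le> r" for x x0
      using iso[OF that(1)] s[OF that(1)] that(2,3) unfolding isolated_def by blast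
    have "bij_betw s (simple_arcs d model_conic) (simple_arcs d c)"
      unfolding bij_betw_def
    proof
      show "inj_on s (simple_arcs d model_conic)"
      proof (rule inj_onI, rule ccontr)
        fix x y assume x: "x \<in> simple_arcs d model_conic" and y: "y \<in> simple_arcs d model_conic" and eq: "s x = s y" and ne: "x \<noteq> y"
        have xy: "x \<in> ?B" "y \<in> ?B" using x y by (simp_all add: simple_arcs_def)
        have "pair_norm (x - y) \<le> pair_norm (x - s x) + pair_norm (s x - y)" by (rule pair_norm_triangle)
        also have "\<dots> \<le> r + r"
          using s(2)[OF xy(1)] s(2)[OF xy(2)] by (simp add: eq[symmetric] pair_norm_minus_commute[of x])
        finally show False using r3(2)[OF r(1,4) xy ne] by simp
      qed
      show "s ` simple_arcs d model_conic = simple_arcs d c"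
      proof (intro equalityI subsetI)
        fix x assume "x \<in> s ` simple_arcs d model_conic"
        then obtain x0 where x0: "x0 \<in> simple_arcs d model_conic" "x = s x0" by blast
        then have B: "x0 \<in> ?B" by (simp add: simple_arcs_def)
        have "s x0 \<in> arcs d" using s(1)[OF B] by (auto simp: contact_arcs_def)
        from r2(2)[OF r(1,3) x0(1) this s(2)[OF B]] s(1)[OF B] show "x \<in> simple_arcs d c"
          by (simp add: simple_arcs_def x0(2))
      next
        fix x assume x: "x \<in> simple_arcs d c"
        then have xc: "x \<in> contact_arcs d c" by (simp add: simple_arcs_def)
        from x obtain t where t: "simple_at (fst x) (snd x) t" by (auto simp: simple_arcs_def)
        obtain x0 where x0: "x0 \<in> ?B" "pair_norm (x - x0) \<le> r" using \<delta>2(2)[OF c2 xc] by blast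
        have xs: "x = s x0" by (rule uniq[OF x0(1) xc x0(2)])
        \<comment> \<open>A rotation fixing \<open>x0\<close> maps \<open>x\<close> to a solution
          equally close to \<open>x0\<close>. Uniqueness gives \<open>rot z x = x\<close>, and
          simplicity of \<open>x\<close> gives \<open>z = 1\<close>.\<close>
        have "z = 1" if z: "z ^ (2*d) = 1" "rot z x0 = x0" for z
        proof -
          have "cmod z ^ (2*d) = 1" using z(1) by (metis norm_one norm_power)
          then have "cmod z = 1" using d power_eq_imp_eq_base[of "cmod z" "2*d" 1] by simp
          then have "pair_norm (rot z (x - x0)) \<le> r" using x0(2) by (simp only: pair_norm_rot)
          then have "pair_norm (rot z x - x0) \<le> r" by (simp only: rot_diff z(2))
          then have "rot z x = s x0" by (rule uniq[OF x0(1) rot_contact_arcs[OF xc z(1)]])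
          then have "rot z (fst x, snd x) = (fst x, snd x)" using xs by simp
          then show ?thesis by (rule simple_at_rot_fixed[OF t])
        qed
        then have "x0 \<in> primitive_arcs d" using x0(1) by (simp only: primitive_arcs_def) blast
        then show "x \<in> s ` simple_arcs d model_conic" unfolding simple_arcs_conic[OF d] using xs by blast
      qed
    qed
    then show ?thesis
      using bij_betw_same_card bij_betw_finite finite_primitive_arcs[OF d] simple_arcs_conic[OF d] by metis
  qed
  show ?thesis
    by (rule exI[of _ \<delta>]) (intro conjI \<delta>(1) allI impI main[unfolded near_def]; assumption)
qed

subsection \<open>Real arcs\<close>

definition conj_arc :: "complex poly \<times> complex poly \<Rightarrow> complex poly \<times> complex poly" where
  "conj_arc x = (map_poly cnj (fst x), map_poly cnj (snd x))"

lemma coeff_map_cnj: "coeff (map_poly cnj p) k = cnj (coeff p k)"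
  by (simp add: coeff_map_poly)

lemma map_cnj_mult: "map_poly cnj (p * q) = map_poly cnj p * map_poly cnj q"
  by (simp add: poly_eq_iff coeff_map_cnj coeff_mult)

lemma map_cnj_power: "map_poly cnj (p ^ n) = map_poly cnj p ^ n"
  by (induction n) (simp_all add: map_cnj_mult map_poly_1)

lemma map_cnj_pderiv: "pderiv (map_poly cnj p) = map_poly cnj (pderiv p)"
  by (simp add: poly_eq_iff coeff_map_cnj coeff_pderiv)

lemma poly_map_cnj: "poly (map_poly cnj p) t = cnj (poly p (cnj t))"
  using poly_cnj[of p "cnj t"] by simp

lemma curve_subst_cnj:
  "curve_subst d (\<lambda>ij. of_real (c ij)) (map_poly cnj p) (map_poly cnj q)
    = map_poly cnj (curve_subst d (\<lambda>ij. of_real (c ij)) p q)"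
  by (simp add: poly_eq_iff coeff_map_cnj curve_subst_def coeff_sum case_prod_beta
      flip: map_cnj_mult map_cnj_power)

lemma degree_map_cnj: "degree (map_poly cnj p) = degree p"
  by (simp add: degree_map_poly)

lemma conj_arc_simple_arcs:
  assumes "x \<in> simple_arcs d (\<lambda>ij. of_real (c ij))"
  shows "conj_arc x \<in> simple_arcs d (\<lambda>ij. of_real (c ij))"
proof -
  obtain p q where x: "x = (p, q)" by fastforce
  have c: "(p, q) \<in> contact_arcs d (\<lambda>ij. of_real (c ij))" using assms by (simp add: x simple_arcs_def)
  then have arcs: "degree p \<le> d" "degree q \<le> d" "coeff p 0 = 0" "coeff q 0 = 0"
    and lead: "coeff p d * coeff q d = -1"
    and sub: "\<And>k. k < 2*d \<Longrightarrow> coeff (curve_subst d (\<lambda>ij. of_real (c ij)) p q) k = 0"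
    by (simp_all add: contact_arcs_def arcs_def)
  have "cnj (coeff p d) * cnj (coeff q d) = cnj (coeff p d * coeff q d)" by simp
  also have "\<dots> = -1" unfolding lead by simp
  finally have "(map_poly cnj p, map_poly cnj q) \<in> contact_arcs d (\<lambda>ij. of_real (c ij))"
    using arcs sub by (simp add: contact_arcs_def arcs_def degree_map_cnj coeff_map_cnj curve_subst_cnj)
  moreover obtain t where t: "simple_at p q t" using assms by (auto simp: x simple_arcs_def)
  have "simple_at (map_poly cnj p) (map_poly cnj q) (cnj t)"
  proof -
    have "s = cnj t" if "poly p (cnj s) = poly p t" "poly q (cnj s) = poly q t" for s
    proof -
      have "cnj s = t" using t that by (simp add: simple_at_def)
      then show ?thesis by (metis complex_cnj_cnj)
    qed
    then show ?thesis using t by (simp add: simple_at_def map_cnj_pderiv poly_map_cnj)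
  qed
  ultimately show ?thesis by (auto simp: simple_arcs_def conj_arc_def x)
qed

lemma rot_simple_arcs:
  assumes "d > 0" "x \<in> simple_arcs d c" "z ^ (2*d) = 1"
  shows "rot z x \<in> simple_arcs d c"
proof -
  have "z \<noteq> 0" using assms(1,3) by (auto simp: power_0_left)
  moreover obtain t where "simple_at (fst x) (snd x) t" using assms(2) by (auto simp: simple_arcs_def)
  ultimately have "simple_at (fst (rot z x)) (snd (rot z x)) (t / z)"
    unfolding rot_def fst_conv snd_conv by (rule simple_at_rot)
  moreover have "rot z x \<in> contact_arcs d c" using assms(2,3) by (simp add: simple_arcs_def rot_contact_arcs)
  ultimately show ?thesis by (auto simp: simple_arcs_def)
qed

text \<open>
  If no arc were conjugate to one of its own rotations, rotations and conjugation would act freely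
  on \<open>simple_arcs\<close>, contradicting the count.
\<close>

lemma exists_self_conjugate_arc:
  assumes d: "d > 0" and fin: "finite (simple_arcs d (\<lambda>ij. of_real (c ij)))"
    and card: "\<not> 4 * d dvd card (simple_arcs d (\<lambda>ij. of_real (c ij)))"
  shows "\<exists>x\<in>simple_arcs d (\<lambda>ij. of_real (c ij)). \<exists>z. z ^ (2*d) = 1 \<and> conj_arc x = rot z x"
proof (rule ccontr)
  assume neg: "\<not> ?thesis"
  let ?X = "simple_arcs d (\<lambda>ij. of_real (c ij))"
  have "4 * d dvd card ?X"
  proof (rule free_action_dvd_card[where \<sigma> = conj_arc and \<tau> = cnj, OF fin d])
    show "rot z x \<in> ?X" if "x \<in> ?X" "z ^ (2*d) = 1" for x z using rot_simple_arcs[OF d] that by blast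
    show "conj_arc x \<in> ?X" if "x \<in> ?X" for x using that by (rule conj_arc_simple_arcs)
    show "conj_arc (conj_arc x) = x" for x
      by (simp add: conj_arc_def prod_eq_iff poly_eq_iff coeff_map_cnj)
    show "conj_arc (rot z x) = rot (cnj z) (conj_arc x)" for z x
      by (simp add: conj_arc_def rot_def poly_eq_iff coeff_map_cnj coeff_pcompose_linear)
    show "cnj z ^ (2*d) = 1" if "z ^ (2*d) = 1" for z
      using that by (metis complex_cnj_one complex_cnj_power)
    show "z = 1" if x: "x \<in> ?X" and "z ^ (2*d) = 1" and fixed: "rot z x = x" for x z
    proof -
      obtain t where t: "simple_at (fst x) (snd x) t" using x by (auto simp: simple_arcs_def)
      have "rot z (fst x, snd x) = (fst x, snd x)" using fixed by simp
      then show ?thesis by (rule simple_at_rot_fixed[OF t])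
    qed
    show "conj_arc x \<noteq> rot z x" if "x \<in> ?X" "z ^ (2*d) = 1" for x z using that neg by blast
  qed
  with card show False ..
qed

section \<open>From a self-conjugate arc to a real interpolant\<close>

lemma real_poly_of_conj_invariant:
  assumes "\<And>k. cnj (coeff p k) = coeff p k"
  shows "map_poly complex_of_real (map_poly Re p) = p"
  using assms by (simp add: poly_eq_iff coeff_map_poly complex_eq_iff)

text \<open>Both arguments are divisible by the parameter, so a monomial of total degree above
  \<open>2 * d\<close> contributes nothing to the coefficients below \<open>2 * d\<close>. Hence
  \<open>mon_set d\<close> is enough even if \<open>c\<close> has larger support.\<close>

lemma coeff_biv_subst:
  assumes fin: "finite (biv_support c)" and c0: "c (0, 0) = 0" and x: "poly x1 0 = 0" "poly x2 0 = 0"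
    and k: "k < 2 * d"
  shows "complex_of_real (coeff (biv_subst c x1 x2) k) =
    coeff (curve_subst d (\<lambda>ij. of_real (c ij)) (map_poly of_real x1) (map_poly of_real x2)) k"
proof -
  let ?f = "\<lambda>ij. c ij * coeff (x1 ^ fst ij * x2 ^ snd ij) k"
  have "monom 1 1 dvd x1" "monom 1 1 dvd x2" using x by (simp_all add: monom_1_dvd_iff' poly_0_coeff_0)
  then have "monom 1 1 ^ (i + j) dvd x1 ^ i * x2 ^ j" for i j
    unfolding power_add by (intro mult_dvd_mono dvd_power_same)
  then have "monom 1 (i + j) dvd x1 ^ i * x2 ^ j" for i j by (simp add: monom_power)
  then have high: "coeff (x1 ^ i * x2 ^ j) k = 0" if "k < i + j" for i j
    using that by (simp add: monom_1_dvd_iff')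
  have zero: "?f ij = 0" if "ij \<notin> mon_set d" for ij
  proof (cases "ij = (0, 0)")
    case True
    then show ?thesis using c0 by simp
  next
    case False
    then have "fst ij + snd ij > 2 * d" using that by (cases ij) (auto simp: mon_set_def)
    then show ?thesis using high[of "fst ij" "snd ij"] k by simp
  qed
  have "coeff (biv_subst c x1 x2) k = (\<Sum>ij\<in>biv_support c. ?f ij)"
    by (simp add: biv_subst_def coeff_sum case_prod_beta)
  also have "\<dots> = (\<Sum>ij\<in>biv_support c \<union> mon_set d. ?f ij)"
    using fin finite_mon_set by (intro sum.mono_neutral_left) (auto simp: biv_support_def)
  also have "\<dots> = (\<Sum>ij\<in>mon_set d. ?f ij)"
    using fin finite_mon_set zero by (intro sum.mono_neutral_right) auto
  finally have 1: "coeff (biv_subst c x1 x2) k = (\<Sum>ij\<in>mon_set d. ?f ij)" .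
  have hom: "map_poly complex_of_real x1 ^ i * map_poly complex_of_real x2 ^ j = map_poly complex_of_real (x1 ^ i * x2 ^ j)" for i j
  proof -
    have m: "map_poly complex_of_real (p * q) = map_poly complex_of_real p * map_poly complex_of_real q" for p q
      by (simp add: poly_eq_iff coeff_map_poly coeff_mult)
    have "map_poly complex_of_real (p ^ n) = map_poly complex_of_real p ^ n" for p n
      by (induction n) (simp_all add: m map_poly_1)
    then show ?thesis by (simp add: m)
  qed
  show ?thesis unfolding 1 curve_subst_def case_prod_beta coeff_sum coeff_smult hom
    by (simp add: coeff_map_poly)
qed

text \<open>An instance of Hilbert 90: with \<open>\<eta>\<close> a square root of \<open>z\<close>
  on the unit circle, conjugation of the coefficients after substituting \<open>\<eta>\<close> times
  the parameter cancels against \<open>z = \<eta> * \<eta>\<close>, so they are real.\<close>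

lemma real_interpolant_of_self_conjugate:
  assumes d: "d > 0" and fin: "finite (biv_support c)" and c0: "c (0, 0) = 0"
    and x: "x \<in> simple_arcs d (\<lambda>ij. of_real (c ij))" and z: "z ^ (2*d) = 1" and conj: "conj_arc x = rot z x"
  shows "\<exists>x1 x2. real_dd_interpolant c d x1 x2"
proof -
  let ?c = "\<lambda>ij. complex_of_real (c ij)"
  \<comment> \<open>\<open>\<eta>\<close> need not be a \<open>2*d\<close>-th root of unity, as its
    \<open>2*d\<close>-th power is \<open>z ^ d\<close>, which is 1 or -1. The product of top
    coefficients may change sign, but it stays nonzero and the contact is preserved.\<close>
  define \<eta> where "\<eta> = csqrt z"
  have \<eta>2: "\<eta> * \<eta> = z" using power2_csqrt[of z] by (simp add: \<eta>_def power2_eq_square)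
  have "cmod z ^ (2*d) = 1" using z by (metis norm_one norm_power)
  then have "cmod z = 1" using d power_eq_imp_eq_base[of "cmod z" "2*d" 1] by simp
  then have "cmod \<eta> * cmod \<eta> = 1" using \<eta>2 by (metis norm_mult)
  then have "\<eta> * cnj \<eta> = 1" by (simp add: complex_norm_square[symmetric] power2_eq_square flip: of_real_mult)
  then have \<eta>0: "\<eta> \<noteq> 0" and \<eta>c: "cnj \<eta> ^ k * \<eta> ^ k = 1" for k
    by (auto simp: mult.commute simp flip: power_mult_distrib)
  obtain p q where pq: "x = (p, q)" by fastforce
  define p' where "p' = pcompose p [:0, \<eta>:]"
  define q' where "q' = pcompose q [:0, \<eta>:]"
  have real: "cnj (coeff (pcompose r [:0, \<eta>:]) k) = coeff (pcompose r [:0, \<eta>:]) k"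
    if "map_poly cnj r = pcompose r [:0, z:]" for r k
  proof -
    have "cnj (coeff r k) = z ^ k * coeff r k"
      using arg_cong[OF that, of "\<lambda>s. coeff s k"] by (simp add: coeff_map_cnj coeff_pcompose_linear)
    then have "cnj (coeff (pcompose r [:0, \<eta>:]) k) = (cnj \<eta> ^ k * \<eta> ^ k) * (\<eta> ^ k * coeff r k)"
      by (simp add: coeff_pcompose_linear \<eta>2[symmetric] power_mult_distrib mult_ac)
    then show ?thesis by (simp add: \<eta>c coeff_pcompose_linear)
  qed
  have "map_poly cnj p = pcompose p [:0, z:]" "map_poly cnj q = pcompose q [:0, z:]"
    using arg_cong[OF conj, of fst] arg_cong[OF conj, of snd] by (simp_all only: pq conj_arc_def rot_def fst_conv snd_conv)
  note real' = real[OF this(1), folded p'_def] real[OF this(2), folded q'_def]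
  define x1 where "x1 = map_poly Re p'"
  define x2 where "x2 = map_poly Re q'"
  have p': "map_poly complex_of_real x1 = p'" and q': "map_poly complex_of_real x2 = q'"
    unfolding x1_def x2_def using real_poly_of_conj_invariant real' by blast+
  have pqc: "(p, q) \<in> contact_arcs d ?c" using x by (simp add: pq simple_arcs_def)
  then have lead: "coeff p d * coeff q d = -1"
    and sub: "\<And>k. k < 2*d \<Longrightarrow> coeff (curve_subst d ?c p q) k = 0" and pq_arcs: "(p, q) \<in> arcs d"
    by (simp_all add: contact_arcs_def)
  have arcs': "(p', q') \<in> arcs d" using rot_arcs[OF pq_arcs, of \<eta>] by (simp add: rot_def p'_def q'_def)
  have lead': "coeff p' d \<noteq> 0" "coeff q' d \<noteq> 0"
    using lead \<eta>0 by (auto simp: p'_def q'_def coeff_pcompose_linear)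
  then have deg': "degree p' = d" "degree q' = d"
    using arcs' by (auto simp: arcs_def le_degree intro: le_antisym)
  have deg: "degree x1 = d" "degree x2 = d"
    using deg' by (simp_all add: degree_map_poly flip: p' q')
  have zero: "poly x1 0 = 0" "poly x2 0 = 0"
  proof -
    have "complex_of_real (coeff x1 0) = coeff p' 0" "complex_of_real (coeff x2 0) = coeff q' 0"
      by (simp_all add: coeff_map_poly flip: p' q')
    then show "poly x1 0 = 0" "poly x2 0 = 0" using arcs' by (simp_all add: arcs_def poly_0_coeff_0)
  qed
  have "generically_injective p' q'"
  proof -
    obtain t where "simple_at p q t" using x by (auto simp: pq simple_arcs_def)
    from simple_at_rot[OF \<eta>0 this] have "simple_at p' q' (t / \<eta>)" by (simp add: p'_def q'_def)
    from simple_at_imp_generically_injective[OF arcs' lead'(1) this] show ?thesis .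
  qed
  moreover have "[:0, 1:] ^ (2 * d) dvd biv_subst c x1 x2"
  proof -
    have "coeff (biv_subst c x1 x2) k = 0" if "k < 2 * d" for k
    proof -
      have "complex_of_real (coeff (biv_subst c x1 x2) k) = coeff (curve_subst d ?c p' q') k"
        using coeff_biv_subst[where d = d, OF fin c0 zero that] by (simp only: p' q')
      also have "\<dots> = 0"
        using sub[OF that] by (simp add: p'_def q'_def curve_subst_pcompose coeff_pcompose_linear)
      finally show ?thesis by simp
    qed
    then have "monom 1 (2 * d) dvd biv_subst c x1 x2" by (simp add: monom_1_dvd_iff')
    moreover have "[:0, 1:] ^ (2 * d) = (monom 1 (2 * d) :: real poly)"
      by (simp add: monom_altdef)
    ultimately show ?thesis by simp
  qed
  ultimately have "real_dd_interpolant c d x1 x2"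
    unfolding real_dd_interpolant_def p' q' using deg zero by blast
  then show ?thesis by blast
qed

section \<open>Transfer of the count to generic real curves\<close>

lemma simple_arcs_cong:
  assumes "\<And>ij. ij \<in> mon_set d \<Longrightarrow> a ij = b ij"
  shows "simple_arcs d a = simple_arcs d b"
proof -
  have "curve_subst d a p q = curve_subst d b p q" for p q
    unfolding curve_subst_def using assms by (intro sum.cong refl) auto
  then show ?thesis by (simp add: simple_arcs_def contact_arcs_def)
qed

lemma constructible_card_simple_arcs:
  "{c. finite (simple_arcs d c) \<and> card (simple_arcs d c) = K} \<in> constructible"
proof -
  define S where "S = {v :: nat \<times> nat + nat \<Rightarrow> complex.
      (arc_fst d (v \<circ> Inr), arc_snd d (v \<circ> Inr)) \<in> contact_arcs d (v \<circ> Inl)} \<inter>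
    {v. \<exists>t. simple_at (arc_fst d (v \<circ> Inr)) (arc_snd d (v \<circ> Inr)) t}"
  have S: "S \<in> constructible"
    unfolding S_def by (intro constructible.inter constructible_contact constructible_simple_at)
  have in_S: "case_sum c x \<in> S \<longleftrightarrow> (arc_fst d x, arc_snd d x) \<in> simple_arcs d c" for c x
  proof -
    have "case_sum c x \<circ> Inr = x" "case_sum c x \<circ> Inl = c" by (simp_all add: fun_eq_iff)
    then show ?thesis by (simp add: S_def simple_arcs_def)
  qed
  let ?V = "{x :: nat \<Rightarrow> complex. \<forall>i. i \<notin> {1..2*d} \<longrightarrow> x i = 0}"
  have bij: "bij_betw (\<lambda>x. (arc_fst d x, arc_snd d x))
      {x. (\<forall>i. i \<notin> {1..2*d} \<longrightarrow> x i = 0) \<and> case_sum c x \<in> S} (simple_arcs d c)" for c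
    unfolding bij_betw_def
  proof
    show "inj_on (\<lambda>x. (arc_fst d x, arc_snd d x)) {x. (\<forall>i. i \<notin> {1..2*d} \<longrightarrow> x i = 0) \<and> case_sum c x \<in> S}"
      by (rule inj_on_subset[OF bij_betw_imp_inj_on[OF bij_betw_arcs]]) blast
    have sub: "simple_arcs d c \<subseteq> (\<lambda>x. (arc_fst d x, arc_snd d x)) ` ?V"
      unfolding bij_betw_imp_surj_on[OF bij_betw_arcs] by (auto simp: simple_arcs_def contact_arcs_def)
    show "(\<lambda>x. (arc_fst d x, arc_snd d x)) ` {x. (\<forall>i. i \<notin> {1..2*d} \<longrightarrow> x i = 0) \<and> case_sum c x \<in> S} = simple_arcs d c"
    proof (intro equalityI subsetI)
      fix y assume "y \<in> (\<lambda>x. (arc_fst d x, arc_snd d x)) ` {x. (\<forall>i. i \<notin> {1..2*d} \<longrightarrow> x i = 0) \<and> case_sum c x \<in> S}"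
      then show "y \<in> simple_arcs d c" using in_S by blast
    next
      fix y assume y: "y \<in> simple_arcs d c"
      with sub obtain x where "x \<in> ?V" "y = (arc_fst d x, arc_snd d x)" by blast
      with y in_S[of c x] show "y \<in> (\<lambda>x. (arc_fst d x, arc_snd d x)) ` {x. (\<forall>i. i \<notin> {1..2*d} \<longrightarrow> x i = 0) \<and> case_sum c x \<in> S}"
        by blast
    qed
  qed
  have "{c. finite {x. (\<forall>i. i \<notin> {1..2*d} \<longrightarrow> x i = 0) \<and> case_sum c x \<in> S} \<and>
      card {x. (\<forall>i. i \<notin> {1..2*d} \<longrightarrow> x i = 0) \<and> case_sum c x \<in> S} = K} \<in> constructible"
    by (rule constructible_card_eq[OF S finite_atLeastAtMost])
  then show ?thesis unfolding bij_betw_finite[OF bij] bij_betw_same_card[OF bij] .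
qed

theorem theorem4p3:
  fixes d :: nat
  assumes "d > 0" and "squarefree d"
  shows "\<exists>Z. zariski_closed_in (mon_set d) Z \<and> Z \<noteq> coord_space (mon_set d) \<and>
           (\<forall>c :: nat \<times> nat \<Rightarrow> real.
              finite (biv_support c) \<and> c (0, 0) = 0 \<and>
              restrict_coeffs (mon_set d) c \<notin> Z \<longrightarrow>
              (\<exists>x1 x2 :: real poly. real_dd_interpolant c d x1 x2))"
proof -
  let ?K = "card (primitive_arcs d)"
  define G where "G = {c. finite (simple_arcs d c) \<and> card (simple_arcs d c) = ?K}"
  have "G \<in> constructible" unfolding G_def by (rule constructible_card_simple_arcs)
  then obtain g w where g: "g \<in> pfun" "g w \<noteq> 0" and dich: "(\<forall>v. g v \<noteq> 0 \<longrightarrow> v \<in> G) \<or> (\<forall>v. g v \<noteq> 0 \<longrightarrow> v \<notin> G)"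
    by (rule constructible_generic)
  obtain \<delta> where \<delta>: "\<delta> > 0" "\<And>c. \<forall>ij\<in>mon_set d. cmod (c ij - model_conic ij) \<le> \<delta> \<Longrightarrow> c \<in> G"
    using card_simple_arcs_near_conic[OF assms(1)] unfolding G_def by blast
  \<comment> \<open>Such a point lies in \<open>G\<close> by closeness to the conic, which rules out
    that \<open>g \<noteq> 0\<close> avoids \<open>G\<close>.\<close>
  obtain v where "g v \<noteq> 0" "\<forall>ij\<in>mon_set d. cmod (v ij - model_conic ij) < \<delta>"
    using pfun_nonzero_nearby[OF g finite_mon_set \<delta>(1)] by blast
  moreover from this(2) have "v \<in> G" by (intro \<delta>(2)) (simp add: less_imp_le)
  ultimately have generic: "\<And>v. g v \<noteq> 0 \<Longrightarrow> v \<in> G" using dich by blast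
  \<comment> \<open>The values of \<open>a\<close> outside \<open>mon_set d\<close> freeze those
    coordinates; its values inside show that \<open>h\<close> is not identically zero.\<close>
  obtain a where a: "g (\<lambda>ij. of_real (a ij)) \<noteq> 0" using pfun_real_point[OF g] by blast
  obtain h where h: "poly_fun (mon_set d) h"
    "\<And>c. g (\<lambda>ij. of_real (if ij \<in> mon_set d then c ij else a ij)) = of_real (h c)"
    using pfun_imp_poly_fun[OF g(1) finite_mon_set, of d a] by blast
  define Z where "Z = {x \<in> coord_space (mon_set d). h x = 0}"
  have "zariski_closed_in (mon_set d) Z"
    unfolding zariski_closed_in_def Z_def using h(1) by (intro exI[of _ "{h}"]) simp
  moreover have "Z \<noteq> coord_space (mon_set d)"
  proof
    assume eq: "Z = coord_space (mon_set d)"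
    define b where "b ij = (if ij \<in> mon_set d then a ij else 0)" for ij
    have "b \<in> coord_space (mon_set d)" by (simp add: b_def coord_space_def)
    then have "h b = 0" using eq by (auto simp: Z_def)
    moreover have "(\<lambda>ij. complex_of_real (if ij \<in> mon_set d then b ij else a ij)) = (\<lambda>ij. of_real (a ij))"
      by (auto simp: b_def)
    ultimately show False using h(2)[of b] a by simp
  qed
  moreover have "\<exists>x1 x2. real_dd_interpolant c d x1 x2"
    if c: "finite (biv_support c)" "c (0, 0) = 0" "restrict_coeffs (mon_set d) c \<notin> Z" for c
  proof -
    let ?b = "restrict_coeffs (mon_set d) c"
    \<comment> \<open>Outside \<open>mon_set d\<close> the coefficients are taken from
      \<open>a\<close>, as in the choice of \<open>h\<close>; \<open>simple_arcs\<close> depends on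
      those inside alone, so the count obtained is that of \<open>c\<close>.\<close>
    let ?e = "\<lambda>ij. complex_of_real (if ij \<in> mon_set d then ?b ij else a ij)"
    have "?b \<in> coord_space (mon_set d)" by (simp add: restrict_coeffs_def coord_space_def)
    then have "h ?b \<noteq> 0" using c(3) by (simp add: Z_def)
    then have "g ?e \<noteq> 0" using h(2)[of ?b] by simp
    then have "?e \<in> G" by (rule generic)
    moreover have "simple_arcs d ?e = simple_arcs d (\<lambda>ij. of_real (c ij))"
      by (rule simple_arcs_cong) (simp add: restrict_coeffs_def)
    ultimately have fin: "finite (simple_arcs d (\<lambda>ij. of_real (c ij)))"
      and card: "card (simple_arcs d (\<lambda>ij. of_real (c ij))) = ?K" by (simp_all add: G_def)
    have "\<not> 4 * d dvd card (simple_arcs d (\<lambda>ij. of_real (c ij)))"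
      unfolding card by (rule not_4d_dvd_card_primitive_arcs[OF assms])
    from exists_self_conjugate_arc[OF assms(1) fin this] obtain x z where
      "x \<in> simple_arcs d (\<lambda>ij. of_real (c ij))" "z ^ (2*d) = 1" "conj_arc x = rot z x" by blast
    from real_interpolant_of_self_conjugate[OF assms(1) c(1,2) this] show ?thesis .
  qed
  ultimately show ?thesis by blast
qed

end
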